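(* Let $\Gamma=(V,E)$ be a finite simple graph and $\Bbbk$ a commutative ring with unit. Then for $W\subsetneq U\subseteq V$ and $n\ge 1$, \[ \mathrm{Ext}^n_{\Bbbk B(\Gamma)}(\Bbbk_U,\Bbbk_W)\cong \widetilde H^{n-1}\big(\mathsf{Cliq}(\Gamma[U\setminus W]),\Bbbk\big). \]
   Context: $B(\Gamma)$ is the free partially commutative left regular band: the monoid with presentation $\langle V\mid x^2=x,\ xyx=xy \text{ for all words } x,y,\ \ xy=yx \text{ for all edges }\{x,y\}\in E\rangle$; equivalently the quotient of the free left regular band on $V$ (repetition-free words, multiplication by concatenation and deletion of repeated letters) by the relations $xy=yx$ for edges. Every element $b$ has a well-defined content $c(b)\subseteq V$ (set of letters occurring). For $U\subseteq V$, $\Bbbk_U$ is the $\Bbbk B(\Gamma)$-module $\Bbbk$ on which $b$ acts as the identity if $c(b)\subseteq U$ and as $0$ otherwise. $\Gamma[S]$ is the induced subgraph on $S$, and $\mathsf{Cliq}(G)$ is the clique complex (simplices = vertex sets of complete subgraphs); $\widetilde H$ is reduced cohomology. *)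

theory Defs
  imports "HOL-Algebra.Module" "HOL-Algebra.AbelCoset" "HOL-Combinatorics.Permutations"
begin

section \<open>Modules over a not necessarily commutative ring\<close>

text \<open>
  The library locale \<open>module\<close> requires a commutative ring of scalars. We keep its record type,
  whose ring multiplication and unit carry no information for a module.
\<close>

definition mk_module ::
    "'m set \<Rightarrow> 'm \<Rightarrow> ('m \<Rightarrow> 'm \<Rightarrow> 'm) \<Rightarrow> ('r \<Rightarrow> 'm \<Rightarrow> 'm) \<Rightarrow> ('r, 'm) module" where
  "mk_module C z a s =
     \<lparr>carrier = C, monoid.mult = undefined, one = undefined, zero = z, add = a, smult = s\<rparr>"

lemma mk_module_simps [simp]:
  "carrier (mk_module C z a s) = C" "zero (mk_module C z a s) = z"
  "add (mk_module C z a s) = a" "smult (mk_module C z a s) = s"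
  by (simp_all add: mk_module_def)

locale left_module = R?: ring R + M?: abelian_group M
  for R (structure) and M (structure) +
  assumes smult_closed:
      "\<lbrakk>a \<in> carrier R; x \<in> carrier M\<rbrakk> \<Longrightarrow> a \<odot>\<^bsub>M\<^esub> x \<in> carrier M"
    and smult_l_distr:
      "\<lbrakk>a \<in> carrier R; b \<in> carrier R; x \<in> carrier M\<rbrakk> \<Longrightarrow>
        (a \<oplus> b) \<odot>\<^bsub>M\<^esub> x = a \<odot>\<^bsub>M\<^esub> x \<oplus>\<^bsub>M\<^esub> b \<odot>\<^bsub>M\<^esub> x"
    and smult_r_distr:
      "\<lbrakk>a \<in> carrier R; x \<in> carrier M; y \<in> carrier M\<rbrakk> \<Longrightarrow>
        a \<odot>\<^bsub>M\<^esub> (x \<oplus>\<^bsub>M\<^esub> y) = a \<odot>\<^bsub>M\<^esub> x \<oplus>\<^bsub>M\<^esub> a \<odot>\<^bsub>M\<^esub> y"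
    and smult_assoc:
      "\<lbrakk>a \<in> carrier R; b \<in> carrier R; x \<in> carrier M\<rbrakk> \<Longrightarrow>
        (a \<otimes> b) \<odot>\<^bsub>M\<^esub> x = a \<odot>\<^bsub>M\<^esub> (b \<odot>\<^bsub>M\<^esub> x)"
    and smult_one: "x \<in> carrier M \<Longrightarrow> \<one> \<odot>\<^bsub>M\<^esub> x = x"

text \<open>Homomorphisms are extensional, so that sets of homomorphisms can serve as carriers.\<close>

definition mod_hom ::
    "('r, 'z) ring_scheme \<Rightarrow> ('r, 'm, 'x) module_scheme \<Rightarrow> ('r, 'n, 'y) module_scheme
      \<Rightarrow> ('m \<Rightarrow> 'n) set" where
  "mod_hom R M N = {h \<in> carrier M \<rightarrow>\<^sub>E carrier N.
     (\<forall>x\<in>carrier M. \<forall>y\<in>carrier M. h (x \<oplus>\<^bsub>M\<^esub> y) = h x \<oplus>\<^bsub>N\<^esub> h y) \<and>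
     (\<forall>a\<in>carrier R. \<forall>x\<in>carrier M. h (a \<odot>\<^bsub>M\<^esub> x) = a \<odot>\<^bsub>N\<^esub> h x)}"

definition mod_isomorphic ::
    "('r, 'z) ring_scheme \<Rightarrow> ('r, 'm, 'x) module_scheme \<Rightarrow> ('r, 'n, 'y) module_scheme \<Rightarrow> bool" where
  "mod_isomorphic R M N \<longleftrightarrow> (\<exists>h\<in>mod_hom R M N. bij_betw h (carrier M) (carrier N))"

definition mod_quotient :: "('r, 'm, 'x) module_scheme \<Rightarrow> 'm set \<Rightarrow> ('r, 'm set) module" where
  "mod_quotient M H = mk_module (a_rcosets\<^bsub>M\<^esub> H) H (\<lambda>X Y. X <+>\<^bsub>M\<^esub> Y)
     (\<lambda>r X. \<Union>x\<in>X. H +>\<^bsub>M\<^esub> (r \<odot>\<^bsub>M\<^esub> x))"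


section \<open>Projective resolutions, cohomology and Ext\<close>

definition fin_supp :: "('r, 'z) ring_scheme \<Rightarrow> 'x set \<Rightarrow> ('x \<Rightarrow> 'r) set" where
  "fin_supp R X = {f \<in> X \<rightarrow> carrier R. (\<forall>x. x \<notin> X \<longrightarrow> f x = \<zero>\<^bsub>R\<^esub>) \<and> finite {x. f x \<noteq> \<zero>\<^bsub>R\<^esub>}}"

definition free_module :: "('r, 'z) ring_scheme \<Rightarrow> 'x set \<Rightarrow> ('r, 'x \<Rightarrow> 'r) module" where
  "free_module R X = mk_module (fin_supp R X) (\<lambda>x. \<zero>\<^bsub>R\<^esub>)
     (\<lambda>f g x. f x \<oplus>\<^bsub>R\<^esub> g x) (\<lambda>a f x. a \<otimes>\<^bsub>R\<^esub> f x)"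

text \<open>
  A module is projective if it is a direct summand of a free module. Restricting the basis to be
  a subset of the type of module elements is harmless: a projective module \<open>P\<close> is a direct
  summand of the free module on the set \<open>carrier P\<close>, which surjects onto \<open>P\<close>.
\<close>

definition projective_module :: "('r, 'z) ring_scheme \<Rightarrow> ('r, 'm, 'x) module_scheme \<Rightarrow> bool" where
  "projective_module R P \<longleftrightarrow> left_module R P \<and>
     (\<exists>(X :: 'm set) i p. i \<in> mod_hom R P (free_module R X) \<and> p \<in> mod_hom R (free_module R X) P \<and>
        (\<forall>x\<in>carrier P. p (i x) = x))"

text \<open>
  \<open>\<dots> \<rightarrow> P 2 \<rightarrow> P 1 \<rightarrow> P 0 \<rightarrow> M \<rightarrow> 0\<close> with maps \<open>d n\<close> from \<open>P (Suc n)\<close> to \<open>P n\<close> and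
  augmentation \<open>e\<close>.
\<close>

definition projective_resolution ::
    "('r, 'z) ring_scheme \<Rightarrow> (nat \<Rightarrow> ('r, 'p) module) \<Rightarrow> (nat \<Rightarrow> 'p \<Rightarrow> 'p) \<Rightarrow> ('p \<Rightarrow> 'm)
      \<Rightarrow> ('r, 'm) module \<Rightarrow> bool" where
  "projective_resolution R P d e M \<longleftrightarrow>
     left_module R M \<and>
     (\<forall>n. projective_module R (P n)) \<and>
     e \<in> mod_hom R (P 0) M \<and> (\<forall>n. d n \<in> mod_hom R (P (Suc n)) (P n)) \<and>
     e ` carrier (P 0) = carrier M \<and>
     d 0 ` carrier (P 1) = a_kernel (P 0) M e \<and>
     (\<forall>n. d (Suc n) ` carrier (P (Suc (Suc n))) = a_kernel (P (Suc n)) (P n) (d n))"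

text \<open>Cochain complexes \<open>C 0 \<rightarrow> C 1 \<rightarrow> C 2 \<rightarrow> \<dots>\<close> with maps \<open>d n\<close> from \<open>C n\<close> to \<open>C (Suc n)\<close>.\<close>

definition cocycles :: "(nat \<Rightarrow> ('r, 'm) module) \<Rightarrow> (nat \<Rightarrow> 'm \<Rightarrow> 'm) \<Rightarrow> nat \<Rightarrow> 'm set" where
  "cocycles C d n = a_kernel (C n) (C (Suc n)) (d n)"

definition coboundaries :: "(nat \<Rightarrow> ('r, 'm) module) \<Rightarrow> (nat \<Rightarrow> 'm \<Rightarrow> 'm) \<Rightarrow> nat \<Rightarrow> 'm set" where
  "coboundaries C d n =
     (case n of 0 \<Rightarrow> {\<zero>\<^bsub>C 0\<^esub>} | Suc m \<Rightarrow> d m ` carrier (C m))"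

definition cohomology ::
    "(nat \<Rightarrow> ('r, 'm) module) \<Rightarrow> (nat \<Rightarrow> 'm \<Rightarrow> 'm) \<Rightarrow> nat \<Rightarrow> ('r, 'm set) module" where
  "cohomology C d n =
     mod_quotient ((C n)\<lparr>carrier := cocycles C d n\<rparr>) (coboundaries C d n)"

text \<open>
  For an algebra \<open>A\<close> over a commutative ring, \<open>Hom\<^sub>A(M, N)\<close> is a module over that ring; a
  scalar \<open>r\<close> acts on \<open>N\<close> as the central element \<open>r \<odot>\<^bsub>A\<^esub> \<one>\<^bsub>A\<^esub>\<close> of \<open>A\<close>.
\<close>

definition hom_module ::
    "('k, 'a, 'z) module_scheme \<Rightarrow> ('a, 'm) module \<Rightarrow> ('a, 'n) module \<Rightarrow> ('k, 'm \<Rightarrow> 'n) module" where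
  "hom_module A M N = mk_module (mod_hom A M N)
     (\<lambda>x\<in>carrier M. \<zero>\<^bsub>N\<^esub>)
     (\<lambda>f g. \<lambda>x\<in>carrier M. f x \<oplus>\<^bsub>N\<^esub> g x)
     (\<lambda>r f. \<lambda>x\<in>carrier M. (r \<odot>\<^bsub>A\<^esub> \<one>\<^bsub>A\<^esub>) \<odot>\<^bsub>N\<^esub> f x)"

text \<open>
  \<open>Ext A P d N n\<close> is the \<open>n\<close>-th Ext module of \<open>M\<close> and \<open>N\<close> computed from the projective
  resolution \<open>(P, d)\<close> of \<open>M\<close>.
\<close>

definition Ext ::
    "('k, 'a, 'z) module_scheme \<Rightarrow> (nat \<Rightarrow> ('a, 'p) module) \<Rightarrow> (nat \<Rightarrow> 'p \<Rightarrow> 'p)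
      \<Rightarrow> ('a, 'n) module \<Rightarrow> nat \<Rightarrow> ('k, ('p \<Rightarrow> 'n) set) module" where
  "Ext A P d N n = cohomology (\<lambda>i. hom_module A (P i) N)
     (\<lambda>i f. compose (carrier (P (Suc i))) f (d i)) n"


section \<open>The free partially commutative left regular band and its algebra\<close>

definition simple_graph :: "'v set \<Rightarrow> 'v set set \<Rightarrow> bool" where
  "simple_graph V E \<longleftrightarrow> finite V \<and> (\<forall>e\<in>E. e \<subseteq> V \<and> card e = 2)"

definition induced_edges :: "'v set set \<Rightarrow> 'v set \<Rightarrow> 'v set set" where
  "induced_edges E S = {e \<in> E. e \<subseteq> S}"

text \<open>The congruence on the free monoid \<open>lists G\<close> generated by a set of relations.\<close>

inductive_set monoid_congruence :: "'a set \<Rightarrow> ('a list \<times> 'a list) set \<Rightarrow> ('a list \<times> 'a list) set"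
  for G :: "'a set" and R :: "('a list \<times> 'a list) set" where
  cong_rel: "\<lbrakk>(u, v) \<in> R; u \<in> lists G; v \<in> lists G\<rbrakk> \<Longrightarrow> (u, v) \<in> monoid_congruence G R"
| cong_refl: "u \<in> lists G \<Longrightarrow> (u, u) \<in> monoid_congruence G R"
| cong_sym: "(u, v) \<in> monoid_congruence G R \<Longrightarrow> (v, u) \<in> monoid_congruence G R"
| cong_trans: "\<lbrakk>(u, v) \<in> monoid_congruence G R; (v, w) \<in> monoid_congruence G R\<rbrakk>
    \<Longrightarrow> (u, w) \<in> monoid_congruence G R"
| cong_mult: "\<lbrakk>(u, v) \<in> monoid_congruence G R; (u', v') \<in> monoid_congruence G R\<rbrakk>
    \<Longrightarrow> (u @ u', v @ v') \<in> monoid_congruence G R"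

definition presented_monoid :: "'a set \<Rightarrow> ('a list \<times> 'a list) set \<Rightarrow> 'a list set monoid" where
  "presented_monoid G R =
     \<lparr>carrier = lists G // monoid_congruence G R,
      monoid.mult = (\<lambda>X Y. \<Union>x\<in>X. \<Union>y\<in>Y. monoid_congruence G R `` {x @ y}),
      one = monoid_congruence G R `` {[]}\<rparr>"

definition free_pc_lrb :: "'v set \<Rightarrow> 'v set set \<Rightarrow> 'v list set monoid" where
  "free_pc_lrb V E = presented_monoid V
     ({(x @ x, x) | x. x \<in> lists V} \<union>
      {(x @ y @ x, x @ y) | x y. x \<in> lists V \<and> y \<in> lists V} \<union>
      {([x, y], [y, x]) | x y. {x, y} \<in> E})"

definition content :: "'v list set \<Rightarrow> 'v set" where
  "content b = (\<Union>w\<in>b. set w)"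

definition monoid_algebra ::
    "('k, 'z) ring_scheme \<Rightarrow> ('b, 'y) monoid_scheme \<Rightarrow> ('k, 'b \<Rightarrow> 'k) module" where
  "monoid_algebra K B =
     \<lparr>carrier = fin_supp K (carrier B),
      monoid.mult = (\<lambda>f g x. \<Oplus>\<^bsub>K\<^esub>p\<in>{(y, z). f y \<noteq> \<zero>\<^bsub>K\<^esub> \<and> g z \<noteq> \<zero>\<^bsub>K\<^esub> \<and> y \<otimes>\<^bsub>B\<^esub> z = x}.
                f (fst p) \<otimes>\<^bsub>K\<^esub> g (snd p)),
      one = (\<lambda>x. if x = \<one>\<^bsub>B\<^esub> then \<one>\<^bsub>K\<^esub> else \<zero>\<^bsub>K\<^esub>),
      zero = (\<lambda>x. \<zero>\<^bsub>K\<^esub>),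
      add = (\<lambda>f g x. f x \<oplus>\<^bsub>K\<^esub> g x),
      smult = (\<lambda>r f x. r \<otimes>\<^bsub>K\<^esub> f x)\<rparr>"

abbreviation lrb_algebra ::
    "('k, 'z) ring_scheme \<Rightarrow> 'v set \<Rightarrow> 'v set set \<Rightarrow> ('k, 'v list set \<Rightarrow> 'k) module" where
  "lrb_algebra K V E \<equiv> monoid_algebra K (free_pc_lrb V E)"

text \<open>
  The left module \<open>\<bbbk>\<^sub>U\<close>: the action of the monoid elements on the ground ring, extended linearly
  to the algebra.
\<close>

definition content_module ::
    "('k, 'z) ring_scheme \<Rightarrow> 'v set \<Rightarrow> ('v list set \<Rightarrow> 'k, 'k) module" where
  "content_module K U = mk_module (carrier K) \<zero>\<^bsub>K\<^esub> (\<lambda>s t. s \<oplus>\<^bsub>K\<^esub> t)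
     (\<lambda>f t. \<Oplus>\<^bsub>K\<^esub>b\<in>{b. f b \<noteq> \<zero>\<^bsub>K\<^esub>}. f b \<otimes>\<^bsub>K\<^esub> (if content b \<subseteq> U then t else \<zero>\<^bsub>K\<^esub>))"


section \<open>Reduced simplicial cohomology of the clique complex\<close>

text \<open>An abstract simplicial complex is given by its set of simplices, including the empty one.\<close>

definition clique_complex :: "'v set \<Rightarrow> 'v set set \<Rightarrow> 'v set set" where
  "clique_complex V E =
     {S. finite S \<and> S \<subseteq> V \<and> (\<forall>x\<in>S. \<forall>y\<in>S. x \<noteq> y \<longrightarrow> {x, y} \<in> E)}"

text \<open>
  \<open>ordered_simplices X n\<close> lists the simplices with \<open>n\<close> vertices, i.e. of dimension \<open>n - 1\<close>, with
  all orderings of their vertices. Cochains are functions of oriented simplices: reordering the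
  vertices multiplies the value by the sign of the permutation. The index \<open>n = 0\<close> is the
  augmentation term in degree \<open>-1\<close>.
\<close>

definition ordered_simplices :: "'v set set \<Rightarrow> nat \<Rightarrow> 'v list set" where
  "ordered_simplices X n = {vs. length vs = n \<and> distinct vs \<and> set vs \<in> X}"

definition cochain_module ::
    "('k, 'z) ring_scheme \<Rightarrow> 'v set set \<Rightarrow> nat \<Rightarrow> ('k, 'v list \<Rightarrow> 'k) module" where
  "cochain_module K X n = mk_module
     {f \<in> ordered_simplices X n \<rightarrow>\<^sub>E carrier K.
        \<forall>vs\<in>ordered_simplices X n. \<forall>\<sigma>. \<sigma> permutes {..<n} \<longrightarrow>
          f (permute_list \<sigma> vs) = (if evenperm \<sigma> then f vs else \<ominus>\<^bsub>K\<^esub> f vs)}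
     (\<lambda>vs\<in>ordered_simplices X n. \<zero>\<^bsub>K\<^esub>)
     (\<lambda>f g. \<lambda>vs\<in>ordered_simplices X n. f vs \<oplus>\<^bsub>K\<^esub> g vs)
     (\<lambda>r f. \<lambda>vs\<in>ordered_simplices X n. r \<otimes>\<^bsub>K\<^esub> f vs)"

definition simplicial_coboundary ::
    "('k, 'z) ring_scheme \<Rightarrow> 'v set set \<Rightarrow> nat \<Rightarrow> ('v list \<Rightarrow> 'k) \<Rightarrow> ('v list \<Rightarrow> 'k)" where
  "simplicial_coboundary K X n f = (\<lambda>vs\<in>ordered_simplices X (Suc n).
     \<Oplus>\<^bsub>K\<^esub>i\<in>{..n}. let u = take i vs @ drop (Suc i) vs in if even i then f u else \<ominus>\<^bsub>K\<^esub> f u)"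

definition reduced_cohomology ::
    "('k, 'z) ring_scheme \<Rightarrow> 'v set set \<Rightarrow> nat \<Rightarrow> ('k, ('v list \<Rightarrow> 'k) set) module" where
  "reduced_cohomology K X q =
     cohomology (cochain_module K X) (simplicial_coboundary K X) (Suc q)"


section \<open>Existence of projective resolutions\<close>

context left_module begin

lemma smult_zero_l: "x \<in> carrier M \<Longrightarrow> \<zero>\<^bsub>R\<^esub> \<odot>\<^bsub>M\<^esub> x = \<zero>\<^bsub>M\<^esub>"
  using smult_l_distr[of "\<zero>\<^bsub>R\<^esub>" "\<zero>\<^bsub>R\<^esub>" x] smult_closed[of "\<zero>\<^bsub>R\<^esub>" x]
  by (metis M.add.r_cancel_one R.l_zero R.zero_closed)

lemma smult_zero_r: "a \<in> carrier R \<Longrightarrow> a \<odot>\<^bsub>M\<^esub> \<zero>\<^bsub>M\<^esub> = \<zero>\<^bsub>M\<^esub>"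
  using smult_r_distr[of a "\<zero>\<^bsub>M\<^esub>" "\<zero>\<^bsub>M\<^esub>"] smult_closed[of a "\<zero>\<^bsub>M\<^esub>"]
  by (metis M.add.r_cancel_one M.l_zero M.zero_closed)

lemma smult_finsum:
  assumes "finite S" "a \<in> carrier R" "\<And>x. x \<in> S \<Longrightarrow> g x \<in> carrier M"
  shows "a \<odot>\<^bsub>M\<^esub> finsum M g S = finsum M (\<lambda>x. a \<odot>\<^bsub>M\<^esub> g x) S"
  using assms
  by (induction S rule: finite_induct)
     (auto simp: smult_zero_r smult_r_distr smult_closed Pi_def M.finsum_closed)

end

lemma free_module_left_module:
  assumes "ring R"
  shows "left_module R (free_module R X)"
proof -
  interpret ring R by fact
  have fin: "finite {x. f x \<oplus>\<^bsub>R\<^esub> g x \<noteq> \<zero>\<^bsub>R\<^esub>}"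
    if "finite {x. f x \<noteq> \<zero>\<^bsub>R\<^esub>}" "finite {x. g x \<noteq> \<zero>\<^bsub>R\<^esub>}" for f g
    by (rule finite_subset[OF _ finite_UnI[OF that]]) auto
  have mem: "f x \<in> carrier R" if "f \<in> fin_supp R X" for f x
    using that by (cases "x \<in> X") (auto simp: fin_supp_def)
  have "abelian_group (free_module R X)"
  proof (rule abelian_groupI; unfold free_module_def mk_module_simps)
    fix f g assume "f \<in> fin_supp R X" "g \<in> fin_supp R X"
    then show "(\<lambda>x. f x \<oplus>\<^bsub>R\<^esub> g x) \<in> fin_supp R X"
      by (auto simp: fin_supp_def fin)
  next
    fix f assume f: "f \<in> fin_supp R X"
    have "finite {x. \<ominus>\<^bsub>R\<^esub> f x \<noteq> \<zero>\<^bsub>R\<^esub>}"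
      by (rule finite_subset[of _ "{x. f x \<noteq> \<zero>\<^bsub>R\<^esub>}"]) (use f in \<open>auto simp: fin_supp_def\<close>)
    then have "(\<lambda>x. \<ominus>\<^bsub>R\<^esub> f x) \<in> fin_supp R X"
      using f by (auto simp: fin_supp_def)
    then show "\<exists>g\<in>fin_supp R X. (\<lambda>x. g x \<oplus>\<^bsub>R\<^esub> f x) = (\<lambda>x. \<zero>\<^bsub>R\<^esub>)"
      by (rule bexI[rotated]) (use mem[OF f] in \<open>auto simp: l_neg\<close>)
  qed (auto simp: mem a_ac fun_eq_iff, auto simp: fin_supp_def)
  moreover have "left_module_axioms R (free_module R X)"
  proof (rule left_module_axioms.intro; unfold free_module_def mk_module_simps)
    fix a f assume a: "a \<in> carrier R" and f: "f \<in> fin_supp R X"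
    have "finite {x. a \<otimes>\<^bsub>R\<^esub> f x \<noteq> \<zero>\<^bsub>R\<^esub>}"
      by (rule finite_subset[of _ "{x. f x \<noteq> \<zero>\<^bsub>R\<^esub>}"]) (use a f in \<open>auto simp: fin_supp_def\<close>)
    then show "(\<lambda>x. a \<otimes>\<^bsub>R\<^esub> f x) \<in> fin_supp R X"
      using a f by (auto simp: fin_supp_def)
  qed (auto simp: mem l_distr r_distr m_assoc fun_eq_iff)
  ultimately show ?thesis
    using assms by (simp add: left_module_def)
qed

definition free_ext ::
    "('r, 'z) ring_scheme \<Rightarrow> ('r, 'm, 'x) module_scheme \<Rightarrow> 'b set \<Rightarrow> ('b \<Rightarrow> 'm) \<Rightarrow> ('b \<Rightarrow> 'r) \<Rightarrow> 'm" where
  "free_ext R M X g = (\<lambda>f\<in>fin_supp R X. \<Oplus>\<^bsub>M\<^esub>x\<in>{x. f x \<noteq> \<zero>\<^bsub>R\<^esub>}. f x \<odot>\<^bsub>M\<^esub> g x)"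

definition free_gen :: "('r, 'z) ring_scheme \<Rightarrow> 'b \<Rightarrow> 'b \<Rightarrow> 'r" where
  "free_gen R x = (\<lambda>y. if y = x then \<one>\<^bsub>R\<^esub> else \<zero>\<^bsub>R\<^esub>)"

context left_module begin

lemma free_ext_superset:
  assumes "f \<in> fin_supp R X" "finite S" "{x. f x \<noteq> \<zero>\<^bsub>R\<^esub>} \<subseteq> S" "S \<subseteq> X" "g \<in> X \<rightarrow> carrier M"
  shows "free_ext R M X g f = (\<Oplus>\<^bsub>M\<^esub>x\<in>S. f x \<odot>\<^bsub>M\<^esub> g x)"
proof -
  have "(\<Oplus>\<^bsub>M\<^esub>x\<in>{x. f x \<noteq> \<zero>\<^bsub>R\<^esub>}. f x \<odot>\<^bsub>M\<^esub> g x) = (\<Oplus>\<^bsub>M\<^esub>x\<in>S. f x \<odot>\<^bsub>M\<^esub> g x)"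
    using assms
    by (intro M.add.finprod_mono_neutral_cong_left)
       (auto simp: smult_zero_l fin_supp_def Pi_def subset_iff intro!: smult_closed)
  then show ?thesis using assms(1) by (simp add: free_ext_def)
qed

lemma free_ext_hom:
  assumes g: "g \<in> X \<rightarrow> carrier M"
  shows "free_ext R M X g \<in> mod_hom R (free_module R X) M"
proof -
  interpret F: left_module R "free_module R X"
    by (rule free_module_left_module) (rule R.ring_axioms)
  have F [simp]: "carrier (free_module R X) = fin_supp R X" by (simp add: free_module_def)
  have supp: "finite {x. f x \<noteq> \<zero>\<^bsub>R\<^esub>}" "{x. f x \<noteq> \<zero>\<^bsub>R\<^esub>} \<subseteq> X" if "f \<in> fin_supp R X" for f
    using that by (auto simp: fin_supp_def)
  have mem: "f x \<odot>\<^bsub>M\<^esub> g x \<in> carrier M" if "f \<in> fin_supp R X" "x \<in> X" for f x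
    using that g by (auto simp: fin_supp_def intro!: smult_closed)
  have clo: "free_ext R M X g f \<in> carrier M" if "f \<in> fin_supp R X" for f
    using that supp[OF that] mem[OF that] by (auto simp: free_ext_def intro!: M.finsum_closed)
  have add: "free_ext R M X g (f \<oplus>\<^bsub>free_module R X\<^esub> h)
        = free_ext R M X g f \<oplus>\<^bsub>M\<^esub> free_ext R M X g h"
    if f: "f \<in> fin_supp R X" and h: "h \<in> fin_supp R X" for f h
  proof -
    let ?S = "{x. f x \<noteq> \<zero>\<^bsub>R\<^esub>} \<union> {x. h x \<noteq> \<zero>\<^bsub>R\<^esub>}"
    have fh: "f \<oplus>\<^bsub>free_module R X\<^esub> h \<in> fin_supp R X" using f h F.M.add.m_closed[of f h] by simp
    have S: "finite ?S" "?S \<subseteq> X" using supp[OF f] supp[OF h] by auto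
    have "{x. (f \<oplus>\<^bsub>free_module R X\<^esub> h) x \<noteq> \<zero>\<^bsub>R\<^esub>} \<subseteq> ?S" by (auto simp: free_module_def)
    then have "free_ext R M X g (f \<oplus>\<^bsub>free_module R X\<^esub> h)
        = (\<Oplus>\<^bsub>M\<^esub>x\<in>?S. (f \<oplus>\<^bsub>free_module R X\<^esub> h) x \<odot>\<^bsub>M\<^esub> g x)"
      using fh S g by (intro free_ext_superset) auto
    also have "\<dots> = (\<Oplus>\<^bsub>M\<^esub>x\<in>?S. f x \<odot>\<^bsub>M\<^esub> g x \<oplus>\<^bsub>M\<^esub> h x \<odot>\<^bsub>M\<^esub> g x)"
    proof (rule M.finsum_cong')
      fix x assume "x \<in> ?S"
      then have "x \<in> X" using S by auto
      then show "(f \<oplus>\<^bsub>free_module R X\<^esub> h) x \<odot>\<^bsub>M\<^esub> g x = f x \<odot>\<^bsub>M\<^esub> g x \<oplus>\<^bsub>M\<^esub> h x \<odot>\<^bsub>M\<^esub> g x"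
        using f h g by (auto simp: free_module_def fin_supp_def intro!: smult_l_distr)
    qed (use S mem[OF f] mem[OF h] in auto)
    also have "\<dots> = (\<Oplus>\<^bsub>M\<^esub>x\<in>?S. f x \<odot>\<^bsub>M\<^esub> g x) \<oplus>\<^bsub>M\<^esub> (\<Oplus>\<^bsub>M\<^esub>x\<in>?S. h x \<odot>\<^bsub>M\<^esub> g x)"
      using S mem[OF f] mem[OF h] by (intro M.finsum_addf) auto
    also have "(\<Oplus>\<^bsub>M\<^esub>x\<in>?S. f x \<odot>\<^bsub>M\<^esub> g x) = free_ext R M X g f"
      using f S g by (intro free_ext_superset[symmetric]) auto
    also have "(\<Oplus>\<^bsub>M\<^esub>x\<in>?S. h x \<odot>\<^bsub>M\<^esub> g x) = free_ext R M X g h"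
      using h S g by (intro free_ext_superset[symmetric]) auto
    finally show ?thesis .
  qed
  have smult: "free_ext R M X g (a \<odot>\<^bsub>free_module R X\<^esub> f) = a \<odot>\<^bsub>M\<^esub> free_ext R M X g f"
    if a: "a \<in> carrier R" and f: "f \<in> fin_supp R X" for a f
  proof -
    let ?S = "{x. f x \<noteq> \<zero>\<^bsub>R\<^esub>}"
    have af: "a \<odot>\<^bsub>free_module R X\<^esub> f \<in> fin_supp R X" using F.smult_closed[of a f] a f by simp
    have "{x. (a \<odot>\<^bsub>free_module R X\<^esub> f) x \<noteq> \<zero>\<^bsub>R\<^esub>} \<subseteq> ?S" using a by (auto simp: free_module_def)
    then have "free_ext R M X g (a \<odot>\<^bsub>free_module R X\<^esub> f)
        = (\<Oplus>\<^bsub>M\<^esub>x\<in>?S. (a \<odot>\<^bsub>free_module R X\<^esub> f) x \<odot>\<^bsub>M\<^esub> g x)"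
      using af supp[OF f] g by (intro free_ext_superset) auto
    also have "\<dots> = (\<Oplus>\<^bsub>M\<^esub>x\<in>?S. a \<odot>\<^bsub>M\<^esub> (f x \<odot>\<^bsub>M\<^esub> g x))"
    proof (rule M.finsum_cong')
      fix x assume "x \<in> ?S"
      then have "x \<in> X" using supp[OF f] by auto
      then show "(a \<odot>\<^bsub>free_module R X\<^esub> f) x \<odot>\<^bsub>M\<^esub> g x = a \<odot>\<^bsub>M\<^esub> (f x \<odot>\<^bsub>M\<^esub> g x)"
        using a f g by (auto simp: free_module_def fin_supp_def intro!: smult_assoc)
    qed (use supp[OF f] mem[OF f] a in \<open>auto intro!: smult_closed[OF a]\<close>)
    also have "\<dots> = a \<odot>\<^bsub>M\<^esub> (\<Oplus>\<^bsub>M\<^esub>x\<in>?S. f x \<odot>\<^bsub>M\<^esub> g x)"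
      using supp[OF f] mem[OF f] a by (intro smult_finsum[symmetric]) auto
    finally show ?thesis using f by (simp add: free_ext_def)
  qed
  show ?thesis
    using clo add smult by (auto simp: mod_hom_def free_ext_def)
qed

lemma free_ext_cong:
  assumes "\<And>x. x \<in> X \<Longrightarrow> g x = g' x" "g' \<in> X \<rightarrow> carrier M"
  shows "free_ext R M X g = free_ext R M X g'"
proof
  fix f
  show "free_ext R M X g f = free_ext R M X g' f"
  proof (cases "f \<in> fin_supp R X")
    case True
    then have S: "finite {x. f x \<noteq> \<zero>\<^bsub>R\<^esub>}" "{x. f x \<noteq> \<zero>\<^bsub>R\<^esub>} \<subseteq> X" and f: "\<And>x. x \<in> X \<Longrightarrow> f x \<in> carrier R"
      by (auto simp: fin_supp_def)
    have "(\<Oplus>\<^bsub>M\<^esub>x\<in>{x. f x \<noteq> \<zero>\<^bsub>R\<^esub>}. f x \<odot>\<^bsub>M\<^esub> g x) = (\<Oplus>\<^bsub>M\<^esub>x\<in>{x. f x \<noteq> \<zero>\<^bsub>R\<^esub>}. f x \<odot>\<^bsub>M\<^esub> g' x)"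
    proof (rule M.finsum_cong')
      show "(\<lambda>x. f x \<odot>\<^bsub>M\<^esub> g' x) \<in> {x. f x \<noteq> \<zero>\<^bsub>R\<^esub>} \<rightarrow> carrier M"
      proof
        fix x assume "x \<in> {x. f x \<noteq> \<zero>\<^bsub>R\<^esub>}"
        then have "x \<in> X" using S by auto
        then show "f x \<odot>\<^bsub>M\<^esub> g' x \<in> carrier M" using f assms(2) by (auto intro!: smult_closed)
      qed
    qed (use assms S in auto)
    with True show ?thesis by (simp add: free_ext_def)
  qed (simp add: free_ext_def)
qed

lemma free_gen_in: "x \<in> X \<Longrightarrow> free_gen R x \<in> fin_supp R X"
  by (auto simp: free_gen_def fin_supp_def)

lemma free_ext_gen:
  assumes "g \<in> X \<rightarrow> carrier M" "x \<in> X"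
  shows "free_ext R M X g (free_gen R x) = g x"
proof -
  have "free_ext R M X g (free_gen R x) = (\<Oplus>\<^bsub>M\<^esub>y\<in>{x}. free_gen R x y \<odot>\<^bsub>M\<^esub> g y)"
    using assms by (intro free_ext_superset free_gen_in) (auto simp: free_gen_def)
  also have "\<dots> = g x"
    using assms by (subst M.finsum_insert) (auto simp: free_gen_def smult_one Pi_def smult_closed)
  finally show ?thesis .
qed

lemma free_ext_image:
  assumes g: "g \<in> X \<rightarrow> carrier M" and H: "g ` X = H" "\<zero>\<^bsub>M\<^esub> \<in> H"
    "\<And>x y. x \<in> H \<Longrightarrow> y \<in> H \<Longrightarrow> x \<oplus>\<^bsub>M\<^esub> y \<in> H" "\<And>a x. a \<in> carrier R \<Longrightarrow> x \<in> H \<Longrightarrow> a \<odot>\<^bsub>M\<^esub> x \<in> H"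
  shows "free_ext R M X g ` carrier (free_module R X) = H"
proof -
  have F [simp]: "carrier (free_module R X) = fin_supp R X" by (simp add: free_module_def)
  have sum: "finsum M h S \<in> H \<and> finsum M h S \<in> carrier M"
    if "finite S" "\<And>x. x \<in> S \<Longrightarrow> h x \<in> H" for h S
  proof -
    have "H \<subseteq> carrier M" using g H(1) by auto
    with that show ?thesis
      by (induction S rule: finite_induct) (auto simp: H Pi_def subset_iff)
  qed
  have "free_ext R M X g f \<in> H" if "f \<in> fin_supp R X" for f
  proof -
    have "finsum M (\<lambda>x. f x \<odot>\<^bsub>M\<^esub> g x) {x. f x \<noteq> \<zero>\<^bsub>R\<^esub>} \<in> H"
      using that by (intro sum[THEN conjunct1]) (auto simp: fin_supp_def H(1)[symmetric] intro!: H(4)[unfolded H(1)[symmetric]])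
    then show ?thesis using that by (simp add: free_ext_def)
  qed
  moreover have "y \<in> free_ext R M X g ` fin_supp R X" if "y \<in> H" for y
  proof -
    obtain x where "x \<in> X" "y = g x" using \<open>y \<in> H\<close> H(1) by blast
    then have "y = free_ext R M X g (free_gen R x)" "free_gen R x \<in> fin_supp R X"
      using free_ext_gen[OF g] free_gen_in by auto
    then show ?thesis by blast
  qed
  ultimately show ?thesis by auto
qed

end

lemma hom_kernel_submodule:
  assumes "left_module R M" "left_module R N" "h \<in> mod_hom R M N"
  defines "H \<equiv> a_kernel M N h"
  shows "\<zero>\<^bsub>M\<^esub> \<in> H" "\<And>x y. x \<in> H \<Longrightarrow> y \<in> H \<Longrightarrow> x \<oplus>\<^bsub>M\<^esub> y \<in> H"
    "\<And>a x. a \<in> carrier R \<Longrightarrow> x \<in> H \<Longrightarrow> a \<odot>\<^bsub>M\<^esub> x \<in> H" "H \<subseteq> carrier M"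
proof -
  interpret M: left_module R M by fact
  interpret N: left_module R N by fact
  have h: "h x \<in> carrier N" if "x \<in> carrier M" for x using assms(3) that by (auto simp: mod_hom_def)
  have "h \<zero>\<^bsub>M\<^esub> = h (\<zero>\<^bsub>R\<^esub> \<odot>\<^bsub>M\<^esub> \<zero>\<^bsub>M\<^esub>)" by (simp add: M.smult_zero_l)
  also have "\<dots> = \<zero>\<^bsub>R\<^esub> \<odot>\<^bsub>N\<^esub> h \<zero>\<^bsub>M\<^esub>" using assms(3) by (simp add: mod_hom_def)
  also have "\<dots> = \<zero>\<^bsub>N\<^esub>" by (simp add: N.smult_zero_l h)
  finally show "\<zero>\<^bsub>M\<^esub> \<in> H" by (simp add: H_def a_kernel_def')
  show "H \<subseteq> carrier M" by (auto simp: H_def a_kernel_def')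
  show "x \<oplus>\<^bsub>M\<^esub> y \<in> H" if "x \<in> H" "y \<in> H" for x y
    using that assms(3) by (auto simp: H_def a_kernel_def' mod_hom_def)
  show "a \<odot>\<^bsub>M\<^esub> x \<in> H" if "a \<in> carrier R" "x \<in> H" for a x
    using that assms(3) by (auto simp: H_def a_kernel_def' mod_hom_def M.smult_closed N.smult_zero_r)
qed


lemma mod_hom_finsum:
  assumes "left_module R M" "left_module R N" "h \<in> mod_hom R M N"
    "finite S" "k \<in> S \<rightarrow> carrier M"
  shows "h (finsum M k S) = finsum N (\<lambda>x. h (k x)) S"
proof -
  interpret M: left_module R M by fact
  interpret N: left_module R N by fact
  have h: "h x \<in> carrier N" if "x \<in> carrier M" for x using assms(3) that by (auto simp: mod_hom_def)
  have h0: "h \<zero>\<^bsub>M\<^esub> = \<zero>\<^bsub>N\<^esub>"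
    using hom_kernel_submodule(1)[OF assms(1-3)] by (simp add: a_kernel_def')
  have ha: "h (x \<oplus>\<^bsub>M\<^esub> y) = h x \<oplus>\<^bsub>N\<^esub> h y" if "x \<in> carrier M" "y \<in> carrier M" for x y
    using assms(3) that by (auto simp: mod_hom_def)
  show ?thesis using assms(4,5)
    by (induction S rule: finite_induct) (auto simp: h h0 ha Pi_def)
qed

lemma mod_hom_free_eq:
  assumes "left_module R N" "h \<in> mod_hom R (free_module R X) N"
  shows "h = free_ext R N X (\<lambda>x. h (free_gen R x))"
proof
  interpret N: left_module R N by fact
  interpret F: left_module R "free_module R X"
    by (rule free_module_left_module) (rule N.R.ring_axioms)
  have F [simp]: "carrier (free_module R X) = fin_supp R X" by (simp add: free_module_def)
  have gen: "free_gen R x \<in> fin_supp R X" if "x \<in> X" for x using that by (rule N.free_gen_in)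
  fix f
  show "h f = free_ext R N X (\<lambda>x. h (free_gen R x)) f"
  proof (cases "f \<in> fin_supp R X")
    case False
    then show ?thesis using assms(2) by (auto simp: free_ext_def mod_hom_def PiE_def extensional_def)
  next
    case f: True
    let ?S = "{x. f x \<noteq> \<zero>\<^bsub>R\<^esub>}"
    have S: "finite ?S" "?S \<subseteq> X" using f by (auto simp: fin_supp_def)
    have fx: "f x \<in> carrier R" for x using f by (cases "x \<in> X") (auto simp: fin_supp_def)
    let ?k = "\<lambda>x. f x \<odot>\<^bsub>free_module R X\<^esub> free_gen R x"
    have k: "?k \<in> ?S \<rightarrow> carrier (free_module R X)"
      using S gen F.smult_closed fx by auto
    have ev: "finsum (free_module R X) ?k T y = finsum R (\<lambda>x. ?k x y) T"
      if "finite T" "T \<subseteq> ?S" for T y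
      using that
    proof (induction T rule: finite_induct)
      case empty
      have "\<zero>\<^bsub>free_module R X\<^esub> y = \<zero>\<^bsub>R\<^esub>" by (simp add: free_module_def)
      then show ?case by simp
    next
      case (insert x T)
      have "finsum (free_module R X) ?k (insert x T)
          = ?k x \<oplus>\<^bsub>free_module R X\<^esub> finsum (free_module R X) ?k T"
        using insert k by (intro F.M.finsum_insert) auto
      moreover have "finsum R (\<lambda>x. ?k x y) (insert x T) = ?k x y \<oplus>\<^bsub>R\<^esub> finsum R (\<lambda>x. ?k x y) T"
        using insert fx by (intro N.R.finsum_insert) (auto simp: free_module_def free_gen_def)
      ultimately show ?case using insert by (simp add: free_module_def)
    qed
    have "f = finsum (free_module R X) ?k ?S"
    proof
      fix y
      have "finsum (free_module R X) ?k ?S y = finsum R (\<lambda>x. if y = x then f x else \<zero>\<^bsub>R\<^esub>) ?S"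
        unfolding ev[OF S(1) order_refl]
        by (rule N.R.finsum_cong') (auto simp: free_module_def free_gen_def fx)
      also have "\<dots> = f y"
      proof (cases "y \<in> ?S")
        case True
        then show ?thesis using N.R.add.finprod_singleton[of y ?S f] S(1) fx by auto
      next
        case False
        then show ?thesis by (subst N.R.add.finprod_one_eqI) auto
      qed
      finally show "f y = finsum (free_module R X) ?k ?S y" by simp
    qed
    then have "h f = h (finsum (free_module R X) ?k ?S)" by simp
    also have "\<dots> = finsum N (\<lambda>x. h (?k x)) ?S"
      by (rule mod_hom_finsum[OF F.left_module_axioms assms S(1) k])
    also have "\<dots> = finsum N (\<lambda>x. f x \<odot>\<^bsub>N\<^esub> h (free_gen R x)) ?S"
    proof (rule N.M.finsum_cong')
      fix x assume "x \<in> ?S"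
      then have "x \<in> X" using S by auto
      then show "h (?k x) = f x \<odot>\<^bsub>N\<^esub> h (free_gen R x)"
        using assms(2) gen fx by (auto simp: mod_hom_def)
    next
      have "h (free_gen R x) \<in> carrier N" if "x \<in> X" for x
        using assms(2) gen[OF that] by (auto simp: mod_hom_def)
      then show "(\<lambda>x. f x \<odot>\<^bsub>N\<^esub> h (free_gen R x)) \<in> ?S \<rightarrow> carrier N"
        using S(2) fx by (auto intro!: N.smult_closed)
    qed simp
    finally show ?thesis using f by (simp add: free_ext_def)
  qed
qed

lemma free_projective:
  assumes "ring R"
  shows "projective_module R (free_module R X)"
proof -
  interpret F: left_module R "free_module R X" by (rule free_module_left_module) fact
  let ?Y = "free_gen R ` X"
  interpret G: left_module R "free_module R ?Y" by (rule free_module_left_module) fact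
  let ?i = "free_ext R (free_module R ?Y) X (\<lambda>x. free_gen R (free_gen R x))"
  let ?p = "free_ext R (free_module R X) ?Y (\<lambda>y. y)"
  have F [simp]: "carrier (free_module R Z) = fin_supp R Z" for Z :: "'z set"
    by (simp add: free_module_def)
  have G [simp]: "carrier (free_module R Z) = fin_supp R Z" for Z :: "('a \<Rightarrow> 'b) set"
    by (simp add: free_module_def)
  have FX [simp]: "carrier (free_module R X) = fin_supp R X"
    by (simp add: free_module_def)
  have gY: "(\<lambda>x. free_gen R (free_gen R x)) \<in> X \<rightarrow> carrier (free_module R ?Y)"
    by (auto intro!: F.free_gen_in)
  have gX: "(\<lambda>y. y) \<in> ?Y \<rightarrow> carrier (free_module R X)"
    by (auto intro!: F.free_gen_in)
  have i: "?i \<in> mod_hom R (free_module R X) (free_module R ?Y)"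
    by (rule G.free_ext_hom[OF gY])
  have p: "?p \<in> mod_hom R (free_module R ?Y) (free_module R X)"
    by (rule F.free_ext_hom[OF gX])
  let ?h = "\<lambda>x\<in>carrier (free_module R X). ?p (?i x)"
  have h: "?h \<in> mod_hom R (free_module R X) (free_module R X)"
    using i p F.M.add.m_closed F.smult_closed by (auto simp: mod_hom_def PiE_def Pi_def)
  have id: "(\<lambda>x\<in>carrier (free_module R X). x) \<in> mod_hom R (free_module R X) (free_module R X)"
    using F.M.add.m_closed F.smult_closed by (auto simp: mod_hom_def)
  have "?h (free_gen R x) = free_gen R x" if "x \<in> X" for x
    using that G.free_ext_gen[OF gY that] F.free_ext_gen[OF gX, of "free_gen R x"]
    by (simp add: F.free_gen_in)
  then have "free_ext R (free_module R X) X (\<lambda>x. ?h (free_gen R x))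
     = free_ext R (free_module R X) X (\<lambda>x. (\<lambda>x\<in>carrier (free_module R X). x) (free_gen R x))"
    by (intro F.free_ext_cong) (auto simp: F.free_gen_in)
  then have "?h = (\<lambda>x\<in>carrier (free_module R X). x)"
    using mod_hom_free_eq[OF F.left_module_axioms h] mod_hom_free_eq[OF F.left_module_axioms id]
    by simp
  note eq = fun_cong[OF this]
  have "?p (?i x) = x" if "x \<in> carrier (free_module R X)" for x
    using eq[of x] unfolding restrict_apply'[OF that] .
  then show ?thesis
    unfolding projective_module_def using i p F.left_module_axioms by blast
qed

text \<open>A type large enough to index the bases of a free resolution.\<close>

datatype ('r, 'm) basis = Base 'm | Syzygy "(('r, 'm) basis \<times> 'r) list"

definition syz :: "('r, 'z) ring_scheme \<Rightarrow> (('r, 'm) basis \<Rightarrow> 'r) \<Rightarrow> ('r, 'm) basis" where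
  "syz R f = Syzygy (SOME xs. set xs = {(x, f x) | x. f x \<noteq> \<zero>\<^bsub>R\<^esub>})"

lemma inj_on_syz: "inj_on (syz R) (fin_supp R X)"
proof (rule inj_onI)
  have *: "set (SOME xs. set xs = {(x, f x) | x. f x \<noteq> \<zero>\<^bsub>R\<^esub>}) = {(x, f x) | x. f x \<noteq> \<zero>\<^bsub>R\<^esub>}"
    if "f \<in> fin_supp R X" for f
    by (rule someI_ex, rule finite_list) (use that in \<open>auto simp: fin_supp_def\<close>)
  fix f g assume f: "f \<in> fin_supp R X" and g: "g \<in> fin_supp R X" and "syz R f = syz R g"
  then have "(SOME xs. set xs = {(x, f x) | x. f x \<noteq> \<zero>\<^bsub>R\<^esub>}) = (SOME xs. set xs = {(x, g x) | x. g x \<noteq> \<zero>\<^bsub>R\<^esub>})"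
    by (simp only: syz_def basis.inject)
  then have eq: "{(x, f x) | x. f x \<noteq> \<zero>\<^bsub>R\<^esub>} = {(x, g x) | x. g x \<noteq> \<zero>\<^bsub>R\<^esub>}"
    by (rule trans[OF *[OF f, symmetric] trans[OF arg_cong[where f = set] *[OF g]]])
  show "f = g"
  proof
    fix x
    show "f x = g x"
    proof (cases "f x = \<zero>\<^bsub>R\<^esub>")
      case False
      then have "(x, f x) \<in> {(x, g x) | x. g x \<noteq> \<zero>\<^bsub>R\<^esub>}" unfolding eq[symmetric] by blast
      then show ?thesis by blast
    next
      case True
      have "g x = \<zero>\<^bsub>R\<^esub>"
      proof (rule ccontr)
        assume "g x \<noteq> \<zero>\<^bsub>R\<^esub>"
        then have "(x, g x) \<in> {(x, f x) | x. f x \<noteq> \<zero>\<^bsub>R\<^esub>}" unfolding eq by blast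
        then show False using True by auto
      qed
      with True show ?thesis by simp
    qed
  qed
qed

lemma projective_resolution_exists:
  fixes R :: "('r, 'z) ring_scheme" and M :: "('r, 'm) module"
  assumes M: "left_module R M"
  shows "\<exists>(P :: nat \<Rightarrow> ('r, ('r, 'm) basis \<Rightarrow> 'r) module) d e. projective_resolution R P d e M"
proof -
  interpret left_module R M by fact
  have ring: "ring R" by (rule R.ring_axioms)
  define e :: "(('r, 'm) basis \<Rightarrow> 'r) \<Rightarrow> 'm" where "e = free_ext R M (Base ` carrier M) (inv_into (carrier M) Base)"
  define next_map where "next_map X H = free_ext R (free_module R X) (syz R ` H) (inv_into H (syz R))"
    for X and H :: "(('r, 'm) basis \<Rightarrow> 'r) set"
  define st where "st = rec_nat (Base ` carrier M, a_kernel (free_module R (Base ` carrier M)) M e)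
    (\<lambda>_ (X, H). (syz R ` H, a_kernel (free_module R (syz R ` H)) (free_module R X) (next_map X H)))"
  define X where "X n = fst (st n)" for n
  define H where "H n = snd (st n)" for n
  define P where "P n = free_module R (X n)" for n
  define d where "d n = next_map (X n) (H n)" for n
  have X0: "X 0 = Base ` carrier M" and H0: "H 0 = a_kernel (P 0) M e"
    by (simp_all add: X_def H_def st_def P_def)
  have XS: "X (Suc n) = syz R ` H n" and HS: "H (Suc n) = a_kernel (P (Suc n)) (P n) (d n)" for n
    by (simp_all add: X_def H_def st_def P_def d_def split: prod.splits)
  have lm: "left_module R (P n)" for n unfolding P_def by (rule free_module_left_module[OF ring])
  have carr: "carrier (P n) = fin_supp R (X n)" for n by (simp add: P_def free_module_def)
  have inj: "inj_on Base A" for A :: "'m set" by (simp add: inj_on_def)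
  have gB: "inv_into (carrier M) Base \<in> Base ` carrier M \<rightarrow> carrier M"
    using inv_into_into[of _ Base "carrier M"] by auto
  have e: "e \<in> mod_hom R (P 0) M"
    unfolding e_def P_def X0 by (rule free_ext_hom[OF gB])
  have eim: "e ` carrier (P 0) = carrier M"
    unfolding e_def P_def X0
    by (rule free_ext_image[OF gB]) (auto simp: inv_into_image_cancel inj smult_closed)
  have g: "inv_into (H n) (syz R) \<in> X (Suc n) \<rightarrow> H n" for n
    unfolding XS using inv_into_into[of _ "syz R" "H n"] by auto
  have sub: "H n \<subseteq> carrier (P n) \<and> \<zero>\<^bsub>P n\<^esub> \<in> H n \<and> (\<forall>x\<in>H n. \<forall>y\<in>H n. x \<oplus>\<^bsub>P n\<^esub> y \<in> H n) \<and>
      (\<forall>a\<in>carrier R. \<forall>x\<in>H n. a \<odot>\<^bsub>P n\<^esub> x \<in> H n) \<and> d n \<in> mod_hom R (P (Suc n)) (P n)" for n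
  proof (induction n)
    case 0
    note s = hom_kernel_submodule[OF lm M e, folded H0]
    have "inv_into (H 0) (syz R) \<in> X (Suc 0) \<rightarrow> carrier (P 0)" using g[of 0] s(4) by auto
    from left_module.free_ext_hom[OF lm this] s show ?case
      by (simp add: d_def next_map_def P_def XS)
  next
    case (Suc n)
    then have "d n \<in> mod_hom R (P (Suc n)) (P n)" by blast
    note s = hom_kernel_submodule[OF lm lm this, folded HS]
    have "inv_into (H (Suc n)) (syz R) \<in> X (Suc (Suc n)) \<rightarrow> carrier (P (Suc n))"
      using g[of "Suc n"] s(4) by auto
    from left_module.free_ext_hom[OF lm this] s show ?case
      by (simp add: d_def next_map_def P_def XS)
  qed
  have im: "d n ` carrier (P (Suc n)) = H n" for n
  proof -
    have "inj_on (syz R) (H n)" using inj_on_syz sub[of n] carr[of n] by (metis inj_on_subset)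
    then have "inv_into (H n) (syz R) ` X (Suc n) = H n"
      by (simp add: XS inv_into_image_cancel)
    moreover have "inv_into (H n) (syz R) \<in> X (Suc n) \<rightarrow> carrier (P n)" using g[of n] sub[of n] by auto
    ultimately have "free_ext R (P n) (X (Suc n)) (inv_into (H n) (syz R))
        ` carrier (free_module R (X (Suc n))) = H n"
      using sub[of n] by (intro left_module.free_ext_image[OF lm]) auto
    then show ?thesis by (simp add: d_def next_map_def P_def XS)
  qed
  have proj: "projective_module R (P n)" for n
    unfolding P_def by (rule free_projective[OF ring])
  have "projective_resolution R P d e M"
    unfolding projective_resolution_def
    using M e eim sub im[of 0] H0 im HS proj by simp
  then show ?thesis by blast
qed


section \<open>The algebra is a ring and \<open>\<bbbk>\<^sub>U\<close> is a module over it\<close>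

lemma monoid_congruence_subset: "monoid_congruence G R \<subseteq> lists G \<times> lists G"
proof -
  have "u \<in> lists G \<and> v \<in> lists G" if "(u, v) \<in> monoid_congruence G R" for u v
    using that by (induction rule: monoid_congruence.induct) auto
  then show ?thesis by auto
qed

lemma equiv_monoid_congruence: "equiv (lists G) (monoid_congruence G R)"
proof (rule equivI)
  show "monoid_congruence G R \<subseteq> lists G \<times> lists G" by (rule monoid_congruence_subset)
  show "refl_on (lists G) (monoid_congruence G R)"
    using monoid_congruence_subset by (auto simp: refl_on_def intro: cong_refl)
  show "sym_on UNIV (monoid_congruence G R)" by (auto intro: symI cong_sym)
  show "trans_on UNIV (monoid_congruence G R)" by (auto intro: transI cong_trans)
qed

lemma presented_mult:
  assumes "u \<in> lists G" "v \<in> lists G"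
  shows "monoid_congruence G R `` {u} \<otimes>\<^bsub>presented_monoid G R\<^esub> monoid_congruence G R `` {v}
    = monoid_congruence G R `` {u @ v}"
proof -
  have "monoid_congruence G R `` {x @ y} = monoid_congruence G R `` {u @ v}"
    if "x \<in> monoid_congruence G R `` {u}" "y \<in> monoid_congruence G R `` {v}" for x y
    using that by (intro equiv_class_eq[OF equiv_monoid_congruence]) (auto intro: cong_sym cong_mult)
  then have "(\<Union>x\<in>monoid_congruence G R `` {u}. \<Union>y\<in>monoid_congruence G R `` {v}. monoid_congruence G R `` {x @ y})
     = (\<Union>x\<in>monoid_congruence G R `` {u}. \<Union>y\<in>monoid_congruence G R `` {v}. monoid_congruence G R `` {u @ v})"
    by simp
  also have "\<dots> = monoid_congruence G R `` {u @ v}"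
    using assms cong_refl[of u G R] cong_refl[of v G R] by blast
  finally show ?thesis by (simp add: presented_monoid_def)
qed

lemma presented_monoid_monoid: "monoid (presented_monoid G R)"
proof (rule monoidI)
  let ?M = "presented_monoid G R"
  have cl: "\<exists>u\<in>lists G. x = monoid_congruence G R `` {u}" if "x \<in> carrier ?M" for x
    using that by (auto simp: presented_monoid_def elim!: quotientE)
  have cc: "monoid_congruence G R `` {u} \<in> carrier ?M" if "u \<in> lists G" for u
    using that by (auto simp: presented_monoid_def intro: quotientI)
  have one: "\<one>\<^bsub>?M\<^esub> = monoid_congruence G R `` {[]}" by (simp add: presented_monoid_def)
  show "\<one>\<^bsub>?M\<^esub> \<in> carrier ?M" unfolding one by (rule cc) simp
  fix x y assume x: "x \<in> carrier ?M" and y: "y \<in> carrier ?M"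
  obtain u v where u: "u \<in> lists G" "x = monoid_congruence G R `` {u}"
    and v: "v \<in> lists G" "y = monoid_congruence G R `` {v}" using cl[OF x] cl[OF y] by blast
  show "x \<otimes>\<^bsub>?M\<^esub> y \<in> carrier ?M" using u v cc[of "u @ v"] by (simp add: presented_mult)
  show "\<one>\<^bsub>?M\<^esub> \<otimes>\<^bsub>?M\<^esub> x = x" "x \<otimes>\<^bsub>?M\<^esub> \<one>\<^bsub>?M\<^esub> = x"
    using u by (auto simp: one presented_mult)
  fix z assume z: "z \<in> carrier ?M"
  obtain w where w: "w \<in> lists G" "z = monoid_congruence G R `` {w}" using cl[OF z] by blast
  show "(x \<otimes>\<^bsub>?M\<^esub> y) \<otimes>\<^bsub>?M\<^esub> z = x \<otimes>\<^bsub>?M\<^esub> (y \<otimes>\<^bsub>?M\<^esub> z)"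
  proof -
    have "u @ v \<in> lists G" "v @ w \<in> lists G" using u v w by auto
    then show ?thesis using u v w by (simp only: presented_mult) simp
  qed
qed

context abelian_monoid begin

lemma finsum_swap:
  assumes "finite A" "finite B" "\<And>a b. a \<in> A \<Longrightarrow> b \<in> B \<Longrightarrow> h a b \<in> carrier G"
  shows "(\<Oplus>a\<in>A. \<Oplus>b\<in>B. h a b) = (\<Oplus>b\<in>B. \<Oplus>a\<in>A. h a b)"
  using assms(1,3)
proof (induction A rule: finite_induct)
  case (insert x A)
  have "(\<Oplus>b\<in>B. \<Oplus>a\<in>insert x A. h a b) = (\<Oplus>b\<in>B. h x b \<oplus> (\<Oplus>a\<in>A. h a b))"
    using insert by (intro finsum_cong') (auto simp: Pi_def intro!: finsum_closed finsum_insert)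
  also have "\<dots> = (\<Oplus>b\<in>B. h x b) \<oplus> (\<Oplus>b\<in>B. \<Oplus>a\<in>A. h a b)"
    using insert by (intro finsum_addf) (auto intro!: finsum_closed)
  finally show ?case
    using insert by (simp add: Pi_def finsum_insert finsum_closed)
qed simp

lemma finsum_delta:
  assumes "finite A" "a \<in> A" "c \<in> carrier G"
  shows "(\<Oplus>x\<in>A. if x = a then c else \<zero>) = c"
  using add.finprod_singleton_swap[of a A "\<lambda>_. c"] assms by auto

lemma finsum_Times:
  assumes "finite A" "finite B" "\<And>a b. a \<in> A \<Longrightarrow> b \<in> B \<Longrightarrow> h a b \<in> carrier G"
  shows "(\<Oplus>p\<in>A \<times> B. h (fst p) (snd p)) = (\<Oplus>a\<in>A. \<Oplus>b\<in>B. h a b)"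
  using assms(1,3)
proof (induction A rule: finite_induct)
  case (insert x A)
  have "insert x A \<times> B = (\<lambda>b. (x, b)) ` B \<union> A \<times> B" by auto
  then have "(\<Oplus>p\<in>insert x A \<times> B. h (fst p) (snd p))
      = (\<Oplus>p\<in>(\<lambda>b. (x, b)) ` B. h (fst p) (snd p)) \<oplus> (\<Oplus>p\<in>A \<times> B. h (fst p) (snd p))"
    using insert assms(2) by (simp only:) (intro finsum_Un_disjoint, auto)
  also have "(\<Oplus>p\<in>(\<lambda>b. (x, b)) ` B. h (fst p) (snd p)) = (\<Oplus>b\<in>B. h x b)"
    using insert by (subst finsum_reindex) (auto simp: inj_on_def)
  finally show ?case using insert by (simp add: Pi_def finsum_insert finsum_closed)
qed simp

end

context
  fixes K :: "('k, 'z) ring_scheme" and B :: "('b, 'y) monoid_scheme"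
  assumes K: "cring K" and B: "monoid B"
begin

interpretation K: cring K by (rule K)
interpretation B: monoid B by (rule B)

abbreviation "alg \<equiv> monoid_algebra K B"
abbreviation "nonzeros f \<equiv> {x. f x \<noteq> \<zero>\<^bsub>K\<^esub>}"

lemma alg_carrier: "carrier alg = fin_supp K (carrier B)" by (simp add: monoid_algebra_def)

lemma alg_val: "f \<in> carrier alg \<Longrightarrow> f x \<in> carrier K"
  by (cases "x \<in> carrier B") (auto simp: alg_carrier fin_supp_def)
lemma alg_nonzeros: "f \<in> carrier alg \<Longrightarrow> finite (nonzeros f)" "f \<in> carrier alg \<Longrightarrow> nonzeros f \<subseteq> carrier B"
  by (auto simp: alg_carrier fin_supp_def)
lemma alg_memI: "(\<And>x. f x \<in> carrier K) \<Longrightarrow> finite S \<Longrightarrow> S \<subseteq> carrier B \<Longrightarrow> nonzeros f \<subseteq> S \<Longrightarrow> f \<in> carrier alg"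
  by (auto simp: alg_carrier fin_supp_def intro: finite_subset)

lemma alg_mult_eq:
  assumes f: "f \<in> carrier alg" and g: "g \<in> carrier alg"
    and S: "finite S" "nonzeros f \<subseteq> S" and T: "finite T" "nonzeros g \<subseteq> T"
  shows "(f \<otimes>\<^bsub>alg\<^esub> g) x =
    (\<Oplus>\<^bsub>K\<^esub>y\<in>S. \<Oplus>\<^bsub>K\<^esub>z\<in>T. if y \<otimes>\<^bsub>B\<^esub> z = x then f y \<otimes>\<^bsub>K\<^esub> g z else \<zero>\<^bsub>K\<^esub>)"
proof -
  note v = alg_val[OF f] alg_val[OF g]
  have "(f \<otimes>\<^bsub>alg\<^esub> g) x = (\<Oplus>\<^bsub>K\<^esub>p\<in>S \<times> T. if fst p \<otimes>\<^bsub>B\<^esub> snd p = x then f (fst p) \<otimes>\<^bsub>K\<^esub> g (snd p) else \<zero>\<^bsub>K\<^esub>)"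
    unfolding monoid_algebra_def monoid.simps
    using S T by (intro K.add.finprod_mono_neutral_cong_left) (auto simp: v)
  also have "\<dots> = (\<Oplus>\<^bsub>K\<^esub>y\<in>S. \<Oplus>\<^bsub>K\<^esub>z\<in>T. if y \<otimes>\<^bsub>B\<^esub> z = x then f y \<otimes>\<^bsub>K\<^esub> g z else \<zero>\<^bsub>K\<^esub>)"
    using S(1) T(1) v by (intro K.finsum_Times[where h = "\<lambda>y z. if y \<otimes>\<^bsub>B\<^esub> z = x then f y \<otimes>\<^bsub>K\<^esub> g z else \<zero>\<^bsub>K\<^esub>"]) auto
  finally show ?thesis .
qed

lemma alg_mult:
  assumes f: "f \<in> carrier alg" and g: "g \<in> carrier alg"
  defines "W \<equiv> (\<lambda>(y, z). y \<otimes>\<^bsub>B\<^esub> z) ` (nonzeros f \<times> nonzeros g)"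
  shows "finite W" "W \<subseteq> carrier B" "nonzeros (f \<otimes>\<^bsub>alg\<^esub> g) \<subseteq> W" "(f \<otimes>\<^bsub>alg\<^esub> g) x \<in> carrier K" "f \<otimes>\<^bsub>alg\<^esub> g \<in> carrier alg"
proof -
  show W: "finite W" "W \<subseteq> carrier B" using alg_nonzeros[OF f] alg_nonzeros[OF g] by (auto simp: W_def)
  show v: "(f \<otimes>\<^bsub>alg\<^esub> g) x \<in> carrier K" for x
    unfolding alg_mult_eq[OF f g alg_nonzeros(1)[OF f] order_refl alg_nonzeros(1)[OF g] order_refl]
    by (auto intro!: K.finsum_closed simp: alg_val[OF f] alg_val[OF g])
  show s: "nonzeros (f \<otimes>\<^bsub>alg\<^esub> g) \<subseteq> W"
  proof
    fix x assume x: "x \<in> nonzeros (f \<otimes>\<^bsub>alg\<^esub> g)"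
    show "x \<in> W"
    proof (rule ccontr)
      assume "x \<notin> W"
      then have "{(y, z). f y \<noteq> \<zero>\<^bsub>K\<^esub> \<and> g z \<noteq> \<zero>\<^bsub>K\<^esub> \<and> y \<otimes>\<^bsub>B\<^esub> z = x} = {}" by (auto simp: W_def)
      then have "(f \<otimes>\<^bsub>alg\<^esub> g) x = \<zero>\<^bsub>K\<^esub>" unfolding monoid_algebra_def monoid.simps by (simp only: K.finsum_empty)
      with x show False by simp
    qed
  qed
  show "f \<otimes>\<^bsub>alg\<^esub> g \<in> carrier alg" by (rule alg_memI[OF v W s])
qed

definition pairing :: "('b \<Rightarrow> 'k) \<Rightarrow> ('b \<Rightarrow> 'k) \<Rightarrow> 'k" where
  "pairing f c = (\<Oplus>\<^bsub>K\<^esub>b\<in>nonzeros f. f b \<otimes>\<^bsub>K\<^esub> c b)"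

lemma pairing_superset:
  assumes "f \<in> carrier alg" "finite S" "nonzeros f \<subseteq> S" "\<And>b. c b \<in> carrier K"
  shows "pairing f c = (\<Oplus>\<^bsub>K\<^esub>b\<in>S. f b \<otimes>\<^bsub>K\<^esub> c b)"
  unfolding pairing_def using assms alg_val[OF assms(1)]
  by (intro K.add.finprod_mono_neutral_cong_left) auto

lemma pairing_mult:
  assumes f: "f \<in> carrier alg" and g: "g \<in> carrier alg" and c: "\<And>b. c b \<in> carrier K"
  shows "pairing (f \<otimes>\<^bsub>alg\<^esub> g) c = pairing f (\<lambda>y. pairing g (\<lambda>z. c (y \<otimes>\<^bsub>B\<^esub> z)))"
proof -
  let ?W = "(\<lambda>(y, z). y \<otimes>\<^bsub>B\<^esub> z) ` (nonzeros f \<times> nonzeros g)"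
  note F = alg_nonzeros(1)[OF f] and G = alg_nonzeros(1)[OF g] and v = alg_val[OF f] alg_val[OF g]
  let ?t = "\<lambda>y z w. if y \<otimes>\<^bsub>B\<^esub> z = w then f y \<otimes>\<^bsub>K\<^esub> g z else \<zero>\<^bsub>K\<^esub>"
  have "pairing (f \<otimes>\<^bsub>alg\<^esub> g) c = (\<Oplus>\<^bsub>K\<^esub>w\<in>?W. (f \<otimes>\<^bsub>alg\<^esub> g) w \<otimes>\<^bsub>K\<^esub> c w)"
    by (rule pairing_superset[OF alg_mult(5)[OF f g] alg_mult(1)[OF f g] alg_mult(3)[OF f g] c])
  also have "\<dots> = (\<Oplus>\<^bsub>K\<^esub>w\<in>?W. \<Oplus>\<^bsub>K\<^esub>y\<in>nonzeros f. \<Oplus>\<^bsub>K\<^esub>z\<in>nonzeros g. ?t y z w \<otimes>\<^bsub>K\<^esub> c w)"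
    unfolding alg_mult_eq[OF f g F order_refl G order_refl]
    by (intro K.finsum_cong' refl)
       (auto simp: v c F G K.finsum_ldistr Pi_def intro!: K.finsum_closed K.finsum_cong')
  also have "\<dots> = (\<Oplus>\<^bsub>K\<^esub>y\<in>nonzeros f. \<Oplus>\<^bsub>K\<^esub>w\<in>?W. \<Oplus>\<^bsub>K\<^esub>z\<in>nonzeros g. ?t y z w \<otimes>\<^bsub>K\<^esub> c w)"
    using F G v c by (intro K.finsum_swap) (auto intro!: K.finsum_closed)
  also have "\<dots> = (\<Oplus>\<^bsub>K\<^esub>y\<in>nonzeros f. \<Oplus>\<^bsub>K\<^esub>z\<in>nonzeros g. \<Oplus>\<^bsub>K\<^esub>w\<in>?W. ?t y z w \<otimes>\<^bsub>K\<^esub> c w)"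
    using F G v c by (intro K.finsum_cong' refl K.finsum_swap) (auto intro!: K.finsum_closed)
  also have "\<dots> = (\<Oplus>\<^bsub>K\<^esub>y\<in>nonzeros f. \<Oplus>\<^bsub>K\<^esub>z\<in>nonzeros g. f y \<otimes>\<^bsub>K\<^esub> (g z \<otimes>\<^bsub>K\<^esub> c (y \<otimes>\<^bsub>B\<^esub> z)))"
  proof (intro K.finsum_cong' refl)
    fix y z assume y: "y \<in> nonzeros f" and z: "z \<in> nonzeros g"
    have "(\<Oplus>\<^bsub>K\<^esub>w\<in>?W. ?t y z w \<otimes>\<^bsub>K\<^esub> c w)
        = (\<Oplus>\<^bsub>K\<^esub>w\<in>?W. if w = y \<otimes>\<^bsub>B\<^esub> z then f y \<otimes>\<^bsub>K\<^esub> (g z \<otimes>\<^bsub>K\<^esub> c (y \<otimes>\<^bsub>B\<^esub> z)) else \<zero>\<^bsub>K\<^esub>)"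
      by (rule K.finsum_cong') (auto simp: v c K.m_assoc)
    also have "\<dots> = f y \<otimes>\<^bsub>K\<^esub> (g z \<otimes>\<^bsub>K\<^esub> c (y \<otimes>\<^bsub>B\<^esub> z))"
      using F G y z v c by (intro K.finsum_delta) (auto simp: image_iff)
    finally show "(\<Oplus>\<^bsub>K\<^esub>w\<in>?W. ?t y z w \<otimes>\<^bsub>K\<^esub> c w) = f y \<otimes>\<^bsub>K\<^esub> (g z \<otimes>\<^bsub>K\<^esub> c (y \<otimes>\<^bsub>B\<^esub> z))" .
  qed (auto simp: v c intro!: K.finsum_closed)
  also have "\<dots> = pairing f (\<lambda>y. pairing g (\<lambda>z. c (y \<otimes>\<^bsub>B\<^esub> z)))"
    unfolding pairing_def
    by (intro K.finsum_cong' refl)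
       (auto simp: v c F G K.finsum_rdistr Pi_def intro!: K.finsum_closed)
  finally show ?thesis .
qed

lemma pairing_closed:
  assumes "f \<in> carrier alg" "\<And>b. c b \<in> carrier K"
  shows "pairing f c \<in> carrier K"
  unfolding pairing_def using alg_val[OF assms(1)] assms(2) by (auto intro!: K.finsum_closed)

lemma pairing_cong:
  assumes "f \<in> carrier alg" "\<And>b. b \<in> carrier B \<Longrightarrow> c b = c' b" "\<And>b. c' b \<in> carrier K"
  shows "pairing f c = pairing f c'"
  unfolding pairing_def using alg_val[OF assms(1)] alg_nonzeros[OF assms(1)] assms(2,3)
  by (intro K.finsum_cong') auto

lemma pairing_delta:
  assumes "f \<in> carrier alg"
  shows "pairing f (\<lambda>b. if b = x then \<one>\<^bsub>K\<^esub> else \<zero>\<^bsub>K\<^esub>) = f x"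
proof -
  have "pairing f (\<lambda>b. if b = x then \<one>\<^bsub>K\<^esub> else \<zero>\<^bsub>K\<^esub>)
      = (\<Oplus>\<^bsub>K\<^esub>b\<in>insert x (nonzeros f). f b \<otimes>\<^bsub>K\<^esub> (if b = x then \<one>\<^bsub>K\<^esub> else \<zero>\<^bsub>K\<^esub>))"
    using alg_nonzeros[OF assms] by (intro pairing_superset assms) auto
  also have "\<dots> = (\<Oplus>\<^bsub>K\<^esub>b\<in>insert x (nonzeros f). if b = x then f x else \<zero>\<^bsub>K\<^esub>)"
    using alg_val[OF assms] by (intro K.finsum_cong') auto
  also have "\<dots> = f x" using alg_nonzeros[OF assms] alg_val[OF assms] by (intro K.finsum_delta) auto
  finally show ?thesis .
qed

lemma alg_eqI:
  assumes "f \<in> carrier alg" "g \<in> carrier alg" "\<And>c. (\<And>b. c b \<in> carrier K) \<Longrightarrow> pairing f c = pairing g c"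
  shows "f = g"
proof
  fix x
  show "f x = g x"
    using assms(3)[of "\<lambda>b. if b = x then \<one>\<^bsub>K\<^esub> else \<zero>\<^bsub>K\<^esub>"] pairing_delta[OF assms(1)] pairing_delta[OF assms(2)]
    by simp
qed

lemma alg_one_closed: "\<one>\<^bsub>alg\<^esub> \<in> carrier alg"
  by (rule alg_memI[of _ "{\<one>\<^bsub>B\<^esub>}"]) (auto simp: monoid_algebra_def)

lemma pairing_one:
  assumes "\<And>b. c b \<in> carrier K"
  shows "pairing \<one>\<^bsub>alg\<^esub> c = c \<one>\<^bsub>B\<^esub>"
proof -
  have "pairing \<one>\<^bsub>alg\<^esub> c = (\<Oplus>\<^bsub>K\<^esub>b\<in>{\<one>\<^bsub>B\<^esub>}. \<one>\<^bsub>alg\<^esub> b \<otimes>\<^bsub>K\<^esub> c b)"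
    by (rule pairing_superset[OF alg_one_closed]) (auto simp: monoid_algebra_def assms)
  also have "\<dots> = c \<one>\<^bsub>B\<^esub>" using assms by (subst K.finsum_insert) (auto simp: monoid_algebra_def)
  finally show ?thesis .
qed

lemma alg_add_closed: "f \<in> carrier alg \<Longrightarrow> g \<in> carrier alg \<Longrightarrow> f \<oplus>\<^bsub>alg\<^esub> g \<in> carrier alg"
  by (rule alg_memI[of _ "nonzeros f \<union> nonzeros g"]) (auto simp: monoid_algebra_def alg_val alg_nonzeros dest: alg_nonzeros(2))

lemma pairing_add:
  assumes f: "f \<in> carrier alg" and g: "g \<in> carrier alg" and c: "\<And>b. c b \<in> carrier K"
  shows "pairing (f \<oplus>\<^bsub>alg\<^esub> g) c = pairing f c \<oplus>\<^bsub>K\<^esub> pairing g c"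
proof -
  let ?S = "nonzeros f \<union> nonzeros g"
  have "pairing (f \<oplus>\<^bsub>alg\<^esub> g) c = (\<Oplus>\<^bsub>K\<^esub>b\<in>?S. (f \<oplus>\<^bsub>alg\<^esub> g) b \<otimes>\<^bsub>K\<^esub> c b)"
    by (rule pairing_superset[OF alg_add_closed[OF f g]]) (use alg_nonzeros[OF f] alg_nonzeros[OF g] c in \<open>auto simp: monoid_algebra_def\<close>)
  also have "\<dots> = (\<Oplus>\<^bsub>K\<^esub>b\<in>?S. f b \<otimes>\<^bsub>K\<^esub> c b \<oplus>\<^bsub>K\<^esub> g b \<otimes>\<^bsub>K\<^esub> c b)"
    by (rule K.finsum_cong') (use alg_val[OF f] alg_val[OF g] c in \<open>auto simp: monoid_algebra_def K.l_distr\<close>)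
  also have "\<dots> = (\<Oplus>\<^bsub>K\<^esub>b\<in>?S. f b \<otimes>\<^bsub>K\<^esub> c b) \<oplus>\<^bsub>K\<^esub> (\<Oplus>\<^bsub>K\<^esub>b\<in>?S. g b \<otimes>\<^bsub>K\<^esub> c b)"
    by (rule K.finsum_addf) (auto simp: alg_val f g c)
  also have "\<dots> = pairing f c \<oplus>\<^bsub>K\<^esub> pairing g c"
    using pairing_superset[OF f _ _ c, of ?S] pairing_superset[OF g _ _ c, of ?S] alg_nonzeros[OF f] alg_nonzeros[OF g] by simp
  finally show ?thesis .
qed

lemma pairing_add_right:
  assumes f: "f \<in> carrier alg" and c: "\<And>b. c b \<in> carrier K" and c': "\<And>b. c' b \<in> carrier K"
  shows "pairing f (\<lambda>b. c b \<oplus>\<^bsub>K\<^esub> c' b) = pairing f c \<oplus>\<^bsub>K\<^esub> pairing f c'"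
proof -
  have "pairing f (\<lambda>b. c b \<oplus>\<^bsub>K\<^esub> c' b) = (\<Oplus>\<^bsub>K\<^esub>b\<in>nonzeros f. f b \<otimes>\<^bsub>K\<^esub> c b \<oplus>\<^bsub>K\<^esub> f b \<otimes>\<^bsub>K\<^esub> c' b)"
    unfolding pairing_def by (rule K.finsum_cong') (auto simp: alg_val f c c' K.r_distr)
  also have "\<dots> = pairing f c \<oplus>\<^bsub>K\<^esub> pairing f c'"
    unfolding pairing_def by (rule K.finsum_addf) (auto simp: alg_val f c c')
  finally show ?thesis .
qed

lemma monoid_algebra_ring: "ring alg"
proof (rule ringI)
  show "abelian_group alg"
  proof (rule abelian_groupI)
    show "\<zero>\<^bsub>alg\<^esub> \<in> carrier alg" by (rule alg_memI[of _ "{}"]) (auto simp: monoid_algebra_def)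
    fix f g assume f: "f \<in> carrier alg" and g: "g \<in> carrier alg"
    show "f \<oplus>\<^bsub>alg\<^esub> g \<in> carrier alg" by (rule alg_add_closed[OF f g])
    show "f \<oplus>\<^bsub>alg\<^esub> g = g \<oplus>\<^bsub>alg\<^esub> f"
      using alg_val[OF f] alg_val[OF g] by (simp add: monoid_algebra_def K.a_comm)
    show "\<zero>\<^bsub>alg\<^esub> \<oplus>\<^bsub>alg\<^esub> f = f" using alg_val[OF f] by (simp add: monoid_algebra_def)
    have "(\<lambda>x. \<ominus>\<^bsub>K\<^esub> f x) \<in> carrier alg"
      by (rule alg_memI[of _ "nonzeros f"]) (use alg_val[OF f] alg_nonzeros[OF f] in auto)
    moreover have "(\<lambda>x. \<ominus>\<^bsub>K\<^esub> f x) \<oplus>\<^bsub>alg\<^esub> f = \<zero>\<^bsub>alg\<^esub>"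
      using alg_val[OF f] by (simp add: monoid_algebra_def K.l_neg)
    ultimately show "\<exists>y\<in>carrier alg. y \<oplus>\<^bsub>alg\<^esub> f = \<zero>\<^bsub>alg\<^esub>" by blast
    fix h assume h: "h \<in> carrier alg"
    show "(f \<oplus>\<^bsub>alg\<^esub> g) \<oplus>\<^bsub>alg\<^esub> h = f \<oplus>\<^bsub>alg\<^esub> (g \<oplus>\<^bsub>alg\<^esub> h)"
      using alg_val[OF f] alg_val[OF g] alg_val[OF h] by (simp add: monoid_algebra_def K.a_assoc)
  qed
  show "monoid alg"
  proof (rule monoidI)
    show "\<one>\<^bsub>alg\<^esub> \<in> carrier alg" by (rule alg_one_closed)
    fix f g assume f: "f \<in> carrier alg" and g: "g \<in> carrier alg"
    show "f \<otimes>\<^bsub>alg\<^esub> g \<in> carrier alg" by (rule alg_mult(5)[OF f g])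
    show "\<one>\<^bsub>alg\<^esub> \<otimes>\<^bsub>alg\<^esub> f = f"
    proof (rule alg_eqI[OF alg_mult(5)[OF alg_one_closed f] f])
      fix c :: "'b \<Rightarrow> 'k" assume c: "\<And>b. c b \<in> carrier K"
      show "pairing (\<one>\<^bsub>alg\<^esub> \<otimes>\<^bsub>alg\<^esub> f) c = pairing f c"
        unfolding pairing_mult[OF alg_one_closed f c] by (subst pairing_one) (auto intro: pairing_closed f c pairing_cong)
    qed
    show "f \<otimes>\<^bsub>alg\<^esub> \<one>\<^bsub>alg\<^esub> = f"
    proof (rule alg_eqI[OF alg_mult(5)[OF f alg_one_closed] f])
      fix c :: "'b \<Rightarrow> 'k" assume c: "\<And>b. c b \<in> carrier K"
      show "pairing (f \<otimes>\<^bsub>alg\<^esub> \<one>\<^bsub>alg\<^esub>) c = pairing f c"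
        unfolding pairing_mult[OF f alg_one_closed c] by (simp add: pairing_one c) (auto intro: f c pairing_cong)
    qed
    fix h assume h: "h \<in> carrier alg"
    show "(f \<otimes>\<^bsub>alg\<^esub> g) \<otimes>\<^bsub>alg\<^esub> h = f \<otimes>\<^bsub>alg\<^esub> (g \<otimes>\<^bsub>alg\<^esub> h)"
    proof (rule alg_eqI)
      fix c :: "'b \<Rightarrow> 'k" assume c: "\<And>b. c b \<in> carrier K"
      note fg = alg_mult(5)[OF f g] and gh = alg_mult(5)[OF g h]
      have pc: "pairing h (\<lambda>z. c (b \<otimes>\<^bsub>B\<^esub> z)) \<in> carrier K" for b by (rule pairing_closed[OF h c])
      have "pairing ((f \<otimes>\<^bsub>alg\<^esub> g) \<otimes>\<^bsub>alg\<^esub> h) c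
          = pairing f (\<lambda>x. pairing g (\<lambda>y. pairing h (\<lambda>z. c ((x \<otimes>\<^bsub>B\<^esub> y) \<otimes>\<^bsub>B\<^esub> z))))"
        unfolding pairing_mult[OF fg h c] by (rule pairing_mult[OF f g pc])
      also have "\<dots> = pairing f (\<lambda>x. pairing g (\<lambda>y. pairing h (\<lambda>z. c (x \<otimes>\<^bsub>B\<^esub> (y \<otimes>\<^bsub>B\<^esub> z)))))"
        by (intro pairing_cong f g h pairing_closed c) (simp add: B.m_assoc)
      also have "\<dots> = pairing (f \<otimes>\<^bsub>alg\<^esub> (g \<otimes>\<^bsub>alg\<^esub> h)) c"
        unfolding pairing_mult[OF f gh c] by (intro pairing_cong f pairing_mult[OF g h c, symmetric] pairing_closed[OF gh c])
      finally show "pairing ((f \<otimes>\<^bsub>alg\<^esub> g) \<otimes>\<^bsub>alg\<^esub> h) c = pairing (f \<otimes>\<^bsub>alg\<^esub> (g \<otimes>\<^bsub>alg\<^esub> h)) c" .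
    qed (auto intro: alg_mult(5) f g h)
  qed
  fix f g h assume f: "f \<in> carrier alg" and g: "g \<in> carrier alg" and h: "h \<in> carrier alg"
  note clo = alg_mult(5) alg_add_closed
  show "(f \<oplus>\<^bsub>alg\<^esub> g) \<otimes>\<^bsub>alg\<^esub> h = f \<otimes>\<^bsub>alg\<^esub> h \<oplus>\<^bsub>alg\<^esub> g \<otimes>\<^bsub>alg\<^esub> h"
    by (rule alg_eqI) (auto intro!: clo f g h simp: pairing_add pairing_mult clo f g h pairing_closed)
  show "h \<otimes>\<^bsub>alg\<^esub> (f \<oplus>\<^bsub>alg\<^esub> g) = h \<otimes>\<^bsub>alg\<^esub> f \<oplus>\<^bsub>alg\<^esub> h \<otimes>\<^bsub>alg\<^esub> g"
    by (rule alg_eqI) (auto intro!: clo f g h simp: pairing_add pairing_mult pairing_add_right clo f g h pairing_closed)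
qed

lemma pairing_smult_right:
  assumes f: "f \<in> carrier alg" and c: "\<And>b. c b \<in> carrier K" and t: "t \<in> carrier K"
  shows "pairing f (\<lambda>b. c b \<otimes>\<^bsub>K\<^esub> t) = pairing f c \<otimes>\<^bsub>K\<^esub> t"
  unfolding pairing_def using alg_nonzeros[OF f] alg_val[OF f] c t
  by (subst K.finsum_ldistr) (auto simp: K.m_assoc intro!: K.finsum_cong')

end

lemma content_word:
  fixes E :: "'v set set"
  assumes "w \<in> lists V"
  defines "C \<equiv> monoid_congruence V ({(x @ x, x) | x. x \<in> lists V} \<union>
      {(x @ y @ x, x @ y) | x y. x \<in> lists V \<and> y \<in> lists V} \<union>
      {([x, y], [y, x]) | x y. {x, y} \<in> E})"
  shows "content (C `` {w}) = set w"
proof -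
  have "set u = set v" if "(u, v) \<in> C" for u v
    using that unfolding C_def by (induction rule: monoid_congruence.induct) auto
  then have "(\<Union>v\<in>C `` {w}. set v) = (\<Union>v\<in>C `` {w}. set w)"
    by (intro SUP_cong refl) (simp add: Image_singleton_iff)
  moreover have "C `` {w} \<noteq> {}" using cong_refl[OF assms(1)] unfolding C_def by blast
  ultimately show ?thesis by (simp add: content_def)
qed

lemma content_module_left_module:
  fixes K :: "('k, 'z) ring_scheme" and V :: "'v set"
  assumes K: "cring K"
  shows "left_module (lrb_algebra K V E) (content_module K U)"
proof -
  interpret K: cring K by fact
  let ?B = "free_pc_lrb V E"
  have B: "monoid ?B" unfolding free_pc_lrb_def by (rule presented_monoid_monoid)
  note P = K B
  have cmult: "content (x \<otimes>\<^bsub>?B\<^esub> y) = content x \<union> content y" if "x \<in> carrier ?B" "y \<in> carrier ?B" for x y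
  proof -
    let ?C = "monoid_congruence V ({(x @ x, x) | x. x \<in> lists V} \<union>
      {(x @ y @ x, x @ y) | x y. x \<in> lists V \<and> y \<in> lists V} \<union>
      {([x, y], [y, x]) | x y. {x, y} \<in> E})"
    have xy: "x \<in> lists V // ?C" "y \<in> lists V // ?C"
      using that unfolding free_pc_lrb_def presented_monoid_def partial_object.simps .
    obtain u where u: "u \<in> lists V" "x = ?C `` {u}" by (rule quotientE[OF xy(1)])
    obtain v where v: "v \<in> lists V" "y = ?C `` {v}" by (rule quotientE[OF xy(2)])
    have uv: "u @ v \<in> lists V" using u(1) v(1) by simp
    show ?thesis
      unfolding u(2) v(2) free_pc_lrb_def presented_mult[OF u(1) v(1)] content_word[OF u(1)]
        content_word[OF v(1)] content_word[OF uv] by simp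
  qed
  have cone: "content \<one>\<^bsub>?B\<^esub> = {}"
    unfolding free_pc_lrb_def presented_monoid_def monoid.simps by (subst content_word) auto
  define \<chi> where "\<chi> = (\<lambda>b :: 'v list set. if content b \<subseteq> U then \<one>\<^bsub>K\<^esub> else \<zero>\<^bsub>K\<^esub>)"
  have \<chi>: "\<chi> b \<in> carrier K" for b by (simp add: \<chi>_def)
  let ?p = "pairing K"
  have act: "f \<odot>\<^bsub>content_module K U\<^esub> t = ?p f \<chi> \<otimes>\<^bsub>K\<^esub> t"
    if "f \<in> carrier (lrb_algebra K V E)" "t \<in> carrier K" for f t
  proof -
    have "f \<odot>\<^bsub>content_module K U\<^esub> t = ?p f (\<lambda>b. \<chi> b \<otimes>\<^bsub>K\<^esub> t)"
      unfolding content_module_def mk_module_simps pairing_def[OF P]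
      using alg_val[OF P that(1)] that(2) by (intro K.finsum_cong') (auto simp: \<chi>_def)
    then show ?thesis using pairing_smult_right[OF P that(1) \<chi> that(2)] by simp
  qed
  have carr: "carrier (content_module K U) = carrier K" "\<And>s t. s \<oplus>\<^bsub>content_module K U\<^esub> t = s \<oplus>\<^bsub>K\<^esub> t"
    "\<zero>\<^bsub>content_module K U\<^esub> = \<zero>\<^bsub>K\<^esub>"
    by (simp_all add: content_module_def)
  have "abelian_group (content_module K U)"
    by (rule abelian_groupI) (auto simp: carr K.a_ac intro: K.l_neg)
  moreover have "left_module_axioms (lrb_algebra K V E) (content_module K U)"
  proof
    fix f g s t
    assume f: "f \<in> carrier (lrb_algebra K V E)" and g: "g \<in> carrier (lrb_algebra K V E)"
      and s: "s \<in> carrier (content_module K U)" and t: "t \<in> carrier (content_module K U)"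
    have s: "s \<in> carrier K" and t: "t \<in> carrier K" using s t by (simp_all add: carr)
    have pf: "?p f \<chi> \<in> carrier K" and pg: "?p g \<chi> \<in> carrier K" using pairing_closed[OF P _ \<chi>] f g by auto
    show "f \<odot>\<^bsub>content_module K U\<^esub> s \<in> carrier (content_module K U)"
      using act[OF f s] pf s by (simp add: carr)
    show "(f \<oplus>\<^bsub>lrb_algebra K V E\<^esub> g) \<odot>\<^bsub>content_module K U\<^esub> s =
       f \<odot>\<^bsub>content_module K U\<^esub> s \<oplus>\<^bsub>content_module K U\<^esub> g \<odot>\<^bsub>content_module K U\<^esub> s"
      using act[OF alg_add_closed[OF P f g] s] act[OF f s] act[OF g s] pairing_add[OF P f g \<chi>] pf pg s
      by (simp add: carr K.l_distr)
    show "f \<odot>\<^bsub>content_module K U\<^esub> (s \<oplus>\<^bsub>content_module K U\<^esub> t) =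
       f \<odot>\<^bsub>content_module K U\<^esub> s \<oplus>\<^bsub>content_module K U\<^esub> f \<odot>\<^bsub>content_module K U\<^esub> t"
      using act[OF f s] act[OF f t] act[OF f, of "s \<oplus>\<^bsub>K\<^esub> t"] pf s t by (simp add: carr K.r_distr)
    have "?p (f \<otimes>\<^bsub>lrb_algebra K V E\<^esub> g) \<chi> = ?p f (\<lambda>y. ?p g (\<lambda>z. \<chi> (y \<otimes>\<^bsub>?B\<^esub> z)))"
      by (rule pairing_mult[OF P f g \<chi>])
    also have "\<dots> = ?p f (\<lambda>y. \<chi> y \<otimes>\<^bsub>K\<^esub> ?p g \<chi>)"
    proof (rule pairing_cong[OF P f])
      fix y assume y: "y \<in> carrier ?B"
      have "?p g (\<lambda>z. \<chi> (y \<otimes>\<^bsub>?B\<^esub> z)) = ?p g (\<lambda>z. \<chi> z \<otimes>\<^bsub>K\<^esub> \<chi> y)"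
        by (rule pairing_cong[OF P g]) (auto simp: \<chi>_def cmult y)
      also have "\<dots> = \<chi> y \<otimes>\<^bsub>K\<^esub> ?p g \<chi>"
        using pairing_smult_right[where c = \<chi> and t = "\<chi> y", OF P g \<chi> \<chi>] K.m_comm[OF pg \<chi>[of y]] by (simp only:)
      finally show "?p g (\<lambda>z. \<chi> (y \<otimes>\<^bsub>?B\<^esub> z)) = \<chi> y \<otimes>\<^bsub>K\<^esub> ?p g \<chi>" .
    qed (simp add: \<chi> pg)
    also have "\<dots> = ?p f \<chi> \<otimes>\<^bsub>K\<^esub> ?p g \<chi>" by (rule pairing_smult_right[OF P f \<chi> pg])
    finally show "(f \<otimes>\<^bsub>lrb_algebra K V E\<^esub> g) \<odot>\<^bsub>content_module K U\<^esub> s =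
       f \<odot>\<^bsub>content_module K U\<^esub> (g \<odot>\<^bsub>content_module K U\<^esub> s)"
      using act[OF alg_mult(5)[OF P f g] s] act[OF g s] act[OF f, of "?p g \<chi> \<otimes>\<^bsub>K\<^esub> s"] pf pg s
      by (simp add: K.m_assoc)
  next
    fix s assume s: "s \<in> carrier (content_module K U)"
    have s: "s \<in> carrier K" using s by (simp_all add: carr)
    have "?p \<one>\<^bsub>lrb_algebra K V E\<^esub> \<chi> = \<one>\<^bsub>K\<^esub>"
      by (subst pairing_one[OF P \<chi>]) (simp add: \<chi>_def cone)
    then show "\<one>\<^bsub>lrb_algebra K V E\<^esub> \<odot>\<^bsub>content_module K U\<^esub> s = s"
      using act[OF alg_one_closed[OF P] s] s by simp
  qed
  ultimately show ?thesis
    using monoid_algebra_ring[OF P] by (simp add: left_module_def)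
qed

theorem lrb_projective_resolution_exists:
  fixes K :: "('k, 'z) ring_scheme" and V U :: "'v set"
  assumes "cring K"
  shows "\<exists>(P :: nat \<Rightarrow>
      ('v list set \<Rightarrow> 'k, ('v list set \<Rightarrow> 'k, 'k) basis \<Rightarrow> 'v list set \<Rightarrow> 'k) module) d e.
    projective_resolution (lrb_algebra K V E) P d e (content_module K U)"
  using projective_resolution_exists[OF content_module_left_module[OF assms]] .

end

theory Submission
  imports Defs
begin

text \<open>
  Let \<open>e\<close> be an element of content \<open>W\<close>. The right ideal \<open>e B\<close> without \<open>e\<close> is the union of
  the right ideals \<open>e v B\<close> with \<open>v \<in> V - W\<close>; the ideals of several letters have a common
  element only if the letters form a clique \<open>S\<close>, and then they intersect in \<open>e e\<^sub>S B\<close>. Over each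
  point of \<open>e B\<close> other than \<open>e\<close> the cliques involved thus form a nonempty full simplex. Hence
  the alternating functions on the sets \<open>e e\<^sub>S B\<close> form a coresolution of \<open>\<bbbk>\<^sub>W\<close> by modules
  that are coinduced from the ground ring. These modules are acyclic for every projective
  resolution of \<open>\<bbbk>\<^sub>U\<close>, because such a resolution splits over the ground ring, and their
  homomorphisms from \<open>\<bbbk>\<^sub>U\<close> are the alternating cochains on the cliques contained in \<open>U - W\<close>.
  Dimension shifting along the coresolution gives the theorem.
\<close>

section \<open>Modules, submodules and quotients\<close>

text \<open>\<open>Ext\<close> is taken from an arbitrary given resolution \<open>P\<close> of
  \<bbbk>_U, over an arbitrary carrier type. Resolving the second argument lets \<open>P\<close> be
  used as it stands, with no comparison to a resolution built from the band. Over a general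
  commutative ring the coinduced modules need not be injective. What replaces injectivity is that
  \<bbbk>_U is free of rank one over the ground ring: the augmentation has a section, and since
  every \<open>P n\<close> is projective over the ground ring as well, the section propagates to a
  splitting of the whole resolution. The band acts on functions on \<open>e e_S B\<close> by right
  translation, and a homomorphism from \<open>M\<close> into them is determined by a functional on
  \<open>e e_S M\<close>. For \<bbbk>_U the latter is the ground ring if
  \<open>W \<union> S \<subseteq> U\<close> and zero otherwise, which singles out the cliques inside
  \<open>U - W\<close>. The empty clique contributes the functions on all of \<open>e B\<close>. It
  is the term of degree -1, so the cohomology is reduced, and cliques with \<open>n\<close> vertices
  belong to Ext in degree \<open>n\<close>.\<close>

lemma mod_homD:
  assumes "h \<in> mod_hom R M N"
  shows "x \<in> carrier M \<Longrightarrow> h x \<in> carrier N"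
    and "x \<in> carrier M \<Longrightarrow> y \<in> carrier M \<Longrightarrow> h (x \<oplus>\<^bsub>M\<^esub> y) = h x \<oplus>\<^bsub>N\<^esub> h y"
    and "a \<in> carrier R \<Longrightarrow> x \<in> carrier M \<Longrightarrow> h (a \<odot>\<^bsub>M\<^esub> x) = a \<odot>\<^bsub>N\<^esub> h x"
    and "x \<notin> carrier M \<Longrightarrow> h x = undefined"
  using assms by (auto simp: mod_hom_def PiE_def extensional_def)

lemma mod_homI:
  assumes "\<And>x. x \<in> carrier M \<Longrightarrow> h x \<in> carrier N" "\<And>x. x \<notin> carrier M \<Longrightarrow> h x = undefined"
    and "\<And>x y. x \<in> carrier M \<Longrightarrow> y \<in> carrier M \<Longrightarrow> h (x \<oplus>\<^bsub>M\<^esub> y) = h x \<oplus>\<^bsub>N\<^esub> h y"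
    and "\<And>a x. a \<in> carrier R \<Longrightarrow> x \<in> carrier M \<Longrightarrow> h (a \<odot>\<^bsub>M\<^esub> x) = a \<odot>\<^bsub>N\<^esub> h x"
  shows "h \<in> mod_hom R M N"
  using assms by (auto simp: mod_hom_def PiE_def extensional_def)

lemma mod_hom_eqI:
  assumes "f \<in> mod_hom R M N" "g \<in> mod_hom R M N" "\<And>x. x \<in> carrier M \<Longrightarrow> f x = g x"
  shows "f = g"
proof
  show "f x = g x" for x
    using assms(3) mod_homD(4)[OF assms(1)] mod_homD(4)[OF assms(2)] by (cases "x \<in> carrier M") auto
qed

lemma mod_hom_compose:
  assumes "left_module R M" "f \<in> mod_hom R M N" "g \<in> mod_hom R N Q"
  shows "compose (carrier M) g f \<in> mod_hom R M Q"
proof -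
  interpret M: left_module R M by fact
  show ?thesis
    by (rule mod_homI)
       (auto simp: compose_def mod_homD[OF assms(2)] mod_homD[OF assms(3)] M.smult_closed)
qed

lemma mod_hom_zero:
  assumes "left_module R M" "left_module R N" "h \<in> mod_hom R M N"
  shows "h \<zero>\<^bsub>M\<^esub> = \<zero>\<^bsub>N\<^esub>"
  using hom_kernel_submodule(1)[OF assms] by (simp add: a_kernel_def')

context left_module begin

lemma smult_minus_one: "x \<in> carrier M \<Longrightarrow> (\<ominus>\<^bsub>R\<^esub> \<one>\<^bsub>R\<^esub>) \<odot>\<^bsub>M\<^esub> x = \<ominus>\<^bsub>M\<^esub> x"
proof -
  assume x: "x \<in> carrier M"
  have "x \<oplus>\<^bsub>M\<^esub> (\<ominus>\<^bsub>R\<^esub> \<one>\<^bsub>R\<^esub>) \<odot>\<^bsub>M\<^esub> x = (\<one>\<^bsub>R\<^esub> \<oplus>\<^bsub>R\<^esub> (\<ominus>\<^bsub>R\<^esub> \<one>\<^bsub>R\<^esub>)) \<odot>\<^bsub>M\<^esub> x"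
    using x by (simp add: smult_l_distr smult_one)
  also have "\<dots> = \<zero>\<^bsub>M\<^esub>" using x by (simp add: R.r_neg smult_zero_l)
  finally show ?thesis using x M.minus_unique by (metis M.a_comm M.minus_equality R.add.inv_closed R.one_closed smult_closed)
qed

lemma smult_minus:
  assumes "a \<in> carrier R" "x \<in> carrier M"
  shows "a \<odot>\<^bsub>M\<^esub> (\<ominus>\<^bsub>M\<^esub> x) = \<ominus>\<^bsub>M\<^esub> (a \<odot>\<^bsub>M\<^esub> x)"
proof -
  have "a \<odot>\<^bsub>M\<^esub> (\<ominus>\<^bsub>M\<^esub> x) \<oplus>\<^bsub>M\<^esub> a \<odot>\<^bsub>M\<^esub> x = \<zero>\<^bsub>M\<^esub>"
    using assms by (simp add: smult_r_distr[symmetric] M.l_neg smult_zero_r)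
  then show ?thesis using assms smult_closed by (intro M.minus_equality[symmetric]) auto
qed

end

text \<open>Additive inverses are not asked for: with \<open>zl\<close> and distributivity the
  scalar minus one produces them.\<close>

lemma left_moduleI:
  assumes "ring R" and z: "\<zero>\<^bsub>M\<^esub> \<in> carrier M"
    and add: "\<And>x y. x \<in> carrier M \<Longrightarrow> y \<in> carrier M \<Longrightarrow> x \<oplus>\<^bsub>M\<^esub> y \<in> carrier M"
    and assoc: "\<And>x y z. x \<in> carrier M \<Longrightarrow> y \<in> carrier M \<Longrightarrow> z \<in> carrier M \<Longrightarrow>
      (x \<oplus>\<^bsub>M\<^esub> y) \<oplus>\<^bsub>M\<^esub> z = x \<oplus>\<^bsub>M\<^esub> (y \<oplus>\<^bsub>M\<^esub> z)"
    and comm: "\<And>x y. x \<in> carrier M \<Longrightarrow> y \<in> carrier M \<Longrightarrow> x \<oplus>\<^bsub>M\<^esub> y = y \<oplus>\<^bsub>M\<^esub> x"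
    and lz: "\<And>x. x \<in> carrier M \<Longrightarrow> \<zero>\<^bsub>M\<^esub> \<oplus>\<^bsub>M\<^esub> x = x"
    and sc: "\<And>a x. a \<in> carrier R \<Longrightarrow> x \<in> carrier M \<Longrightarrow> a \<odot>\<^bsub>M\<^esub> x \<in> carrier M"
    and ld: "\<And>a b x. a \<in> carrier R \<Longrightarrow> b \<in> carrier R \<Longrightarrow> x \<in> carrier M \<Longrightarrow>
      (a \<oplus>\<^bsub>R\<^esub> b) \<odot>\<^bsub>M\<^esub> x = a \<odot>\<^bsub>M\<^esub> x \<oplus>\<^bsub>M\<^esub> b \<odot>\<^bsub>M\<^esub> x"
    and rd: "\<And>a x y. a \<in> carrier R \<Longrightarrow> x \<in> carrier M \<Longrightarrow> y \<in> carrier M \<Longrightarrow>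
      a \<odot>\<^bsub>M\<^esub> (x \<oplus>\<^bsub>M\<^esub> y) = a \<odot>\<^bsub>M\<^esub> x \<oplus>\<^bsub>M\<^esub> a \<odot>\<^bsub>M\<^esub> y"
    and as: "\<And>a b x. a \<in> carrier R \<Longrightarrow> b \<in> carrier R \<Longrightarrow> x \<in> carrier M \<Longrightarrow>
      (a \<otimes>\<^bsub>R\<^esub> b) \<odot>\<^bsub>M\<^esub> x = a \<odot>\<^bsub>M\<^esub> (b \<odot>\<^bsub>M\<^esub> x)"
    and one: "\<And>x. x \<in> carrier M \<Longrightarrow> \<one>\<^bsub>R\<^esub> \<odot>\<^bsub>M\<^esub> x = x"
    and zl: "\<And>x. x \<in> carrier M \<Longrightarrow> \<zero>\<^bsub>R\<^esub> \<odot>\<^bsub>M\<^esub> x = \<zero>\<^bsub>M\<^esub>"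
  shows "left_module R M"
proof -
  interpret R: ring R by fact
  have "abelian_group M"
  proof (rule abelian_groupI)
    fix x assume x: "x \<in> carrier M"
    have "(\<ominus>\<^bsub>R\<^esub> \<one>\<^bsub>R\<^esub>) \<odot>\<^bsub>M\<^esub> x \<oplus>\<^bsub>M\<^esub> x = (\<ominus>\<^bsub>R\<^esub> \<one>\<^bsub>R\<^esub> \<oplus>\<^bsub>R\<^esub> \<one>\<^bsub>R\<^esub>) \<odot>\<^bsub>M\<^esub> x"
      using x by (simp add: ld one)
    also have "\<dots> = \<zero>\<^bsub>M\<^esub>" using x zl by (simp add: R.l_neg)
    finally show "\<exists>y\<in>carrier M. y \<oplus>\<^bsub>M\<^esub> x = \<zero>\<^bsub>M\<^esub>" using sc[OF _ x] by blast
  qed (use z add assoc comm lz in auto)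
  moreover have "left_module_axioms R M"
    by unfold_locales (use sc ld rd as one in auto)
  ultimately show ?thesis using assms(1) by (simp add: left_module_def)
qed

text \<open>Negatives are not listed because the scalar minus one provides them.\<close>

definition submodule_of :: "('r, 'z) ring_scheme \<Rightarrow> ('r, 'm, 'x) module_scheme \<Rightarrow> 'm set \<Rightarrow> bool" where
  "submodule_of R M H \<longleftrightarrow> H \<subseteq> carrier M \<and> \<zero>\<^bsub>M\<^esub> \<in> H \<and> (\<forall>x\<in>H. \<forall>y\<in>H. x \<oplus>\<^bsub>M\<^esub> y \<in> H) \<and>
     (\<forall>a\<in>carrier R. \<forall>x\<in>H. a \<odot>\<^bsub>M\<^esub> x \<in> H)"

lemma submodule_ofD:
  assumes "submodule_of R M H"
  shows "x \<in> H \<Longrightarrow> x \<in> carrier M" "\<zero>\<^bsub>M\<^esub> \<in> H" "x \<in> H \<Longrightarrow> y \<in> H \<Longrightarrow> x \<oplus>\<^bsub>M\<^esub> y \<in> H"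
    "a \<in> carrier R \<Longrightarrow> x \<in> H \<Longrightarrow> a \<odot>\<^bsub>M\<^esub> x \<in> H"
  using assms by (auto simp: submodule_of_def)

lemma submodule_left_module:
  assumes "left_module R M" "submodule_of R M H"
  shows "left_module R (M\<lparr>carrier := H\<rparr>)"
proof -
  interpret M: left_module R M by fact
  note s = submodule_ofD[OF assms(2)]
  show ?thesis
  proof (rule left_moduleI)
    show "x \<oplus>\<^bsub>M\<lparr>carrier := H\<rparr>\<^esub> y = y \<oplus>\<^bsub>M\<lparr>carrier := H\<rparr>\<^esub> x"
      if "x \<in> carrier (M\<lparr>carrier := H\<rparr>)" "y \<in> carrier (M\<lparr>carrier := H\<rparr>)" for x y
      using that M.a_comm[of x y] by (simp add: s)
  qed (simp_all add: M.R.ring_axioms s M.a_assoc M.smult_l_distr M.smult_r_distr M.smult_assoc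
        M.smult_one M.smult_zero_l)
qed

lemma submodule_kernel:
  assumes "left_module R M" "left_module R N" "h \<in> mod_hom R M N"
  shows "submodule_of R M (a_kernel M N h)"
  using hom_kernel_submodule[OF assms] by (auto simp: submodule_of_def)

lemma submodule_image:
  assumes "left_module R M" "left_module R N" "h \<in> mod_hom R M N"
  shows "submodule_of R N (h ` carrier M)"
proof -
  interpret M: left_module R M by fact
  show ?thesis unfolding submodule_of_def
  proof (intro conjI ballI)
    show "\<zero>\<^bsub>N\<^esub> \<in> h ` carrier M" using mod_hom_zero[OF assms] by (intro image_eqI[where x = "\<zero>\<^bsub>M\<^esub>"]) auto
    show "h ` carrier M \<subseteq> carrier N" by (auto simp: mod_homD[OF assms(3)])
    fix x assume "x \<in> h ` carrier M"
    then obtain u where u: "u \<in> carrier M" "x = h u" by auto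
    show "a \<odot>\<^bsub>N\<^esub> x \<in> h ` carrier M" if "a \<in> carrier R" for a
      using u that mod_homD(3)[OF assms(3) that u(1)] M.smult_closed by (metis image_eqI)
    fix y assume "y \<in> h ` carrier M"
    then obtain v where v: "v \<in> carrier M" "y = h v" by auto
    show "x \<oplus>\<^bsub>N\<^esub> y \<in> h ` carrier M" 
      using u v mod_homD(2)[OF assms(3) u(1) v(1)] by (metis image_eqI M.a_closed)
  qed
qed

lemma submodule_of_restrict:
  "submodule_of R M H \<Longrightarrow> H \<subseteq> Z \<Longrightarrow> submodule_of R (M\<lparr>carrier := Z\<rparr>) H"
  by (auto simp: submodule_of_def)

lemma submodule_abelian_subgroup:
  assumes "left_module R M" "submodule_of R M H"
  shows "abelian_subgroup H M"
proof -
  interpret M: left_module R M by fact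
  note s = submodule_ofD[OF assms(2)]
  have "\<ominus>\<^bsub>M\<^esub> x \<in> H" if "x \<in> H" for x
    using s(4)[of "\<ominus>\<^bsub>R\<^esub> \<one>\<^bsub>R\<^esub>" x] M.smult_minus_one[of x] s(1)[of x] that by simp
  then have "subgroup H (add_monoid M)"
    using s by unfold_locales (auto simp: a_inv_def[symmetric])
  then show ?thesis
    by (intro abelian_subgroupI3) (auto simp: additive_subgroup_def M.abelian_group_axioms)
qed

section \<open>Cosets and quotient modules\<close>

lemma quotient_carrier: "carrier (mod_quotient M H) = (\<lambda>x. H +>\<^bsub>M\<^esub> x) ` carrier M"
  by (auto simp: mod_quotient_def A_RCOSETS_defs a_r_coset_def)

lemma quotient_coset_eq:
  assumes "left_module R M" "submodule_of R M H" and x: "x \<in> carrier M" and y: "y \<in> carrier M"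
  shows "H +>\<^bsub>M\<^esub> x = H +>\<^bsub>M\<^esub> y \<longleftrightarrow> x \<ominus>\<^bsub>M\<^esub> y \<in> H" "x \<in> H +>\<^bsub>M\<^esub> y \<longleftrightarrow> x \<ominus>\<^bsub>M\<^esub> y \<in> H"
proof -
  interpret M: left_module R M by fact
  interpret H: abelian_subgroup H M by (rule submodule_abelian_subgroup) fact+
  show *: "x \<in> H +>\<^bsub>M\<^esub> y \<longleftrightarrow> x \<ominus>\<^bsub>M\<^esub> y \<in> H"
    using H.a_rcos_module[OF y x] by (simp add: a_minus_def)
  show "H +>\<^bsub>M\<^esub> x = H +>\<^bsub>M\<^esub> y \<longleftrightarrow> x \<ominus>\<^bsub>M\<^esub> y \<in> H"
    unfolding *[symmetric] using H.a_rcos_self[OF x] H.a_repr_independence'[OF _ y] by auto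
qed

lemma quotient_add:
  assumes "left_module R M" "submodule_of R M H" "x \<in> carrier M" "y \<in> carrier M"
  shows "(H +>\<^bsub>M\<^esub> x) \<oplus>\<^bsub>mod_quotient M H\<^esub> (H +>\<^bsub>M\<^esub> y) = H +>\<^bsub>M\<^esub> (x \<oplus>\<^bsub>M\<^esub> y)"
proof -
  interpret H: abelian_subgroup H M by (rule submodule_abelian_subgroup) fact+
  show ?thesis using assms by (simp add: mod_quotient_def H.a_rcos_sum)
qed

text \<open>\<open>mod_quotient\<close> forms the union of the cosets of \<open>a y\<close> over all
  representatives \<open>y\<close>. Two representatives differ by an element of \<open>H\<close>,
  which \<open>a\<close> keeps in \<open>H\<close>, so all these cosets coincide.\<close>

lemma quotient_smult:
  assumes "left_module R M" "submodule_of R M H" and a: "a \<in> carrier R" and x: "x \<in> carrier M"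
  shows "a \<odot>\<^bsub>mod_quotient M H\<^esub> (H +>\<^bsub>M\<^esub> x) = H +>\<^bsub>M\<^esub> (a \<odot>\<^bsub>M\<^esub> x)"
proof -
  interpret M: left_module R M by fact
  interpret H: abelian_subgroup H M by (rule submodule_abelian_subgroup) fact+
  have "H +>\<^bsub>M\<^esub> (a \<odot>\<^bsub>M\<^esub> y) = H +>\<^bsub>M\<^esub> (a \<odot>\<^bsub>M\<^esub> x)" if y: "y \<in> H +>\<^bsub>M\<^esub> x" for y
  proof -
    have yM: "y \<in> carrier M" using H.a_elemrcos_carrier[OF x y] .
    then have "y \<ominus>\<^bsub>M\<^esub> x \<in> H" using y x quotient_coset_eq(2)[OF assms(1,2)] by blast
    then have "a \<odot>\<^bsub>M\<^esub> (y \<ominus>\<^bsub>M\<^esub> x) \<in> H" by (rule submodule_ofD(4)[OF assms(2) a])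
    also have "a \<odot>\<^bsub>M\<^esub> (y \<ominus>\<^bsub>M\<^esub> x) = a \<odot>\<^bsub>M\<^esub> y \<ominus>\<^bsub>M\<^esub> a \<odot>\<^bsub>M\<^esub> x"
      using a x yM by (simp add: a_minus_def M.smult_r_distr M.smult_minus)
    finally have "a \<odot>\<^bsub>M\<^esub> y \<ominus>\<^bsub>M\<^esub> a \<odot>\<^bsub>M\<^esub> x \<in> H" .
    then show ?thesis using quotient_coset_eq(1)[OF assms(1,2), of "a \<odot>\<^bsub>M\<^esub> y" "a \<odot>\<^bsub>M\<^esub> x"] yM a x M.smult_closed by simp
  qed
  moreover have "x \<in> H +>\<^bsub>M\<^esub> x" using H.a_rcos_self x by simp
  ultimately have "(\<Union>y\<in>H +>\<^bsub>M\<^esub> x. H +>\<^bsub>M\<^esub> (a \<odot>\<^bsub>M\<^esub> y)) = H +>\<^bsub>M\<^esub> (a \<odot>\<^bsub>M\<^esub> x)" by blast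
  then show ?thesis by (simp add: mod_quotient_def)
qed

lemma quotient_closed:
  assumes "left_module R M" "submodule_of R M H"
  shows "X \<in> carrier (mod_quotient M H) \<Longrightarrow> Y \<in> carrier (mod_quotient M H) \<Longrightarrow>
      X \<oplus>\<^bsub>mod_quotient M H\<^esub> Y \<in> carrier (mod_quotient M H)"
    and "a \<in> carrier R \<Longrightarrow> X \<in> carrier (mod_quotient M H) \<Longrightarrow>
      a \<odot>\<^bsub>mod_quotient M H\<^esub> X \<in> carrier (mod_quotient M H)"
proof -
  interpret M: left_module R M by fact
  assume "X \<in> carrier (mod_quotient M H)"
  then obtain x where x: "x \<in> carrier M" "X = H +>\<^bsub>M\<^esub> x" by (auto simp: quotient_carrier)
  show "a \<odot>\<^bsub>mod_quotient M H\<^esub> X \<in> carrier (mod_quotient M H)" if "a \<in> carrier R"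
    using x that by (simp add: quotient_smult[OF assms]) (simp add: quotient_carrier M.smult_closed)
  assume "Y \<in> carrier (mod_quotient M H)"
  then obtain y where y: "y \<in> carrier M" "Y = H +>\<^bsub>M\<^esub> y" by (auto simp: quotient_carrier)
  show "X \<oplus>\<^bsub>mod_quotient M H\<^esub> Y \<in> carrier (mod_quotient M H)"
    using x y by (simp add: quotient_add[OF assms]) (simp add: quotient_carrier)
qed

text \<open>Stated for a relation rather than a map, so that the zig-zags of dimension shifting need
  no choices.\<close>

lemma quotient_isomorphic_relation:
  assumes G: "left_module R G" and G': "left_module R G'"
    and B: "submodule_of R G B" and B': "submodule_of R G' B'"
    and add: "\<And>x y x' y'. \<rho> x x' \<Longrightarrow> \<rho> y y' \<Longrightarrow> x \<in> carrier G \<Longrightarrow> y \<in> carrier G \<Longrightarrow>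
      x' \<in> carrier G' \<Longrightarrow> y' \<in> carrier G' \<Longrightarrow> \<rho> (x \<oplus>\<^bsub>G\<^esub> y) (x' \<oplus>\<^bsub>G'\<^esub> y')"
    and smult: "\<And>a x x'. \<rho> x x' \<Longrightarrow> a \<in> carrier R \<Longrightarrow> x \<in> carrier G \<Longrightarrow> x' \<in> carrier G' \<Longrightarrow>
      \<rho> (a \<odot>\<^bsub>G\<^esub> x) (a \<odot>\<^bsub>G'\<^esub> x')"
    and total: "\<And>x. x \<in> carrier G \<Longrightarrow> \<exists>x'\<in>carrier G'. \<rho> x x'"
    and surj: "\<And>x'. x' \<in> carrier G' \<Longrightarrow> \<exists>x\<in>carrier G. \<rho> x x'"
    and iff: "\<And>x x'. \<rho> x x' \<Longrightarrow> x \<in> carrier G \<Longrightarrow> x' \<in> carrier G' \<Longrightarrow> x \<in> B \<longleftrightarrow> x' \<in> B'"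
  shows "mod_isomorphic R (mod_quotient G B) (mod_quotient G' B')"
proof -
  interpret G: left_module R G by fact
  interpret G': left_module R G' by fact
  interpret B: abelian_subgroup B G by (rule submodule_abelian_subgroup[OF G B])
  \<comment> \<open>A relation that respects sums and scalars respects differences, so
    well-definedness and injectivity of \<open>h\<close> both reduce to \<open>iff\<close>.\<close>
  have minus: "x \<ominus>\<^bsub>G\<^esub> y \<in> B \<longleftrightarrow> x' \<ominus>\<^bsub>G'\<^esub> y' \<in> B'"
    if "\<rho> x x'" "\<rho> y y'" "x \<in> carrier G" "y \<in> carrier G" "x' \<in> carrier G'" "y' \<in> carrier G'" for x y x' y'
  proof (rule iff)
    show "\<rho> (x \<ominus>\<^bsub>G\<^esub> y) (x' \<ominus>\<^bsub>G'\<^esub> y')"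
      using that add[of x x' "\<ominus>\<^bsub>G\<^esub> y" "\<ominus>\<^bsub>G'\<^esub> y'"] smult[of y y' "\<ominus>\<^bsub>R\<^esub> \<one>\<^bsub>R\<^esub>"]
      by (simp add: a_minus_def G.smult_minus_one G'.smult_minus_one)
  qed (use that in simp_all)
  let ?Q = "mod_quotient G B" and ?Q' = "mod_quotient G' B'"
  \<comment> \<open>By \<open>minus\<close> all cosets in this set are equal, so the union is that
    one coset and no representative has to be chosen.\<close>
  define h where "h = (\<lambda>X\<in>carrier ?Q. \<Union>{B' +>\<^bsub>G'\<^esub> x' | x x'. x \<in> X \<and> x' \<in> carrier G' \<and> \<rho> x x'})"
  have h: "h (B +>\<^bsub>G\<^esub> x) = B' +>\<^bsub>G'\<^esub> x'" if x: "x \<in> carrier G" "x' \<in> carrier G'" "\<rho> x x'" for x x'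
  proof -
    have "B' +>\<^bsub>G'\<^esub> y' = B' +>\<^bsub>G'\<^esub> x'" if y: "y \<in> B +>\<^bsub>G\<^esub> x" "y' \<in> carrier G'" "\<rho> y y'" for y y'
    proof -
      have yG: "y \<in> carrier G" using B.a_elemrcos_carrier[OF x(1) y(1)] .
      have "y \<ominus>\<^bsub>G\<^esub> x \<in> B" using y(1) x(1) yG quotient_coset_eq(2)[OF G B] by blast
      then show ?thesis
        using minus[OF y(3) x(3) yG x(1) y(2) x(2)] quotient_coset_eq(1)[OF G' B' y(2) x(2)] by blast
    qed
    moreover have "x \<in> B +>\<^bsub>G\<^esub> x" by (rule B.a_rcos_self[OF x(1)])
    ultimately have "{B' +>\<^bsub>G'\<^esub> y' | y y'. y \<in> B +>\<^bsub>G\<^esub> x \<and> y' \<in> carrier G' \<and> \<rho> y y'} = {B' +>\<^bsub>G'\<^esub> x'}"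
      using x by blast
    then show ?thesis using x by (simp add: h_def quotient_carrier)
  qed
  have rep: "\<exists>x x'. X = B +>\<^bsub>G\<^esub> x \<and> x \<in> carrier G \<and> x' \<in> carrier G' \<and> \<rho> x x'" if "X \<in> carrier ?Q" for X
    using that total by (fastforce simp: quotient_carrier)
  have "h \<in> mod_hom R ?Q ?Q'"
  proof (rule mod_homI)
    fix X assume X: "X \<in> carrier ?Q"
    obtain x x' where x: "X = B +>\<^bsub>G\<^esub> x" "x \<in> carrier G" "x' \<in> carrier G'" "\<rho> x x'"
      using rep[OF X] by blast
    show "h X \<in> carrier ?Q'" using x h[OF x(2-4)] by (simp add: quotient_carrier)
    show "h (a \<odot>\<^bsub>?Q\<^esub> X) = a \<odot>\<^bsub>?Q'\<^esub> h X" if a: "a \<in> carrier R" for a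
      using x a h[OF x(2-4)] h[OF _ _ smult[OF x(4) a x(2,3)]]
      by (simp add: quotient_smult[OF G B] quotient_smult[OF G' B'] G.smult_closed G'.smult_closed)
    fix Y assume Y: "Y \<in> carrier ?Q"
    obtain y y' where y: "Y = B +>\<^bsub>G\<^esub> y" "y \<in> carrier G" "y' \<in> carrier G'" "\<rho> y y'"
      using rep[OF Y] by blast
    show "h (X \<oplus>\<^bsub>?Q\<^esub> Y) = h X \<oplus>\<^bsub>?Q'\<^esub> h Y"
      using x y h[OF x(2-4)] h[OF y(2-4)] h[OF _ _ add[OF x(4) y(4) x(2) y(2) x(3) y(3)]]
      by (simp add: quotient_add[OF G B] quotient_add[OF G' B'])
  qed (simp add: h_def)
  moreover have "bij_betw h (carrier ?Q) (carrier ?Q')"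
  proof (rule bij_betw_imageI)
    show "inj_on h (carrier ?Q)"
    proof (rule inj_onI)
      fix X Y assume X: "X \<in> carrier ?Q" and Y: "Y \<in> carrier ?Q" and eq: "h X = h Y"
      obtain x x' where x: "X = B +>\<^bsub>G\<^esub> x" "x \<in> carrier G" "x' \<in> carrier G'" "\<rho> x x'"
        using rep[OF X] by blast
      obtain y y' where y: "Y = B +>\<^bsub>G\<^esub> y" "y \<in> carrier G" "y' \<in> carrier G'" "\<rho> y y'"
        using rep[OF Y] by blast
      have "x' \<ominus>\<^bsub>G'\<^esub> y' \<in> B'" using eq h[OF x(2-4)] h[OF y(2-4)] quotient_coset_eq(1)[OF G' B' x(3) y(3)]
        unfolding x(1) y(1) by simp
      then show "X = Y"
        using minus[OF x(4) y(4)] x y quotient_coset_eq(1)[OF G B x(2) y(2)] by simp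
    qed
    show "h ` carrier ?Q = carrier ?Q'"
    proof
      show "h ` carrier ?Q \<subseteq> carrier ?Q'"
      proof
        fix X' assume "X' \<in> h ` carrier ?Q"
        then obtain X where X: "X \<in> carrier ?Q" "X' = h X" by blast
        obtain x x' where x: "X = B +>\<^bsub>G\<^esub> x" "x \<in> carrier G" "x' \<in> carrier G'" "\<rho> x x'"
          using rep[OF X(1)] by blast
        show "X' \<in> carrier ?Q'" unfolding X(2) x(1) h[OF x(2-4)] using x(3) by (simp add: quotient_carrier)
      qed
      show "carrier ?Q' \<subseteq> h ` carrier ?Q"
      proof
        fix X' assume "X' \<in> carrier ?Q'"
        then obtain x' where x': "X' = B' +>\<^bsub>G'\<^esub> x'" "x' \<in> carrier G'" by (auto simp: quotient_carrier)
        then obtain x where "x \<in> carrier G" "\<rho> x x'" using surj by blast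
        then have "h (B +>\<^bsub>G\<^esub> x) = X'" "B +>\<^bsub>G\<^esub> x \<in> carrier ?Q" using x' h[of x x'] by (simp_all add: quotient_carrier)
        then show "X' \<in> h ` carrier ?Q" by blast
      qed
    qed
  qed
  ultimately show ?thesis by (auto simp: mod_isomorphic_def)
qed

text \<open>Closure of \<open>L\<close> under its operations makes the composite linear. For the
  quotients it comes from \<open>quotient_closed\<close>, without a proof that they are
  modules.\<close>

lemma mod_isomorphic_trans:
  assumes "mod_isomorphic R L M" "mod_isomorphic R M N"
    and closed: "\<And>x y. x \<in> carrier L \<Longrightarrow> y \<in> carrier L \<Longrightarrow> x \<oplus>\<^bsub>L\<^esub> y \<in> carrier L"
      "\<And>a x. a \<in> carrier R \<Longrightarrow> x \<in> carrier L \<Longrightarrow> a \<odot>\<^bsub>L\<^esub> x \<in> carrier L"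
  shows "mod_isomorphic R L N"
proof -
  obtain f where f: "f \<in> mod_hom R L M" "bij_betw f (carrier L) (carrier M)"
    using assms(1) by (auto simp: mod_isomorphic_def)
  obtain g where g: "g \<in> mod_hom R M N" "bij_betw g (carrier M) (carrier N)"
    using assms(2) by (auto simp: mod_isomorphic_def)
  have "compose (carrier L) g f \<in> mod_hom R L N"
    by (rule mod_homI) (auto simp: compose_def closed mod_homD[OF f(1)] mod_homD[OF g(1)])
  moreover have "bij_betw (compose (carrier L) g f) (carrier L) (carrier N)"
    using bij_betw_compose[OF f(2) g(2)] .
  ultimately show ?thesis by (auto simp: mod_isomorphic_def)
qed

section \<open>Projective modules and restriction of scalars\<close>

lemma mod_hom_id:
  assumes "left_module R M"
  shows "(\<lambda>x\<in>carrier M. x) \<in> mod_hom R M M"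
proof -
  interpret M: left_module R M by fact
  show ?thesis by (rule mod_homI) (auto simp: M.smult_closed)
qed

lemma mod_hom_minus:
  assumes "left_module R M" "left_module R N" "f \<in> mod_hom R M N" "g \<in> mod_hom R M N"
  shows "(\<lambda>x\<in>carrier M. f x \<ominus>\<^bsub>N\<^esub> g x) \<in> mod_hom R M N"
proof -
  interpret M: left_module R M by fact
  interpret N: left_module R N by fact
  note f = mod_homD(1-3)[OF assms(3)] and g = mod_homD(1-3)[OF assms(4)]
  show ?thesis
  proof (rule mod_homI)
    fix x y assume x: "x \<in> carrier M" and y: "y \<in> carrier M"
    have "(f x \<oplus>\<^bsub>N\<^esub> f y) \<ominus>\<^bsub>N\<^esub> (g x \<oplus>\<^bsub>N\<^esub> g y) = (f x \<ominus>\<^bsub>N\<^esub> g x) \<oplus>\<^bsub>N\<^esub> (f y \<ominus>\<^bsub>N\<^esub> g y)"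
      using f(1)[OF x] f(1)[OF y] g(1)[OF x] g(1)[OF y] by (simp add: a_minus_def N.minus_add N.M.add.m_ac)
    then show "(\<lambda>x\<in>carrier M. f x \<ominus>\<^bsub>N\<^esub> g x) (x \<oplus>\<^bsub>M\<^esub> y) =
      (\<lambda>x\<in>carrier M. f x \<ominus>\<^bsub>N\<^esub> g x) x \<oplus>\<^bsub>N\<^esub> (\<lambda>x\<in>carrier M. f x \<ominus>\<^bsub>N\<^esub> g x) y"
      using x y by (simp add: f(2) g(2))
  next
    fix a x assume a: "a \<in> carrier R" and x: "x \<in> carrier M"
    show "(\<lambda>x\<in>carrier M. f x \<ominus>\<^bsub>N\<^esub> g x) (a \<odot>\<^bsub>M\<^esub> x) = a \<odot>\<^bsub>N\<^esub> (\<lambda>x\<in>carrier M. f x \<ominus>\<^bsub>N\<^esub> g x) x"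
      using a x by (simp add: f g a_minus_def N.smult_r_distr N.smult_minus M.smult_closed)
  qed (simp_all add: f g)
qed

lemma free_module_hom_eqI:
  assumes "left_module R N" "f \<in> mod_hom R (free_module R X) N" "g \<in> mod_hom R (free_module R X) N"
    "\<And>x. x \<in> X \<Longrightarrow> f (free_gen R x) = g (free_gen R x)"
  shows "f = g"
proof -
  interpret N: left_module R N by fact
  have "free_ext R N X (\<lambda>x. f (free_gen R x)) = free_ext R N X (\<lambda>x. g (free_gen R x))"
    by (rule N.free_ext_cong)
       (auto simp: assms(4) intro!: mod_homD(1)[OF assms(3)] N.free_gen_in simp: free_module_def)
  then show ?thesis using mod_hom_free_eq[OF assms(1,2)] mod_hom_free_eq[OF assms(1,3)] by simp
qed

text \<open>Freeness reduces lifting to the choice of one preimage per generator. The linear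
  extension of that choice, followed by \<open>d\<close>, agrees with \<open>h\<close> on generators
  and hence everywhere.\<close>

lemma free_module_lift:
  assumes "left_module R L" "left_module R N" "d \<in> mod_hom R L N" "h \<in> mod_hom R (free_module R X) N"
    "h ` carrier (free_module R X) \<subseteq> d ` carrier L"
  obtains s where "s \<in> mod_hom R (free_module R X) L"
    "\<And>x. x \<in> carrier (free_module R X) \<Longrightarrow> d (s x) = h x"
proof -
  interpret L: left_module R L by fact
  interpret F: left_module R "free_module R X" by (rule free_module_left_module) (rule L.R.ring_axioms)
  have gen: "free_gen R x \<in> carrier (free_module R X)" if "x \<in> X" for x
    using L.free_gen_in[OF that] by (simp add: free_module_def)
  have "\<forall>x. \<exists>l. x \<in> X \<longrightarrow> l \<in> carrier L \<and> d l = h (free_gen R x)"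
    using assms(5) gen by (force simp: image_subset_iff image_iff)
  then obtain c where c: "\<And>x. x \<in> X \<Longrightarrow> c x \<in> carrier L \<and> d (c x) = h (free_gen R x)" by metis
  define s where "s = free_ext R L X c"
  have cX: "c \<in> X \<rightarrow> carrier L" using c by auto
  have s: "s \<in> mod_hom R (free_module R X) L" unfolding s_def by (rule L.free_ext_hom[OF cX])
  have "compose (carrier (free_module R X)) d s = h"
    by (rule free_module_hom_eqI[OF assms(2) mod_hom_compose[OF F.left_module_axioms s assms(3)] assms(4)])
       (simp add: compose_def gen s_def L.free_ext_gen[OF cX] c)
  then have "d (s x) = h x" if "x \<in> carrier (free_module R X)" for x
    using that by (auto simp: compose_def fun_eq_iff split: if_splits)
  then show ?thesis using s that by blast
qed

text \<open>A retract of a free module inherits the lifting property: lift \<open>h\<close> after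
  the retraction \<open>p\<close>, then precede the lift by the section \<open>i\<close>.\<close>

lemma projective_lift:
  fixes P :: "('r, 'm, 'x) module_scheme"
  assumes "projective_module R P" "left_module R L" "left_module R N" "d \<in> mod_hom R L N" "h \<in> mod_hom R P N"
    "h ` carrier P \<subseteq> d ` carrier L"
  obtains s where "s \<in> mod_hom R P L" "\<And>x. x \<in> carrier P \<Longrightarrow> d (s x) = h x"
proof -
  interpret L: left_module R L by fact
  have P: "left_module R P" using assms(1) by (simp add: projective_module_def)
  obtain X :: "'m set" and i p where i: "i \<in> mod_hom R P (free_module R X)" and p: "p \<in> mod_hom R (free_module R X) P"
    and pi: "\<And>x. x \<in> carrier P \<Longrightarrow> p (i x) = x"
    using assms(1) unfolding projective_module_def by blast
  have F: "left_module R (free_module R X)" by (rule free_module_left_module) (rule L.R.ring_axioms)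
  let ?h = "compose (carrier (free_module R X)) h p"
  have h: "?h \<in> mod_hom R (free_module R X) N" by (rule mod_hom_compose[OF F p assms(5)])
  have "?h ` carrier (free_module R X) \<subseteq> d ` carrier L"
    using assms(6) mod_homD(1)[OF p] by (auto simp: compose_def)
  then obtain s where s: "s \<in> mod_hom R (free_module R X) L"
    "\<And>x. x \<in> carrier (free_module R X) \<Longrightarrow> d (s x) = ?h x"
    using free_module_lift[OF assms(2,3,4) h] by blast
  have "d (compose (carrier P) s i x) = h x" if "x \<in> carrier P" for x
    using that s(2)[of "i x"] mod_homD(1)[OF i] pi by (simp add: compose_def)
  then show ?thesis using that mod_hom_compose[OF P i s(1)] by blast
qed

section \<open>Restriction of scalars to the ground ring\<close>

definition restrict_scalars ::
    "('k, 'a, 'z) module_scheme \<Rightarrow> ('a, 'm, 'x) module_scheme \<Rightarrow> ('k, 'm) module" where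
  "restrict_scalars A M = mk_module (carrier M) \<zero>\<^bsub>M\<^esub> (\<lambda>x y. x \<oplus>\<^bsub>M\<^esub> y)
     (\<lambda>r x. (r \<odot>\<^bsub>A\<^esub> \<one>\<^bsub>A\<^esub>) \<odot>\<^bsub>M\<^esub> x)"

lemma restrict_scalars_simps [simp]:
  "carrier (restrict_scalars A M) = carrier M" "\<zero>\<^bsub>restrict_scalars A M\<^esub> = \<zero>\<^bsub>M\<^esub>"
  "x \<oplus>\<^bsub>restrict_scalars A M\<^esub> y = x \<oplus>\<^bsub>M\<^esub> y"
  "r \<odot>\<^bsub>restrict_scalars A M\<^esub> x = (r \<odot>\<^bsub>A\<^esub> \<one>\<^bsub>A\<^esub>) \<odot>\<^bsub>M\<^esub> x"
  by (simp_all add: restrict_scalars_def)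

text \<open>The axioms speak of multiples of the unit because \<open>hom_module\<close> and
  \<open>restrict_scalars\<close> let a scalar act through its multiple of the unit.\<close>

locale central_algebra = K: cring K + A: ring A
  for K :: "('k, 'y) ring_scheme" and A :: "('k, 'a, 'z) module_scheme" +
  assumes scalar_closed: "r \<in> carrier K \<Longrightarrow> r \<odot>\<^bsub>A\<^esub> \<one>\<^bsub>A\<^esub> \<in> carrier A"
    and scalar_add: "r \<in> carrier K \<Longrightarrow> s \<in> carrier K \<Longrightarrow>
      (r \<oplus>\<^bsub>K\<^esub> s) \<odot>\<^bsub>A\<^esub> \<one>\<^bsub>A\<^esub> = r \<odot>\<^bsub>A\<^esub> \<one>\<^bsub>A\<^esub> \<oplus>\<^bsub>A\<^esub> s \<odot>\<^bsub>A\<^esub> \<one>\<^bsub>A\<^esub>"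
    and scalar_mult: "r \<in> carrier K \<Longrightarrow> s \<in> carrier K \<Longrightarrow>
      (r \<otimes>\<^bsub>K\<^esub> s) \<odot>\<^bsub>A\<^esub> \<one>\<^bsub>A\<^esub> = (r \<odot>\<^bsub>A\<^esub> \<one>\<^bsub>A\<^esub>) \<otimes>\<^bsub>A\<^esub> (s \<odot>\<^bsub>A\<^esub> \<one>\<^bsub>A\<^esub>)"
    and scalar_one: "\<one>\<^bsub>K\<^esub> \<odot>\<^bsub>A\<^esub> \<one>\<^bsub>A\<^esub> = \<one>\<^bsub>A\<^esub>"
    and scalar_zero: "\<zero>\<^bsub>K\<^esub> \<odot>\<^bsub>A\<^esub> \<one>\<^bsub>A\<^esub> = \<zero>\<^bsub>A\<^esub>"
    and scalar_central: "r \<in> carrier K \<Longrightarrow> a \<in> carrier A \<Longrightarrow>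
      (r \<odot>\<^bsub>A\<^esub> \<one>\<^bsub>A\<^esub>) \<otimes>\<^bsub>A\<^esub> a = a \<otimes>\<^bsub>A\<^esub> (r \<odot>\<^bsub>A\<^esub> \<one>\<^bsub>A\<^esub>)"
begin

abbreviation "scal r \<equiv> r \<odot>\<^bsub>A\<^esub> \<one>\<^bsub>A\<^esub>"

lemma restrict_scalars_left_module:
  assumes "left_module A M"
  shows "left_module K (restrict_scalars A M)"
proof -
  interpret M: left_module A M by fact
  show ?thesis
    by (rule left_moduleI)
       (simp_all add: K.ring_axioms M.smult_closed scalar_closed scalar_add scalar_mult scalar_one
          scalar_zero M.smult_l_distr M.smult_r_distr M.smult_assoc M.smult_one M.smult_zero_l M.M.add.m_ac)
qed

lemma restrict_scalars_hom:
  "h \<in> mod_hom A M N \<Longrightarrow> h \<in> mod_hom K (restrict_scalars A M) (restrict_scalars A N)"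
  by (auto simp: mod_hom_def scalar_closed)

lemma hom_module_left_module:
  assumes "left_module A M" "left_module A N"
  shows "left_module K (hom_module A M N)"
proof -
  interpret M: left_module A M by fact
  interpret N: left_module A N by fact
  interpret N': left_module K "restrict_scalars A N" by (rule restrict_scalars_left_module) fact
  have ext: "(\<lambda>x\<in>carrier M. f x) = f" if "f \<in> mod_hom A M N" for f
    using mod_homD(4)[OF that] by (auto simp: fun_eq_iff)
  note sc = N.smult_closed[OF scalar_closed]
  \<comment> \<open>Centrality makes a scalar multiple of an \<open>A\<close>-linear map
    \<open>A\<close>-linear again.\<close>
  have comm: "scal r \<odot>\<^bsub>N\<^esub> (a \<odot>\<^bsub>N\<^esub> x) = a \<odot>\<^bsub>N\<^esub> (scal r \<odot>\<^bsub>N\<^esub> x)"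
    if "r \<in> carrier K" "a \<in> carrier A" "x \<in> carrier N" for r a x
    using that scalar_central[of r a] by (simp add: N.smult_assoc[symmetric] scalar_closed)
  show ?thesis
  proof (rule left_moduleI[OF K.ring_axioms]; unfold hom_module_def mk_module_simps)
    show "(\<lambda>x\<in>carrier M. \<zero>\<^bsub>N\<^esub>) \<in> mod_hom A M N"
      by (rule mod_homI) (simp_all add: N.smult_zero_r M.smult_closed)
    fix f assume f: "f \<in> mod_hom A M N"
    show "(\<lambda>x\<in>carrier M. scal r \<odot>\<^bsub>N\<^esub> f x) \<in> mod_hom A M N" if r: "r \<in> carrier K" for r
      by (rule mod_homI) (simp_all add: mod_homD[OF f] r sc scalar_closed N.smult_r_distr comm M.smult_closed)
    show "(\<lambda>x\<in>carrier M. (\<lambda>x\<in>carrier M. \<zero>\<^bsub>N\<^esub>) x \<oplus>\<^bsub>N\<^esub> f x) = f"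
      using ext[OF f] by (simp add: mod_homD[OF f] cong: restrict_cong)
    show "(\<lambda>x\<in>carrier M. scal \<one>\<^bsub>K\<^esub> \<odot>\<^bsub>N\<^esub> f x) = f"
      using ext[OF f] by (simp add: mod_homD[OF f] scalar_one N.smult_one cong: restrict_cong)
    show "(\<lambda>x\<in>carrier M. scal \<zero>\<^bsub>K\<^esub> \<odot>\<^bsub>N\<^esub> f x) = (\<lambda>x\<in>carrier M. \<zero>\<^bsub>N\<^esub>)"
      by (simp add: mod_homD[OF f] scalar_zero N.smult_zero_l cong: restrict_cong)
    fix r s assume r: "r \<in> carrier K" and s: "s \<in> carrier K"
    show "(\<lambda>x\<in>carrier M. scal (r \<oplus>\<^bsub>K\<^esub> s) \<odot>\<^bsub>N\<^esub> f x) = (\<lambda>x\<in>carrier M.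
         (\<lambda>x\<in>carrier M. scal r \<odot>\<^bsub>N\<^esub> f x) x \<oplus>\<^bsub>N\<^esub> (\<lambda>x\<in>carrier M. scal s \<odot>\<^bsub>N\<^esub> f x) x)"
      by (simp add: mod_homD[OF f] r s scalar_add N.smult_l_distr scalar_closed cong: restrict_cong)
    show "(\<lambda>x\<in>carrier M. scal (r \<otimes>\<^bsub>K\<^esub> s) \<odot>\<^bsub>N\<^esub> f x) = (\<lambda>x\<in>carrier M.
         scal r \<odot>\<^bsub>N\<^esub> (\<lambda>x\<in>carrier M. scal s \<odot>\<^bsub>N\<^esub> f x) x)"
      by (simp add: mod_homD[OF f] r s scalar_mult N.smult_assoc scalar_closed cong: restrict_cong)
  next
    fix f g assume f: "f \<in> mod_hom A M N" and g: "g \<in> mod_hom A M N"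
    show "(\<lambda>x\<in>carrier M. f x \<oplus>\<^bsub>N\<^esub> g x) \<in> mod_hom A M N"
      by (rule mod_homI) (simp_all add: mod_homD[OF f] mod_homD[OF g] N.a_ac N.smult_r_distr M.smult_closed)
    show "(\<lambda>x\<in>carrier M. f x \<oplus>\<^bsub>N\<^esub> g x) = (\<lambda>x\<in>carrier M. g x \<oplus>\<^bsub>N\<^esub> f x)"
      by (simp add: mod_homD[OF f] mod_homD[OF g] N.a_comm cong: restrict_cong)
    show "(\<lambda>x\<in>carrier M. scal r \<odot>\<^bsub>N\<^esub> (\<lambda>x\<in>carrier M. f x \<oplus>\<^bsub>N\<^esub> g x) x) = (\<lambda>x\<in>carrier M.
         (\<lambda>x\<in>carrier M. scal r \<odot>\<^bsub>N\<^esub> f x) x \<oplus>\<^bsub>N\<^esub> (\<lambda>x\<in>carrier M. scal r \<odot>\<^bsub>N\<^esub> g x) x)"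
      if "r \<in> carrier K" for r
      by (simp add: mod_homD[OF f] mod_homD[OF g] that scalar_closed N.smult_r_distr cong: restrict_cong)
    fix h assume h: "h \<in> mod_hom A M N"
    show "(\<lambda>x\<in>carrier M. (\<lambda>x\<in>carrier M. f x \<oplus>\<^bsub>N\<^esub> g x) x \<oplus>\<^bsub>N\<^esub> h x) =
      (\<lambda>x\<in>carrier M. f x \<oplus>\<^bsub>N\<^esub> (\<lambda>x\<in>carrier M. g x \<oplus>\<^bsub>N\<^esub> h x) x)"
      by (simp add: mod_homD[OF f] mod_homD[OF g] mod_homD[OF h] N.a_assoc cong: restrict_cong)
  qed
qed

end

section \<open>Modules over a monoid algebra\<close>

context
  fixes K :: "('k, 'z) ring_scheme" and B :: "('b, 'y) monoid_scheme"
  assumes K: "cring K" and B: "monoid B"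
begin

interpretation K: cring K by (rule K)
interpretation B: monoid B by (rule B)

abbreviation "kB \<equiv> monoid_algebra K B"

lemma monoid_algebra_smult_closed:
  assumes "r \<in> carrier K" "f \<in> carrier kB"
  shows "r \<odot>\<^bsub>kB\<^esub> f \<in> carrier kB"
  using assms alg_val[OF K B assms(2)] alg_nonzeros[OF K B assms(2)]
  by (intro alg_memI[OF K B, of _ "{x. f x \<noteq> \<zero>\<^bsub>K\<^esub>}"]) (auto simp: monoid_algebra_def)

lemma pairing_monoid_algebra_smult:
  assumes r: "r \<in> carrier K" and f: "f \<in> carrier kB" and c: "\<And>b. c b \<in> carrier K"
  shows "pairing K (r \<odot>\<^bsub>kB\<^esub> f) c = r \<otimes>\<^bsub>K\<^esub> pairing K f c"
proof -
  note v = alg_val[OF K B f]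
  have "pairing K (r \<odot>\<^bsub>kB\<^esub> f) c = (\<Oplus>\<^bsub>K\<^esub>b\<in>{x. f x \<noteq> \<zero>\<^bsub>K\<^esub>}. (r \<odot>\<^bsub>kB\<^esub> f) b \<otimes>\<^bsub>K\<^esub> c b)"
    using alg_nonzeros[OF K B f] r c
    by (intro pairing_superset[OF K B monoid_algebra_smult_closed[OF r f]]) (auto simp: monoid_algebra_def)
  also have "\<dots> = (\<Oplus>\<^bsub>K\<^esub>b\<in>{x. f x \<noteq> \<zero>\<^bsub>K\<^esub>}. r \<otimes>\<^bsub>K\<^esub> (f b \<otimes>\<^bsub>K\<^esub> c b))"
    using r c v by (intro K.finsum_cong') (auto simp: monoid_algebra_def K.m_assoc)
  also have "\<dots> = r \<otimes>\<^bsub>K\<^esub> pairing K f c"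
    using r c v alg_nonzeros[OF K B f] unfolding pairing_def[OF K B]
    by (subst K.finsum_rdistr) auto
  finally show ?thesis .
qed

text \<open>Algebra elements are compared through their pairings with all functions
  \<open>c\<close>. Pairing turns the convolution into an iterated sum, in which the unit
  contributes a single term.\<close>

lemma monoid_algebra_scalar_mult:
  assumes r: "r \<in> carrier K" and f: "f \<in> carrier kB"
  shows "(r \<odot>\<^bsub>kB\<^esub> \<one>\<^bsub>kB\<^esub>) \<otimes>\<^bsub>kB\<^esub> f = r \<odot>\<^bsub>kB\<^esub> f" "f \<otimes>\<^bsub>kB\<^esub> (r \<odot>\<^bsub>kB\<^esub> \<one>\<^bsub>kB\<^esub>) = r \<odot>\<^bsub>kB\<^esub> f"
proof -
  note o = alg_one_closed[OF K B]
  note s = monoid_algebra_smult_closed[OF r o] and rf = monoid_algebra_smult_closed[OF r f]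
  show "(r \<odot>\<^bsub>kB\<^esub> \<one>\<^bsub>kB\<^esub>) \<otimes>\<^bsub>kB\<^esub> f = r \<odot>\<^bsub>kB\<^esub> f"
  proof (rule alg_eqI[OF K B alg_mult(5)[OF K B s f] rf])
    fix c :: "'b \<Rightarrow> 'k" assume c: "\<And>b. c b \<in> carrier K"
    have p: "pairing K f (\<lambda>z. c (y \<otimes>\<^bsub>B\<^esub> z)) \<in> carrier K" for y by (rule pairing_closed[OF K B f c])
    have "pairing K (r \<odot>\<^bsub>kB\<^esub> \<one>\<^bsub>kB\<^esub> \<otimes>\<^bsub>kB\<^esub> f) c = r \<otimes>\<^bsub>K\<^esub> pairing K f (\<lambda>z. c (\<one>\<^bsub>B\<^esub> \<otimes>\<^bsub>B\<^esub> z))"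
      unfolding pairing_mult[OF K B s f c] pairing_monoid_algebra_smult[OF r o p] pairing_one[OF K B p] ..
    also have "pairing K f (\<lambda>z. c (\<one>\<^bsub>B\<^esub> \<otimes>\<^bsub>B\<^esub> z)) = pairing K f c"
      by (rule pairing_cong[OF K B f]) (auto simp: c)
    finally show "pairing K (r \<odot>\<^bsub>kB\<^esub> \<one>\<^bsub>kB\<^esub> \<otimes>\<^bsub>kB\<^esub> f) c = pairing K (r \<odot>\<^bsub>kB\<^esub> f) c"
      unfolding pairing_monoid_algebra_smult[OF r f c] .
  qed
  show "f \<otimes>\<^bsub>kB\<^esub> (r \<odot>\<^bsub>kB\<^esub> \<one>\<^bsub>kB\<^esub>) = r \<odot>\<^bsub>kB\<^esub> f"
  proof (rule alg_eqI[OF K B alg_mult(5)[OF K B f s] rf])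
    fix c :: "'b \<Rightarrow> 'k" assume c: "\<And>b. c b \<in> carrier K"
    have "pairing K (f \<otimes>\<^bsub>kB\<^esub> (r \<odot>\<^bsub>kB\<^esub> \<one>\<^bsub>kB\<^esub>)) c = pairing K f (\<lambda>y. c (y \<otimes>\<^bsub>B\<^esub> \<one>\<^bsub>B\<^esub>) \<otimes>\<^bsub>K\<^esub> r)"
      unfolding pairing_mult[OF K B f s c] pairing_monoid_algebra_smult[OF r o c]
        pairing_one[OF K B, of "\<lambda>z. c (_ \<otimes>\<^bsub>B\<^esub> z)", OF c] K.m_comm[OF r c] ..
    also have "\<dots> = pairing K f (\<lambda>y. c y \<otimes>\<^bsub>K\<^esub> r)"
      by (rule pairing_cong[OF K B f]) (auto simp: c r)
    also have "\<dots> = r \<otimes>\<^bsub>K\<^esub> pairing K f c"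
      by (subst pairing_smult_right[OF K B f c r]) (rule K.m_comm[OF pairing_closed[OF K B f c] r])
    finally show "pairing K (f \<otimes>\<^bsub>kB\<^esub> (r \<odot>\<^bsub>kB\<^esub> \<one>\<^bsub>kB\<^esub>)) c = pairing K (r \<odot>\<^bsub>kB\<^esub> f) c"
      unfolding pairing_monoid_algebra_smult[OF r f c] .
  qed
qed

lemma monoid_algebra_central: "central_algebra K kB"
proof (intro central_algebra.intro central_algebra_axioms.intro)
  note o = alg_one_closed[OF K B]
  show "cring K" by (rule K)
  show "ring kB" by (rule monoid_algebra_ring[OF K B])
  show "\<one>\<^bsub>K\<^esub> \<odot>\<^bsub>kB\<^esub> \<one>\<^bsub>kB\<^esub> = \<one>\<^bsub>kB\<^esub>" "\<zero>\<^bsub>K\<^esub> \<odot>\<^bsub>kB\<^esub> \<one>\<^bsub>kB\<^esub> = \<zero>\<^bsub>kB\<^esub>"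
    by (auto simp: monoid_algebra_def)
  fix r assume r: "r \<in> carrier K"
  show "r \<odot>\<^bsub>kB\<^esub> \<one>\<^bsub>kB\<^esub> \<in> carrier kB" by (rule monoid_algebra_smult_closed[OF r o])
  show "(r \<odot>\<^bsub>kB\<^esub> \<one>\<^bsub>kB\<^esub>) \<otimes>\<^bsub>kB\<^esub> a = a \<otimes>\<^bsub>kB\<^esub> (r \<odot>\<^bsub>kB\<^esub> \<one>\<^bsub>kB\<^esub>)" if "a \<in> carrier kB" for a
    using monoid_algebra_scalar_mult[OF r that] by simp
  fix s assume s: "s \<in> carrier K"
  show "(r \<oplus>\<^bsub>K\<^esub> s) \<odot>\<^bsub>kB\<^esub> \<one>\<^bsub>kB\<^esub> = r \<odot>\<^bsub>kB\<^esub> \<one>\<^bsub>kB\<^esub> \<oplus>\<^bsub>kB\<^esub> s \<odot>\<^bsub>kB\<^esub> \<one>\<^bsub>kB\<^esub>"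
    using r s by (auto simp: monoid_algebra_def K.l_distr)
  show "(r \<otimes>\<^bsub>K\<^esub> s) \<odot>\<^bsub>kB\<^esub> \<one>\<^bsub>kB\<^esub> = (r \<odot>\<^bsub>kB\<^esub> \<one>\<^bsub>kB\<^esub>) \<otimes>\<^bsub>kB\<^esub> (s \<odot>\<^bsub>kB\<^esub> \<one>\<^bsub>kB\<^esub>)"
    unfolding monoid_algebra_scalar_mult(1)[OF r monoid_algebra_smult_closed[OF s o]]
    using r s by (auto simp: monoid_algebra_def K.m_assoc)
qed

text \<open>The generators of the free module on \<open>carrier B\<close> double as the monoid
  elements inside the algebra.\<close>

lemma free_gen_monoid_algebra: "b \<in> carrier B \<Longrightarrow> free_gen K b \<in> carrier kB"
  by (rule alg_memI[OF K B, of _ "{b}"]) (auto simp: free_gen_def)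

lemma pairing_free_gen:
  assumes b: "b \<in> carrier B" and c: "\<And>b. c b \<in> carrier K"
  shows "pairing K (free_gen K b) c = c b"
proof -
  have "pairing K (free_gen K b) c = (\<Oplus>\<^bsub>K\<^esub>x\<in>{b}. free_gen K b x \<otimes>\<^bsub>K\<^esub> c x)"
    by (rule pairing_superset[OF K B free_gen_monoid_algebra[OF b]]) (auto simp: free_gen_def c)
  also have "\<dots> = c b" using c by (subst K.finsum_insert) (auto simp: free_gen_def)
  finally show ?thesis .
qed

text \<open>For fixed \<open>x\<close>, both sides of the linearity equation are
  \<open>K\<close>-linear in the algebra element, and the algebra is free over \<open>K\<close> on
  the monoid. Agreement on monoid elements therefore suffices.\<close>

lemma monoid_algebra_homI:
  assumes M: "left_module kB M" and N: "left_module kB N"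
    and h: "h \<in> mod_hom K (restrict_scalars kB M) (restrict_scalars kB N)"
    and eq: "\<And>b x. b \<in> carrier B \<Longrightarrow> x \<in> carrier M \<Longrightarrow> h (free_gen K b \<odot>\<^bsub>M\<^esub> x) = free_gen K b \<odot>\<^bsub>N\<^esub> h x"
  shows "h \<in> mod_hom kB M N"
proof (rule mod_homI)
  interpret M: left_module kB M by fact
  interpret N: left_module kB N by fact
  interpret A: central_algebra K kB by (rule monoid_algebra_central)
  note hD = mod_homD(1-3)[OF h, simplified]
  show "h x = undefined" if "x \<notin> carrier M" for x using mod_homD(4)[OF h] that by simp
  show "h x \<in> carrier N" if "x \<in> carrier M" for x using hD that by simp
  show "h (x \<oplus>\<^bsub>M\<^esub> y) = h x \<oplus>\<^bsub>N\<^esub> h y" if "x \<in> carrier M" "y \<in> carrier M" for x y using hD that by simp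
  fix a x assume a: "a \<in> carrier kB" and x: "x \<in> carrier M"
  let ?F = "free_module K (carrier B)"
  have F: "carrier ?F = carrier kB" "\<And>f g. f \<oplus>\<^bsub>?F\<^esub> g = f \<oplus>\<^bsub>kB\<^esub> g"
    by (simp_all add: free_module_def monoid_algebra_def)
  have Fs: "r \<odot>\<^bsub>?F\<^esub> f = (r \<odot>\<^bsub>kB\<^esub> \<one>\<^bsub>kB\<^esub>) \<otimes>\<^bsub>kB\<^esub> f" if "r \<in> carrier K" "f \<in> carrier kB" for r f
    unfolding monoid_algebra_scalar_mult(1)[OF that] by (simp add: free_module_def monoid_algebra_def)
  let ?p = "\<lambda>f\<in>carrier kB. h (f \<odot>\<^bsub>M\<^esub> x)" and ?q = "\<lambda>f\<in>carrier kB. f \<odot>\<^bsub>N\<^esub> h x"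
  have clo: "(r \<odot>\<^bsub>kB\<^esub> \<one>\<^bsub>kB\<^esub>) \<otimes>\<^bsub>kB\<^esub> f \<in> carrier kB" if "r \<in> carrier K" "f \<in> carrier kB" for r f
    using that A.scalar_closed by simp
  have p: "?p \<in> mod_hom K ?F (restrict_scalars kB N)"
    by (rule mod_homI) (simp_all add: F Fs x hD M.smult_closed M.smult_l_distr M.smult_assoc A.scalar_closed)
  have q: "?q \<in> mod_hom K ?F (restrict_scalars kB N)"
    by (rule mod_homI) (simp_all add: F Fs x hD N.smult_closed N.smult_l_distr N.smult_assoc A.scalar_closed)
  have "?p = ?q"
    by (rule free_module_hom_eqI[OF A.restrict_scalars_left_module[OF N] p q])
       (simp add: free_gen_monoid_algebra eq x)
  from fun_cong[OF this, of a] show "h (a \<odot>\<^bsub>M\<^esub> x) = a \<odot>\<^bsub>N\<^esub> h x" using a by simp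
qed

text \<open>A free module over the algebra with basis \<open>X\<close> is free over the ground ring with basis
  \<open>X \<times> carrier B\<close>; hence projective modules over the algebra are projective over the ground ring.\<close>

lemma projective_lift_scalars:
  fixes P :: "('b \<Rightarrow> 'k, 'p, 'x) module_scheme"
  assumes P: "projective_module kB P" and L: "left_module kB L" and N: "left_module kB N"
    and d: "d \<in> mod_hom K (restrict_scalars kB L) (restrict_scalars kB N)"
    and h: "h \<in> mod_hom K (restrict_scalars kB P) (restrict_scalars kB N)"
    and im: "h ` carrier P \<subseteq> d ` carrier L"
  obtains s where "s \<in> mod_hom K (restrict_scalars kB P) (restrict_scalars kB L)"
    "\<And>x. x \<in> carrier P \<Longrightarrow> d (s x) = h x"
proof -
  interpret A: central_algebra K kB by (rule monoid_algebra_central)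
  obtain X :: "'p set" and i p where i: "i \<in> mod_hom kB P (free_module kB X)"
    and p: "p \<in> mod_hom kB (free_module kB X) P" and pi: "\<And>x. x \<in> carrier P \<Longrightarrow> p (i x) = x"
    using P unfolding projective_module_def by blast
  let ?X = "X \<times> carrier B"
  let ?F = "free_module K ?X" and ?G = "free_module kB X"
  have Pm: "left_module kB P" using P by (simp add: projective_module_def)
  interpret Pm: left_module kB P by (rule Pm)
  have F: "left_module K ?F" by (rule free_module_left_module) (rule K.ring_axioms)
  interpret F: left_module K ?F by (rule F)
  have G: "left_module kB ?G" by (rule free_module_left_module) (rule A.A.ring_axioms)
  have carF: "carrier ?F = fin_supp K ?X" "carrier ?G = fin_supp kB X"
    by (simp_all add: free_module_def)
  have zero: "\<zero>\<^bsub>kB\<^esub> = (\<lambda>b. \<zero>\<^bsub>K\<^esub>)" by (simp add: monoid_algebra_def)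
  have smF: "r \<odot>\<^bsub>?F\<^esub> f = (\<lambda>z. r \<otimes>\<^bsub>K\<^esub> f z)" for r f by (simp add: free_module_def)
  have smG: "((r \<odot>\<^bsub>kB\<^esub> \<one>\<^bsub>kB\<^esub>) \<odot>\<^bsub>?G\<^esub> g) x = (\<lambda>b. r \<otimes>\<^bsub>K\<^esub> g x b)" if "r \<in> carrier K" "g \<in> carrier ?G" for r g x
  proof -
    have "g x \<in> carrier kB" using that(2) by (cases "x \<in> X") (auto simp: carF fin_supp_def)
    from monoid_algebra_scalar_mult(1)[OF that(1) this] show ?thesis
      by (simp add: free_module_def) (simp add: monoid_algebra_def)
  qed
  \<comment> \<open>Currying and uncurrying between functions on \<open>X \<times> carrier B\<close>
    and algebra-valued functions on \<open>X\<close>; the argument rests on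
    \<open>c (u g) = g\<close>.\<close>
  define c where "c = (\<lambda>f\<in>carrier ?F. \<lambda>x b. f (x, b) :: 'k)"
  define u where "u = (\<lambda>g\<in>carrier ?G. \<lambda>(x, b). g x b :: 'k)"
  have cG: "(\<lambda>x b. f (x, b)) \<in> carrier ?G" if "f \<in> carrier ?F" for f
  proof -
    have f: "\<And>z. f z \<in> carrier K" "\<And>z. z \<notin> ?X \<Longrightarrow> f z = \<zero>\<^bsub>K\<^esub>" "finite {z. f z \<noteq> \<zero>\<^bsub>K\<^esub>}"
      using that by (auto simp: carF fin_supp_def Pi_def) (metis K.zero_closed SigmaI)
    have "(\<lambda>b. f (x, b)) \<in> carrier kB" for x
    proof (rule alg_memI[OF K B])
      show "finite (snd ` {z. f z \<noteq> \<zero>\<^bsub>K\<^esub>})" using f(3) by simp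
    qed (use f in \<open>force+\<close>)
    moreover have "finite {x. (\<lambda>b. f (x, b)) \<noteq> (\<lambda>b. \<zero>\<^bsub>K\<^esub>)}"
      by (rule finite_subset[OF _ finite_imageI[OF f(3), of fst]]) force
    ultimately show ?thesis using f(2) by (auto simp: carF fin_supp_def zero fun_eq_iff)
  qed
  have uF: "(\<lambda>(x, b). g x b) \<in> carrier ?F" if "g \<in> carrier ?G" for g
  proof -
    have g: "\<And>x. x \<in> X \<Longrightarrow> g x \<in> carrier kB" "\<And>x. x \<notin> X \<Longrightarrow> g x = (\<lambda>b. \<zero>\<^bsub>K\<^esub>)" "finite {x. g x \<noteq> (\<lambda>b. \<zero>\<^bsub>K\<^esub>)}"
      using that by (auto simp: carF fin_supp_def zero)
    have gx: "g x \<in> fin_supp K (carrier B)" for x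
      using g(1,2)[of x] by (cases "x \<in> X") (auto simp: alg_carrier[OF K B] fin_supp_def)
    have "finite (Sigma {x. g x \<noteq> (\<lambda>b. \<zero>\<^bsub>K\<^esub>)} (\<lambda>x. {b. g x b \<noteq> \<zero>\<^bsub>K\<^esub>}))"
      using g(3) gx by (intro finite_SigmaI) (auto simp: fin_supp_def)
    then have "finite {z. (case z of (x, b) \<Rightarrow> g x b) \<noteq> \<zero>\<^bsub>K\<^esub>}"
      by (rule finite_subset[rotated]) auto
    then show ?thesis using gx g(2) by (auto simp: carF fin_supp_def)
  qed
  have c: "c \<in> mod_hom K ?F (restrict_scalars kB ?G)"
  proof (rule mod_homI)
    fix f g assume fg: "f \<in> carrier ?F" "g \<in> carrier ?F"
    then have "f \<oplus>\<^bsub>?F\<^esub> g \<in> carrier ?F" by simp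
    then show "c (f \<oplus>\<^bsub>?F\<^esub> g) = c f \<oplus>\<^bsub>restrict_scalars kB ?G\<^esub> c g"
      using fg by (simp add: c_def) (simp add: free_module_def monoid_algebra_def)
  next
    fix r f assume rf: "r \<in> carrier K" "f \<in> carrier ?F"
    then have "r \<odot>\<^bsub>?F\<^esub> f \<in> carrier ?F" by (simp add: F.smult_closed)
    then show "c (r \<odot>\<^bsub>?F\<^esub> f) = r \<odot>\<^bsub>restrict_scalars kB ?G\<^esub> c f"
      using rf smG[OF rf(1) cG[OF rf(2)]] by (auto simp: c_def fun_eq_iff smF)
  qed (simp_all add: c_def cG)
  have u: "u \<in> mod_hom K (restrict_scalars kB ?G) ?F"
  proof (rule mod_homI)
    interpret G: left_module kB ?G by (rule G)
    fix f g assume fg: "f \<in> carrier (restrict_scalars kB ?G)" "g \<in> carrier (restrict_scalars kB ?G)"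
    then have "f \<oplus>\<^bsub>?G\<^esub> g \<in> carrier ?G" by simp
    then show "u (f \<oplus>\<^bsub>restrict_scalars kB ?G\<^esub> g) = u f \<oplus>\<^bsub>?F\<^esub> u g"
      using fg by (simp add: u_def) (simp add: free_module_def monoid_algebra_def fun_eq_iff)
  next
    interpret G: left_module kB ?G by (rule G)
    fix r f assume rf: "r \<in> carrier K" "f \<in> carrier (restrict_scalars kB ?G)"
    then have "(r \<odot>\<^bsub>kB\<^esub> \<one>\<^bsub>kB\<^esub>) \<odot>\<^bsub>?G\<^esub> f \<in> carrier ?G" by (simp add: G.smult_closed A.scalar_closed)
    then show "u (r \<odot>\<^bsub>restrict_scalars kB ?G\<^esub> f) = r \<odot>\<^bsub>?F\<^esub> u f"
      using rf smG[OF rf(1)] by (auto simp: u_def fun_eq_iff smF)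
  qed (simp_all add: u_def uF)
  have cu: "c (u g) = g" if "g \<in> carrier ?G" for g
    using that uF[OF that] by (simp add: c_def u_def)
  note iK = A.restrict_scalars_hom[OF i] and pK = A.restrict_scalars_hom[OF p]
  note LK = A.restrict_scalars_left_module[OF L] and NK = A.restrict_scalars_left_module[OF N]
  note PK = A.restrict_scalars_left_module[OF Pm]
  let ?h = "compose (carrier ?F) h (compose (carrier ?F) p c)"
  have h': "?h \<in> mod_hom K ?F (restrict_scalars kB N)"
    by (rule mod_hom_compose[OF F mod_hom_compose[OF F c pK] h])
  have "?h ` carrier ?F \<subseteq> d ` carrier (restrict_scalars kB L)"
    using im mod_homD(1)[OF c] mod_homD(1)[OF p] by (auto simp: compose_def)
  then obtain s where s: "s \<in> mod_hom K ?F (restrict_scalars kB L)" "\<And>x. x \<in> carrier ?F \<Longrightarrow> d (s x) = ?h x"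
    using free_module_lift[OF LK NK d h'] by blast
  \<comment> \<open>The lift over the free \<open>K\<close>-module is pulled back along
    \<open>u\<close> after \<open>i\<close>. It lifts \<open>h\<close> because
    \<open>p (c (u (i x))) = p (i x) = x\<close>.\<close>
  let ?s = "compose (carrier P) s (compose (carrier P) u i)"
  have "?s \<in> mod_hom K (restrict_scalars kB P) (restrict_scalars kB L)"
    using mod_hom_compose[OF PK mod_hom_compose[OF PK iK u] s(1)] by simp
  moreover have "d (?s x) = h x" if x: "x \<in> carrier P" for x
  proof -
    have ix: "i x \<in> carrier ?G" by (rule mod_homD(1)[OF i x])
    have "u (i x) \<in> carrier ?F" using mod_homD(1)[OF u] ix by simp
    then show ?thesis using s(2)[of "u (i x)"] x pi[OF x] cu[OF ix] by (simp add: compose_def)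
  qed
  ultimately show ?thesis using that by blast
qed

end

section \<open>Dimension shifting\<close>

lemma projective_resolutionD:
  assumes "projective_resolution R P d e M"
  shows "left_module R M" "projective_module R (P n)" "left_module R (P n)"
    "e \<in> mod_hom R (P 0) M" "d n \<in> mod_hom R (P (Suc n)) (P n)" "e ` carrier (P 0) = carrier M"
    "d 0 ` carrier (P (Suc 0)) = {x \<in> carrier (P 0). e x = \<zero>\<^bsub>M\<^esub>}"
    "d (Suc n) ` carrier (P (Suc (Suc n))) = {x \<in> carrier (P (Suc n)). d n x = \<zero>\<^bsub>P n\<^esub>}"
  using assms by (auto simp: projective_resolution_def projective_module_def a_kernel_def')

text \<open>By \<open>d s d = d\<close>, the element \<open>x - s (d x)\<close> always lies in the
  kernel of \<open>d\<close>, which is the image of \<open>d'\<close>. Projectivity of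
  \<open>P\<close> over the ground ring lifts this map through \<open>d'\<close>. On
  \<open>x = d' y\<close> the correction \<open>s (d x)\<close> vanishes, so the lift satisfies the
  same condition for \<open>d'\<close>.\<close>

lemma scalar_splitting_step:
  fixes P :: "('b \<Rightarrow> 'k, 'p) module"
  assumes K: "cring K" and B: "monoid B" and P: "projective_module (kB K B) P"
    and L: "left_module (kB K B) L" and N: "left_module (kB K B) N"
    and d: "d \<in> mod_hom (kB K B) P N" and d': "d' \<in> mod_hom (kB K B) L P"
    and exact: "d' ` carrier L = {x \<in> carrier P. d x = \<zero>\<^bsub>N\<^esub>}"
    and s: "s \<in> mod_hom K (restrict_scalars (kB K B) N) (restrict_scalars (kB K B) P)"
      "\<And>x. x \<in> carrier P \<Longrightarrow> d (s (d x)) = d x"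
  obtains s' where
    "s' \<in> mod_hom K (restrict_scalars (kB K B) P) (restrict_scalars (kB K B) L)"
    "\<And>y. y \<in> carrier L \<Longrightarrow> d' (s' (d' y)) = d' y"
proof -
  interpret A: central_algebra K "kB K B" by (rule monoid_algebra_central[OF K B])
  let ?r = "restrict_scalars (kB K B)"
  have Pm: "left_module (kB K B) P" using P by (simp add: projective_module_def)
  interpret P: left_module "kB K B" P by (rule Pm)
  interpret N: left_module "kB K B" N by (rule N)
  note m = A.restrict_scalars_left_module[OF Pm] A.restrict_scalars_left_module[OF N]
  let ?h = "\<lambda>x\<in>carrier P. x \<ominus>\<^bsub>P\<^esub> s (d x)"
  have "(\<lambda>x\<in>carrier (?r P). (\<lambda>x\<in>carrier (?r P). x) x \<ominus>\<^bsub>?r P\<^esub> compose (carrier (?r P)) s d x)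
      \<in> mod_hom K (?r P) (?r P)"
    by (rule mod_hom_minus[OF m(1) m(1) mod_hom_id[OF m(1)]
          mod_hom_compose[OF m(1) A.restrict_scalars_hom[OF d] s(1)]])
  also have "(\<lambda>x\<in>carrier (?r P). (\<lambda>x\<in>carrier (?r P). x) x \<ominus>\<^bsub>?r P\<^esub> compose (carrier (?r P)) s d x) = ?h"
    by (auto simp: compose_def restrict_def a_minus_def a_inv_def m_inv_def)
  finally have h: "?h \<in> mod_hom K (?r P) (?r P)" .
  have dh: "d (x \<ominus>\<^bsub>P\<^esub> s (d x)) = \<zero>\<^bsub>N\<^esub>" if x: "x \<in> carrier P" for x
  proof -
    have dx: "d x \<in> carrier N" "s (d x) \<in> carrier P"
      using mod_homD(1)[OF d x] mod_homD(1)[OF s(1)] by simp_all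
    have "d (\<ominus>\<^bsub>P\<^esub> s (d x)) = \<ominus>\<^bsub>N\<^esub> d x"
      using dx mod_homD(3)[OF d, of "\<ominus>\<^bsub>kB K B\<^esub> \<one>\<^bsub>kB K B\<^esub>" "s (d x)"] s(2)[OF x]
      by (simp add: P.smult_minus_one N.smult_minus_one)
    then show ?thesis using x dx mod_homD(2)[OF d] by (simp add: a_minus_def N.r_neg)
  qed
  have "?h ` carrier P \<subseteq> d' ` carrier L"
    unfolding exact using dh mod_homD(1)[OF h] by auto
  then obtain s' where s': "s' \<in> mod_hom K (?r P) (?r L)" "\<And>x. x \<in> carrier P \<Longrightarrow> d' (s' x) = ?h x"
    using projective_lift_scalars[OF K B P L Pm A.restrict_scalars_hom[OF d'] h] by blast
  have "d' (s' (d' y)) = d' y" if y: "y \<in> carrier L" for y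
  proof -
    have dy: "d' y \<in> carrier P" "d (d' y) = \<zero>\<^bsub>N\<^esub>" using exact y by blast+
    have "s \<zero>\<^bsub>N\<^esub> = \<zero>\<^bsub>P\<^esub>" using mod_hom_zero[OF m(2,1) s(1)] by simp
    then show ?thesis using s'(2)[OF dy(1)] dy by (simp add: a_minus_def)
  qed
  with s'(1) that show ?thesis by blast
qed

text \<open>The equation makes \<open>d n\<close> after \<open>s\<close> an idempotent whose range
  is the image of \<open>d n\<close>; so this image is a direct summand over the ground ring, with
  no complement to be named. The section \<sigma> of the augmentation starts the induction.\<close>

lemma resolution_scalar_splitting:
  assumes K: "cring K" and B: "monoid B"
    and res: "projective_resolution (kB K B) P d e M"
    and \<sigma>: "\<sigma> \<in> mod_hom K (restrict_scalars (kB K B) M) (restrict_scalars (kB K B) (P 0))"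
      "\<And>t. t \<in> carrier M \<Longrightarrow> e (\<sigma> t) = t"
  shows "\<exists>s \<in> mod_hom K (restrict_scalars (kB K B) (P n)) (restrict_scalars (kB K B) (P (Suc n))).
    \<forall>y\<in>carrier (P (Suc n)). d n (s (d n y)) = d n y"
proof (induction n)
  note r = projective_resolutionD[OF res]
  {
    case 0
    show ?case
      by (rule scalar_splitting_step[OF K B r(2) r(3) r(1) r(4) r(5) r(7) \<sigma>(1)])
         (use \<sigma>(2) mod_homD(1)[OF r(4)] in blast)+
  next
    case (Suc n)
    then obtain s where s: "s \<in> mod_hom K (restrict_scalars (kB K B) (P n))
        (restrict_scalars (kB K B) (P (Suc n)))"
      "\<And>y. y \<in> carrier (P (Suc n)) \<Longrightarrow> d n (s (d n y)) = d n y" by blast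
    show ?case
      by (rule scalar_splitting_step[OF K B r(2) r(3) r(3) r(5) r(5) r(8) s]) blast+
  }
qed

lemma hom_module_simps:
  "carrier (hom_module A M N) = mod_hom A M N"
  "\<zero>\<^bsub>hom_module A M N\<^esub> = (\<lambda>x\<in>carrier M. \<zero>\<^bsub>N\<^esub>)"
  "f \<oplus>\<^bsub>hom_module A M N\<^esub> g = (\<lambda>x\<in>carrier M. f x \<oplus>\<^bsub>N\<^esub> g x)"
  "r \<odot>\<^bsub>hom_module A M N\<^esub> f = (\<lambda>x\<in>carrier M. (r \<odot>\<^bsub>A\<^esub> \<one>\<^bsub>A\<^esub>) \<odot>\<^bsub>N\<^esub> f x)"
  by (simp_all add: hom_module_def)

section \<open>Cocycles and coboundaries in Hom complexes; the connecting isomorphism\<close>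

context central_algebra begin

lemma submodule_hom_vanishing:
  assumes M: "left_module A M" and N: "left_module A N" and Y: "Y \<subseteq> carrier M"
  shows "submodule_of K (hom_module A M N) {f \<in> mod_hom A M N. \<forall>y\<in>Y. f y = \<zero>\<^bsub>N\<^esub>}"
proof -
  interpret N: left_module A N by fact
  interpret H: left_module K "hom_module A M N" by (rule hom_module_left_module) fact+
  have "y \<in> carrier M" if "y \<in> Y" for y using Y that by blast
  then show ?thesis
    using H.M.zero_closed H.M.a_closed H.smult_closed
    by (auto simp: submodule_of_def hom_module_simps N.smult_zero_r scalar_closed)
qed

lemma submodule_hom_compose:
  assumes M: "left_module A M" and L: "left_module A L" and N: "left_module A N"
    and \<pi>: "\<pi> \<in> mod_hom A N L" and S: "submodule_of K (hom_module A M N) S"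
  shows "submodule_of K (hom_module A M L) ((\<lambda>f. compose (carrier M) \<pi> f) ` S)"
proof -
  interpret N: left_module A N by fact
  note s = submodule_ofD[OF S, unfolded hom_module_simps]
  note p = mod_homD(1-3)[OF \<pi>]
  show ?thesis unfolding submodule_of_def hom_module_simps
  proof (intro conjI ballI)
    show "(\<lambda>f. compose (carrier M) \<pi> f) ` S \<subseteq> mod_hom A M L"
      using mod_hom_compose[OF M s(1) \<pi>] by blast
    show "(\<lambda>x\<in>carrier M. \<zero>\<^bsub>L\<^esub>) \<in> (\<lambda>f. compose (carrier M) \<pi> f) ` S"
      by (rule image_eqI[OF _ s(2)]) (auto simp: compose_def mod_hom_zero[OF N L \<pi>])
    fix x assume "x \<in> (\<lambda>f. compose (carrier M) \<pi> f) ` S"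
    then obtain f where f: "f \<in> S" "x = compose (carrier M) \<pi> f" by blast
    note fD = mod_homD(1)[OF s(1)[OF f(1)]]
    show "(\<lambda>y\<in>carrier M. scal r \<odot>\<^bsub>L\<^esub> x y) \<in> (\<lambda>f. compose (carrier M) \<pi> f) ` S" if "r \<in> carrier K" for r
      by (rule image_eqI[OF _ s(4)[OF that f(1)]]) (auto simp: f compose_def p fD scalar_closed that)
    fix y assume "y \<in> (\<lambda>f. compose (carrier M) \<pi> f) ` S"
    then obtain g where g: "g \<in> S" "y = compose (carrier M) \<pi> g" by blast
    note gD = mod_homD(1)[OF s(1)[OF g(1)]]
    show "(\<lambda>z\<in>carrier M. x z \<oplus>\<^bsub>L\<^esub> y z) \<in> (\<lambda>f. compose (carrier M) \<pi> f) ` S"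
      by (rule image_eqI[OF _ s(3)[OF f(1) g(1)]]) (auto simp: f g compose_def p fD gD)
  qed
qed

lemma submodule_hom_precompose:
  fixes L :: "('a, 'l) module" and N :: "('a, 'n) module"
  assumes M: "left_module A M" and L: "left_module A L" and N: "left_module A N" and b: "b \<in> mod_hom A M L"
  shows "submodule_of K (hom_module A M N) ((\<lambda>f. compose (carrier M) f b) ` mod_hom A L N)"
proof -
  interpret H: left_module K "hom_module A L N" by (rule hom_module_left_module) fact+
  note z = H.M.zero_closed[unfolded hom_module_simps] and a = H.M.a_closed[unfolded hom_module_simps]
    and sm = H.smult_closed[unfolded hom_module_simps]
  note bD = mod_homD(1)[OF b]
  show ?thesis unfolding submodule_of_def hom_module_simps
  proof (intro conjI ballI)
    show "(\<lambda>f. compose (carrier M) f b) ` mod_hom A L N \<subseteq> mod_hom A M N"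
      using mod_hom_compose[OF M b] by blast
    show "(\<lambda>x\<in>carrier M. \<zero>\<^bsub>N\<^esub>) \<in> (\<lambda>f. compose (carrier M) f b) ` mod_hom A L N"
      by (rule image_eqI[OF _ z]) (auto simp: compose_def bD)
    fix x assume "x \<in> (\<lambda>f. compose (carrier M) f b) ` mod_hom A L N"
    then obtain f where f: "f \<in> mod_hom A L N" "x = compose (carrier M) f b" by blast
    show "(\<lambda>y\<in>carrier M. scal r \<odot>\<^bsub>N\<^esub> x y) \<in> (\<lambda>f. compose (carrier M) f b) ` mod_hom A L N"
      if "r \<in> carrier K" for r
      by (rule image_eqI[OF _ sm[OF that f(1)]]) (auto simp: f compose_def bD)
    fix y assume "y \<in> (\<lambda>f. compose (carrier M) f b) ` mod_hom A L N"
    then obtain g where g: "g \<in> mod_hom A L N" "y = compose (carrier M) g b" by blast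
    show "(\<lambda>z\<in>carrier M. x z \<oplus>\<^bsub>N\<^esub> y z) \<in> (\<lambda>f. compose (carrier M) f b) ` mod_hom A L N"
      by (rule image_eqI[OF _ a[OF f(1) g(1)]]) (auto simp: f g compose_def bD)
  qed
qed

lemma submodule_shift_boundaries:
  fixes X1 :: "('a, 'p) module" and I :: "('a, 'i) module" and N' :: "('a, 'j) module"
  assumes X1: "left_module A X1" and b: "b ` Y \<subseteq> carrier X1"
    and I: "left_module A I" and N': "left_module A N'" and \<pi>: "\<pi> \<in> mod_hom A I N'"
  shows "submodule_of K
    ((hom_module A X1 N')\<lparr>carrier := {g \<in> mod_hom A X1 N'. \<forall>x\<in>Y. g (b x) = \<zero>\<^bsub>N'\<^esub>}\<rparr>)
    ((\<lambda>h. compose (carrier X1) \<pi> h) ` {h \<in> mod_hom A X1 I. \<forall>x\<in>Y. h (b x) = \<zero>\<^bsub>I\<^esub>})"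
proof (rule submodule_of_restrict)
  have "submodule_of K (hom_module A X1 I) {h \<in> mod_hom A X1 I. \<forall>x\<in>Y. h (b x) = \<zero>\<^bsub>I\<^esub>}"
    using submodule_hom_vanishing[OF X1 I b] by simp
  then show "submodule_of K (hom_module A X1 N')
      ((\<lambda>h. compose (carrier X1) \<pi> h) ` {h \<in> mod_hom A X1 I. \<forall>x\<in>Y. h (b x) = \<zero>\<^bsub>I\<^esub>})"
    by (rule submodule_hom_compose[OF X1 N' I \<pi>])
  show "(\<lambda>h. compose (carrier X1) \<pi> h) ` {h \<in> mod_hom A X1 I. \<forall>x\<in>Y. h (b x) = \<zero>\<^bsub>I\<^esub>}
      \<subseteq> {g \<in> mod_hom A X1 N'. \<forall>x\<in>Y. g (b x) = \<zero>\<^bsub>N'\<^esub>}"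
    using mod_hom_compose[OF X1 _ \<pi>] b mod_hom_zero[OF I N' \<pi>] by (auto simp: compose_def)
qed

lemma submodule_boundaries:
  fixes X1 :: "('a, 'p) module" and N :: "('a, 'n) module"
  assumes X: "left_module A X1" "left_module A X2" and b: "b \<in> mod_hom A X2 X1"
    and c: "\<And>x. x \<in> Y \<Longrightarrow> c x \<in> carrier X2" "\<And>x. x \<in> Y \<Longrightarrow> b (c x) = \<zero>\<^bsub>X1\<^esub>" and N: "left_module A N"
  shows "submodule_of K ((hom_module A X2 N)\<lparr>carrier := {f \<in> mod_hom A X2 N. \<forall>x\<in>Y. f (c x) = \<zero>\<^bsub>N\<^esub>}\<rparr>)
    ((\<lambda>f. compose (carrier X2) f b) ` mod_hom A X1 N)"
proof (rule submodule_of_restrict[OF submodule_hom_precompose[OF X(2,1) N b]], rule image_subsetI)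
  fix f assume f: "f \<in> mod_hom A X1 N"
  then show "compose (carrier X2) f b \<in> {f \<in> mod_hom A X2 N. \<forall>x\<in>Y. f (c x) = \<zero>\<^bsub>N\<^esub>}"
    using mod_hom_compose[OF X(2) b f] mod_hom_zero[OF X(1) N f] c by (auto simp: compose_def)
qed

text \<open>The right-hand quotient is the cokernel of the map from Hom(coker b, I) to Hom(coker b,
  N'), written with maps vanishing on the image of \<open>b\<close>. It refers to nothing below
  \<open>X1\<close>, so one statement serves degree one, where \<open>X1\<close> is the bottom term
  of the resolution, and all higher degrees. The hypothesis \<open>lift\<close> stands for
  projectivity of \<open>X1\<close> and surjectivity of \<pi>, and \<open>van\<close> for acyclicity
  of \<open>I\<close>.\<close>

lemma dimension_shift:
  fixes X1 :: "('a, 'p) module" and N :: "('a, 'n) module" and I :: "('a, 'i) module" and N' :: "('a, 'j) module"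
  assumes X: "left_module A X1" "left_module A X2" "left_module A X3"
    and b: "b \<in> mod_hom A X2 X1" and c: "c \<in> mod_hom A X3 X2"
    and bc: "\<And>x. x \<in> carrier X3 \<Longrightarrow> b (c x) = \<zero>\<^bsub>X1\<^esub>"
    and N: "left_module A N" and I: "left_module A I" and N': "left_module A N'"
    and \<iota>: "\<iota> \<in> mod_hom A N I" "inj_on \<iota> (carrier N)"
    and \<pi>: "\<pi> \<in> mod_hom A I N'" and exact: "\<iota> ` carrier N = {y \<in> carrier I. \<pi> y = \<zero>\<^bsub>N'\<^esub>}"
    and lift: "\<And>g. g \<in> mod_hom A X1 N' \<Longrightarrow> \<exists>h\<in>mod_hom A X1 I. \<forall>x\<in>carrier X1. \<pi> (h x) = g x"
    and van: "\<And>f. f \<in> mod_hom A X2 I \<Longrightarrow> (\<And>x. x \<in> carrier X3 \<Longrightarrow> f (c x) = \<zero>\<^bsub>I\<^esub>) \<Longrightarrow>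
      \<exists>h\<in>mod_hom A X1 I. \<forall>x\<in>carrier X2. h (b x) = f x"
  shows "mod_isomorphic K
    (mod_quotient ((hom_module A X2 N)\<lparr>carrier := {f \<in> mod_hom A X2 N. \<forall>x\<in>carrier X3. f (c x) = \<zero>\<^bsub>N\<^esub>}\<rparr>)
      ((\<lambda>f. compose (carrier X2) f b) ` mod_hom A X1 N))
    (mod_quotient ((hom_module A X1 N')\<lparr>carrier := {g \<in> mod_hom A X1 N'. \<forall>x\<in>carrier X2. g (b x) = \<zero>\<^bsub>N'\<^esub>}\<rparr>)
      ((\<lambda>h. compose (carrier X1) \<pi> h) ` {h \<in> mod_hom A X1 I. \<forall>x\<in>carrier X2. h (b x) = \<zero>\<^bsub>I\<^esub>}))"
    (is "mod_isomorphic K (mod_quotient (?G\<lparr>carrier := ?Z\<rparr>) ?B) (mod_quotient (?G'\<lparr>carrier := ?Z'\<rparr>) ?B')")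
proof -
  interpret N: left_module A N by fact
  interpret I: left_module A I by fact
  interpret N': left_module A N' by fact
  interpret X1: left_module A X1 by (rule X)
  note bD = mod_homD(1-3)[OF b] and cD = mod_homD(1-3)[OF c]
  note iD = mod_homD(1-3)[OF \<iota>(1)] and pD = mod_homD(1-3)[OF \<pi>]
  have b0: "b ` carrier X2 \<subseteq> carrier X1" and c0: "c ` carrier X3 \<subseteq> carrier X2" using bD(1) cD(1) by auto
  have Z: "submodule_of K ?G ?Z" using submodule_hom_vanishing[OF X(2) N c0] by simp
  have Z': "submodule_of K ?G' ?Z'" using submodule_hom_vanishing[OF X(1) N' b0] by simp
  have i0: "\<iota> \<zero>\<^bsub>N\<^esub> = \<zero>\<^bsub>I\<^esub>" by (rule mod_hom_zero[OF N I \<iota>(1)])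
  have f0: "f \<zero>\<^bsub>X1\<^esub> = \<zero>\<^bsub>Q\<^esub>" if "f \<in> mod_hom A X1 Q" "left_module A Q" for f and Q :: "('a, 'q) module"
    by (rule mod_hom_zero[OF X(1) that(2,1)])
  have p\<iota>: "\<pi> (\<iota> n) = \<zero>\<^bsub>N'\<^esub>" if "n \<in> carrier N" for n using exact that by blast
  \<comment> \<open>A map into \<open>I\<close> killed by \<pi> factors through \<iota>, which is
    injective with image the kernel of \<pi>.\<close>
  have pull: "\<exists>f\<in>mod_hom A M N. \<forall>x\<in>carrier M. \<iota> (f x) = h x"
    if M: "left_module A M" and h: "h \<in> mod_hom A M I" and "\<And>x. x \<in> carrier M \<Longrightarrow> \<pi> (h x) = \<zero>\<^bsub>N'\<^esub>"
    for h and M :: "('a, 'q) module"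
  proof -
    interpret M: left_module A M by (rule M)
    note hD = mod_homD(1-3)[OF h]
    define f where "f = (\<lambda>x\<in>carrier M. inv_into (carrier N) \<iota> (h x))"
    have "h x \<in> \<iota> ` carrier N" if "x \<in> carrier M" for x using that(1) hD exact \<open>\<And>x. x \<in> carrier M \<Longrightarrow> \<pi> (h x) = \<zero>\<^bsub>N'\<^esub>\<close> by auto
    then have f: "f x \<in> carrier N" "\<iota> (f x) = h x" if "x \<in> carrier M" for x
      using that by (auto simp: f_def inv_into_into f_inv_into_f)
    have "f \<in> mod_hom A M N"
    proof (rule mod_homI)
      show "f x = undefined" if "x \<notin> carrier M" for x using that by (simp add: f_def)
      show "f (x \<oplus>\<^bsub>M\<^esub> y) = f x \<oplus>\<^bsub>N\<^esub> f y" if "x \<in> carrier M" "y \<in> carrier M" for x y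
        by (rule inj_onD[OF \<iota>(2)]) (use that f in \<open>simp_all add: iD hD\<close>)
      show "f (a \<odot>\<^bsub>M\<^esub> x) = a \<odot>\<^bsub>N\<^esub> f x" if "a \<in> carrier A" "x \<in> carrier M" for a x
        by (rule inj_onD[OF \<iota>(2)]) (use that f in \<open>simp_all add: iD hD M.smult_closed N.smult_closed\<close>)
    qed (use f in auto)
    then show ?thesis using f by blast
  qed
  have B: "submodule_of K (?G\<lparr>carrier := ?Z\<rparr>) ?B"
    by (rule submodule_boundaries[OF X(1,2) b cD(1) bc N])
  have B': "submodule_of K (?G'\<lparr>carrier := ?Z'\<rparr>) ?B'"
    by (rule submodule_shift_boundaries[OF X(1) b0 I N' \<pi>])
  \<comment> \<open>The zig-zag of the connecting homomorphism: \<open>h\<close> restricts along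
    \<open>b\<close> to \<iota> after \<open>f\<close> and projects to \<open>g\<close>.\<close>
  define \<rho> where "\<rho> f g \<longleftrightarrow> (\<exists>h\<in>mod_hom A X1 I. (\<forall>x\<in>carrier X2. h (b x) = \<iota> (f x)) \<and> (\<forall>x\<in>carrier X1. \<pi> (h x) = g x))" for f g
  interpret H: left_module K "hom_module A X1 I" by (rule hom_module_left_module[OF X(1) I])
  note Ha = H.M.a_closed[unfolded hom_module_simps] and Hs = H.smult_closed[unfolded hom_module_simps]
  show ?thesis
  proof (rule quotient_isomorphic_relation[OF submodule_left_module[OF hom_module_left_module[OF X(2) N] Z]
      submodule_left_module[OF hom_module_left_module[OF X(1) N'] Z'] B B', of \<rho>])
    fix f g f' g' assume r: "\<rho> f f'" "\<rho> g g'"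
      and f: "f \<in> carrier (?G\<lparr>carrier := ?Z\<rparr>)" and g: "g \<in> carrier (?G\<lparr>carrier := ?Z\<rparr>)"
    have fD: "f x \<in> carrier N" "g x \<in> carrier N" if "x \<in> carrier X2" for x
      using f g mod_homD(1) that by (auto dest: mod_homD(1))
    obtain h where h: "h \<in> mod_hom A X1 I" "\<forall>x\<in>carrier X2. h (b x) = \<iota> (f x)" "\<forall>x\<in>carrier X1. \<pi> (h x) = f' x"
      using r(1) by (auto simp: \<rho>_def)
    obtain k where k: "k \<in> mod_hom A X1 I" "\<forall>x\<in>carrier X2. k (b x) = \<iota> (g x)" "\<forall>x\<in>carrier X1. \<pi> (k x) = g' x"
      using r(2) by (auto simp: \<rho>_def)
    show "\<rho> (f \<oplus>\<^bsub>?G\<lparr>carrier := ?Z\<rparr>\<^esub> g) (f' \<oplus>\<^bsub>?G'\<lparr>carrier := ?Z'\<rparr>\<^esub> g')"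
      unfolding \<rho>_def
      by (rule bexI[OF _ Ha[OF h(1) k(1)]])
         (use h k in \<open>simp add: hom_module_simps bD iD pD fD mod_homD(1)[OF h(1)] mod_homD(1)[OF k(1)]\<close>)
  next
    fix r f f' assume r: "\<rho> f f'" "r \<in> carrier K" and f: "f \<in> carrier (?G\<lparr>carrier := ?Z\<rparr>)"
    have fD: "f x \<in> carrier N" if "x \<in> carrier X2" for x
      using f that by (auto dest: mod_homD(1))
    obtain h where h: "h \<in> mod_hom A X1 I" "\<forall>x\<in>carrier X2. h (b x) = \<iota> (f x)" "\<forall>x\<in>carrier X1. \<pi> (h x) = f' x"
      using r(1) by (auto simp: \<rho>_def)
    show "\<rho> (r \<odot>\<^bsub>?G\<lparr>carrier := ?Z\<rparr>\<^esub> f) (r \<odot>\<^bsub>?G'\<lparr>carrier := ?Z'\<rparr>\<^esub> f')"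
      unfolding \<rho>_def
      by (rule bexI[OF _ Hs[OF r(2) h(1)]])
         (use h r(2) in \<open>simp add: hom_module_simps bD iD pD fD mod_homD(1)[OF h(1)] scalar_closed\<close>)
  next
    fix f assume "f \<in> carrier (?G\<lparr>carrier := ?Z\<rparr>)"
    then have f: "f \<in> mod_hom A X2 N" "\<And>x. x \<in> carrier X3 \<Longrightarrow> f (c x) = \<zero>\<^bsub>N\<^esub>" by auto
    \<comment> \<open>\<iota> after \<open>f\<close> is a cocycle with values in \<open>I\<close>,
      so \<open>van\<close> extends it along \<open>b\<close>; the projection of the extension is
      the partner of \<open>f\<close>.\<close>
    have "compose (carrier X2) \<iota> f \<in> mod_hom A X2 I" by (rule mod_hom_compose[OF X(2) f(1) \<iota>(1)])
    then obtain h where h: "h \<in> mod_hom A X1 I" "\<forall>x\<in>carrier X2. h (b x) = compose (carrier X2) \<iota> f x"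
      using van[of "compose (carrier X2) \<iota> f"] f(2) cD(1) i0 by (auto simp: compose_def)
    have fN: "f x \<in> carrier N" if "x \<in> carrier X2" for x using mod_homD(1)[OF f(1) that] .
    have "compose (carrier X1) \<pi> h \<in> ?Z'"
      using mod_hom_compose[OF X(1) h(1) \<pi>] bD(1) h(2) p\<iota> fN by (auto simp: compose_def)
    moreover have "\<rho> f (compose (carrier X1) \<pi> h)"
      unfolding \<rho>_def using h by (auto simp: compose_def)
    ultimately show "\<exists>f'\<in>carrier (?G'\<lparr>carrier := ?Z'\<rparr>). \<rho> f f'" by auto
  next
    fix g assume "g \<in> carrier (?G'\<lparr>carrier := ?Z'\<rparr>)"
    then have g: "g \<in> mod_hom A X1 N'" "\<And>x. x \<in> carrier X2 \<Longrightarrow> g (b x) = \<zero>\<^bsub>N'\<^esub>" by auto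
    obtain h where h: "h \<in> mod_hom A X1 I" "\<forall>x\<in>carrier X1. \<pi> (h x) = g x" using lift[OF g(1)] by blast
    obtain f where f: "f \<in> mod_hom A X2 N" "\<forall>x\<in>carrier X2. \<iota> (f x) = compose (carrier X2) h b x"
      using pull[OF X(2) mod_hom_compose[OF X(2) b h(1)]] h(2) g(2) bD(1) by (auto simp: compose_def)
    have "f (c x) = \<zero>\<^bsub>N\<^esub>" if x: "x \<in> carrier X3" for x
      by (rule inj_onD[OF \<iota>(2)])
         (use f x cD(1) bc in \<open>auto simp: compose_def i0 f0[OF h(1) I] mod_homD(1)[OF f(1)]\<close>)
    then have "f \<in> ?Z" using f by auto
    moreover have "\<rho> f g" unfolding \<rho>_def using h f by (auto simp: compose_def)
    ultimately show "\<exists>f\<in>carrier (?G\<lparr>carrier := ?Z\<rparr>). \<rho> f g" by auto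
  next
    fix f g assume r: "\<rho> f g" and "f \<in> carrier (?G\<lparr>carrier := ?Z\<rparr>)" "g \<in> carrier (?G'\<lparr>carrier := ?Z'\<rparr>)"
    then have f: "f \<in> mod_hom A X2 N" "\<And>x. x \<in> carrier X3 \<Longrightarrow> f (c x) = \<zero>\<^bsub>N\<^esub>"
      and g: "g \<in> mod_hom A X1 N'" "\<And>x. x \<in> carrier X2 \<Longrightarrow> g (b x) = \<zero>\<^bsub>N'\<^esub>" by auto
    obtain h where h: "h \<in> mod_hom A X1 I" "\<And>x. x \<in> carrier X2 \<Longrightarrow> h (b x) = \<iota> (f x)"
      "\<And>x. x \<in> carrier X1 \<Longrightarrow> \<pi> (h x) = g x"
      using r(1) by (auto simp: \<rho>_def)
    note hD = mod_homD(1)[OF h(1)]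
    have p_minus: "\<pi> (y \<ominus>\<^bsub>I\<^esub> z) = \<pi> y \<ominus>\<^bsub>N'\<^esub> \<pi> z" if "y \<in> carrier I" "z \<in> carrier I" for y z
      using that pD(3)[of "\<ominus>\<^bsub>A\<^esub> \<one>\<^bsub>A\<^esub>" z] by (simp add: a_minus_def pD I.smult_minus_one N'.smult_minus_one)
    show "f \<in> ?B \<longleftrightarrow> g \<in> ?B'"
    proof
      assume "f \<in> ?B"
      then obtain k where k: "k \<in> mod_hom A X1 N" "f = compose (carrier X2) k b" by blast
      note kD = mod_homD(1)[OF k(1)]
      \<comment> \<open>Correcting \<open>h\<close> by \<iota> after \<open>k\<close> keeps its
        projection \<open>g\<close> and makes it vanish on the image of \<open>b\<close>.\<close>
      let ?h = "\<lambda>x\<in>carrier X1. h x \<ominus>\<^bsub>I\<^esub> compose (carrier X1) \<iota> k x"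
      have h': "?h \<in> mod_hom A X1 I" by (rule mod_hom_minus[OF X(1) I h(1) mod_hom_compose[OF X(1) k(1) \<iota>(1)]])
      have "?h (b x) = \<zero>\<^bsub>I\<^esub>" if "x \<in> carrier X2" for x
        using that h(2)[OF that] bD(1) kD iD(1) by (simp add: k(2) compose_def a_minus_def I.r_neg)
      moreover have "g = compose (carrier X1) \<pi> ?h"
        by (rule mod_hom_eqI[OF g(1) mod_hom_compose[OF X(1) h' \<pi>]])
           (simp add: compose_def p_minus hD kD iD(1) p\<iota> h(3)[symmetric], simp add: a_minus_def pD(1) hD)
      ultimately show "g \<in> ?B'" using h' by blast
    next
      assume "g \<in> ?B'"
      then obtain k where k: "k \<in> mod_hom A X1 I" "\<And>x. x \<in> carrier X2 \<Longrightarrow> k (b x) = \<zero>\<^bsub>I\<^esub>"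
        "g = compose (carrier X1) \<pi> k" by blast
      note kD = mod_homD(1)[OF k(1)]
      \<comment> \<open>\<open>h\<close> and \<open>k\<close> have the same projection, so their
        difference comes from \<open>N\<close>. On the image of \<open>b\<close> it still equals
        \<iota> after \<open>f\<close>, because \<open>k\<close> vanishes there.\<close>
      let ?h = "\<lambda>x\<in>carrier X1. h x \<ominus>\<^bsub>I\<^esub> k x"
      have "\<pi> (?h x) = \<zero>\<^bsub>N'\<^esub>" if "x \<in> carrier X1" for x
        using that h(3)[OF that]
        by (simp add: p_minus hD kD k(3) compose_def pD(1), simp add: a_minus_def pD(1) kD N'.r_neg)
      then obtain f' where f': "f' \<in> mod_hom A X1 N" "\<And>x. x \<in> carrier X1 \<Longrightarrow> \<iota> (f' x) = ?h x"
        using pull[OF X(1) mod_hom_minus[OF X(1) I h(1) k(1)]] by blast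
      have "f = compose (carrier X2) f' b"
      proof (rule mod_hom_eqI[OF f(1) mod_hom_compose[OF X(2) b f'(1)]])
        fix x assume x: "x \<in> carrier X2"
        show "f x = compose (carrier X2) f' b x"
          by (rule inj_onD[OF \<iota>(2)])
             (use x f' bD(1) hD in \<open>auto simp: compose_def h(2)[symmetric] k(2) a_minus_def mod_homD(1)[OF f(1)] mod_homD(1)[OF f'(1)]\<close>)
      qed
      then show "f \<in> ?B" using f'(1) by blast
    qed
  qed
qed

lemma Ext_Suc:
  fixes P :: "nat \<Rightarrow> ('a, 'p) module" and N :: "('a, 'n) module"
  shows "Ext A P d N (Suc i) = mod_quotient ((hom_module A (P (Suc i)) N)
      \<lparr>carrier := {f \<in> mod_hom A (P (Suc i)) N. \<forall>x\<in>carrier (P (Suc (Suc i))). f (d (Suc i) x) = \<zero>\<^bsub>N\<^esub>}\<rparr>)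
    ((\<lambda>f. compose (carrier (P (Suc i))) f (d i)) ` mod_hom A (P i) N)"
  unfolding Ext_def cohomology_def cocycles_def coboundaries_def a_kernel_def'
  by (simp add: hom_module_simps compose_def fun_eq_iff restrict_def)
     (intro arg_cong2[where f = mod_quotient] refl, metis)

lemma Ext_closed:
  fixes P :: "nat \<Rightarrow> ('a, 'p) module" and N :: "('a, 'n) module" and M :: "('a, 'm) module"
  assumes res: "projective_resolution A P d e M" and N: "left_module A N"
  shows "x \<in> carrier (Ext A P d N (Suc i)) \<Longrightarrow> y \<in> carrier (Ext A P d N (Suc i)) \<Longrightarrow>
      x \<oplus>\<^bsub>Ext A P d N (Suc i)\<^esub> y \<in> carrier (Ext A P d N (Suc i))"
    and "a \<in> carrier K \<Longrightarrow> x \<in> carrier (Ext A P d N (Suc i)) \<Longrightarrow>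
      a \<odot>\<^bsub>Ext A P d N (Suc i)\<^esub> x \<in> carrier (Ext A P d N (Suc i))"
proof -
  note r = projective_resolutionD[OF res]
  have d: "d (Suc i) x \<in> carrier (P (Suc i))" "d i (d (Suc i) x) = \<zero>\<^bsub>P i\<^esub>"
    if "x \<in> carrier (P (Suc (Suc i)))" for x using r(8)[of i] that by blast+
  have "d (Suc i) ` carrier (P (Suc (Suc i))) \<subseteq> carrier (P (Suc i))" using d by blast
  from submodule_hom_vanishing[OF r(3) N this]
  have "left_module K ((hom_module A (P (Suc i)) N)\<lparr>carrier :=
      {f \<in> mod_hom A (P (Suc i)) N. \<forall>x\<in>carrier (P (Suc (Suc i))). f (d (Suc i) x) = \<zero>\<^bsub>N\<^esub>}\<rparr>)"
    by (intro submodule_left_module[OF hom_module_left_module[OF r(3) N]]) simp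
  note closed = quotient_closed[OF this submodule_boundaries[OF r(3) r(3) r(5) d N]]
  show "x \<in> carrier (Ext A P d N (Suc i)) \<Longrightarrow> y \<in> carrier (Ext A P d N (Suc i)) \<Longrightarrow>
      x \<oplus>\<^bsub>Ext A P d N (Suc i)\<^esub> y \<in> carrier (Ext A P d N (Suc i))"
    unfolding Ext_Suc by (rule closed(1))
  show "a \<in> carrier K \<Longrightarrow> x \<in> carrier (Ext A P d N (Suc i)) \<Longrightarrow>
      a \<odot>\<^bsub>Ext A P d N (Suc i)\<^esub> x \<in> carrier (Ext A P d N (Suc i))"
    unfolding Ext_Suc by (rule closed(2))
qed

end

section \<open>The right ideals of the left regular band\<close>

definition lrb_relations :: "'v set \<Rightarrow> 'v set set \<Rightarrow> ('v list \<times> 'v list) set" where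
  "lrb_relations V E = {(x @ x, x) | x. x \<in> lists V} \<union>
      {(x @ y @ x, x @ y) | x y. x \<in> lists V \<and> y \<in> lists V} \<union>
      {([x, y], [y, x]) | x y. {x, y} \<in> E}"

definition word_class :: "'v set \<Rightarrow> 'v set set \<Rightarrow> 'v list \<Rightarrow> 'v list set" where
  "word_class V E w = monoid_congruence V (lrb_relations V E) `` {w}"

lemma free_pc_lrb_monoid: "monoid (free_pc_lrb V E)"
  unfolding free_pc_lrb_def by (rule presented_monoid_monoid)

lemma word_class_eqI:
  assumes "(u, v) \<in> monoid_congruence V (lrb_relations V E)"
  shows "word_class V E u = word_class V E v"
  unfolding word_class_def by (rule equiv_class_eq[OF equiv_monoid_congruence assms])

lemma word_class_closed: "w \<in> lists V \<Longrightarrow> word_class V E w \<in> carrier (free_pc_lrb V E)"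
  by (auto simp: word_class_def free_pc_lrb_def lrb_relations_def presented_monoid_def intro: quotientI)

lemma word_class_cases:
  assumes "x \<in> carrier (free_pc_lrb V E)"
  obtains w where "w \<in> lists V" "x = word_class V E w"
proof -
  have "x \<in> lists V // monoid_congruence V (lrb_relations V E)"
    using assms by (simp add: free_pc_lrb_def lrb_relations_def presented_monoid_def)
  then show ?thesis using that by (auto simp: word_class_def elim!: quotientE)
qed

lemma word_class_mult:
  "u \<in> lists V \<Longrightarrow> v \<in> lists V \<Longrightarrow>
    word_class V E u \<otimes>\<^bsub>free_pc_lrb V E\<^esub> word_class V E v = word_class V E (u @ v)"
  by (simp add: word_class_def free_pc_lrb_def lrb_relations_def presented_mult)

lemma word_class_Nil: "word_class V E [] = \<one>\<^bsub>free_pc_lrb V E\<^esub>"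
  by (simp add: word_class_def free_pc_lrb_def lrb_relations_def presented_monoid_def)

lemma content_word_class: "w \<in> lists V \<Longrightarrow> content (word_class V E w) = set w"
  by (simp add: word_class_def lrb_relations_def content_word)

lemma content_mult:
  assumes "x \<in> carrier (free_pc_lrb V E)" "y \<in> carrier (free_pc_lrb V E)"
  shows "content (x \<otimes>\<^bsub>free_pc_lrb V E\<^esub> y) = content x \<union> content y"
proof -
  obtain u where u: "u \<in> lists V" "x = word_class V E u" using word_class_cases[OF assms(1)] .
  obtain v where v: "v \<in> lists V" "y = word_class V E v" using word_class_cases[OF assms(2)] .
  have "u @ v \<in> lists V" using u v by simp
  then show ?thesis using u v by (simp only: word_class_mult content_word_class set_append)
qed

text \<open>Each letter \<open>a\<close> of \<open>y\<close> already occurs in a word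
  \<open>p a r\<close> for \<open>x\<close>, and the relation \<open>xyx = xy\<close>, applied to
  the letter \<open>a\<close> and the word \<open>r\<close>, deletes a further \<open>a\<close> at
  the end.\<close>

lemma lrb_absorb:
  assumes "x \<in> carrier (free_pc_lrb V E)" "y \<in> carrier (free_pc_lrb V E)" "content y \<subseteq> content x"
  shows "x \<otimes>\<^bsub>free_pc_lrb V E\<^esub> y = x"
proof -
  obtain u where u: "u \<in> lists V" "x = word_class V E u" using word_class_cases[OF assms(1)] .
  obtain v where v: "v \<in> lists V" "y = word_class V E v" using word_class_cases[OF assms(2)] .
  have one: "word_class V E (u @ [a]) = word_class V E u" if a: "a \<in> set u" for a
  proof -
    obtain p r where pr: "u = p @ [a] @ r" using split_list[OF a] by auto
    have "[a] \<in> lists V" "r \<in> lists V" "p \<in> lists V" using u pr by auto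
    moreover from this have "([a] @ r @ [a], [a] @ r) \<in> lrb_relations V E"
      unfolding lrb_relations_def by blast
    ultimately have "([a] @ r @ [a], [a] @ r) \<in> monoid_congruence V (lrb_relations V E)"
      by (intro cong_rel) simp_all
    from cong_mult[OF cong_refl[OF \<open>p \<in> lists V\<close>] this] show ?thesis
      unfolding pr append_assoc by (rule word_class_eqI)
  qed
  have "word_class V E (u @ v) = word_class V E u" if "set v \<subseteq> set u" "v \<in> lists V" for v
    using that
  proof (induction v rule: rev_induct)
    case (snoc a v)
    have "word_class V E (u @ v @ [a]) = word_class V E (u @ v) \<otimes>\<^bsub>free_pc_lrb V E\<^esub> word_class V E [a]"
      using u snoc.prems by (subst word_class_mult) auto
    also have "\<dots> = word_class V E (u @ [a])"
      using u snoc by (subst snoc.IH) (auto simp: word_class_mult)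
    finally show ?case using one[of a] snoc.prems by simp
  qed simp
  then show ?thesis using u v assms(3) by (simp add: word_class_mult content_word_class)
qed

lemma lrb_commute:
  assumes "{a, b} \<in> E" "a \<in> V" "b \<in> V"
  shows "word_class V E [a] \<otimes>\<^bsub>free_pc_lrb V E\<^esub> word_class V E [b] =
    word_class V E [b] \<otimes>\<^bsub>free_pc_lrb V E\<^esub> word_class V E [a]"
proof -
  have "([a, b], [b, a]) \<in> monoid_congruence V (lrb_relations V E)"
    using assms by (intro cong_rel) (auto simp: lrb_relations_def)
  from word_class_eqI[OF this] show ?thesis using assms by (simp add: word_class_mult)
qed

text \<open>This is what keeps ideals of non-adjacent letters apart: the deletions allowed by the
  relations remove only repeated occurrences, and commutations never exchange two letters that are
  not adjacent in the graph.\<close>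

lemma first_letter_invariant:
  assumes "(u, v) \<in> monoid_congruence V (lrb_relations V E)" "{a, b} \<notin> E" "\<And>e. e \<in> E \<Longrightarrow> card e = 2"
  shows "List.find (\<lambda>x. x \<in> {a, b}) u = List.find (\<lambda>x. x \<in> {a, b}) v"
  using assms(1)
proof (induction rule: monoid_congruence.induct)
  have app: "List.find P (xs @ ys) = (case List.find P xs of None \<Rightarrow> List.find P ys | Some z \<Rightarrow> Some z)"
    for P and xs ys :: "'a list" by (induction xs) auto
  {
    case (cong_rel u v)
    have "x \<noteq> y" if "{x, y} \<in> E" for x y using assms(3)[OF that] by auto
    moreover have "\<not> (x \<in> {a, b} \<and> y \<in> {a, b})" if "{x, y} \<in> E" "x \<noteq> y" for x y
      using that assms(2) by (auto simp: insert_commute)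
    moreover have "{b, a} \<notin> E" using assms(2) by (simp add: insert_commute)
    ultimately show ?case
      using assms(2) cong_rel(1) by (auto simp: lrb_relations_def app split: option.splits)
  next
    case (cong_mult u v u' v')
    then show ?case by (simp add: app split: option.split)
  }
qed simp_all

section \<open>The right ideal of an element of content \<open>W\<close> and its covering by ideals
  of letters\<close>

locale lrb_pair =
  fixes V :: "'v set" and E :: "'v set set" and W :: "'v set"
  assumes graph: "simple_graph V E" and WV: "W \<subseteq> V"
begin

abbreviation "LRB \<equiv> free_pc_lrb V E"
abbreviation "cls \<equiv> word_class V E"
abbreviation lrb_mult (infixl "\<cdot>" 70) where "x \<cdot> y \<equiv> x \<otimes>\<^bsub>LRB\<^esub> y"

sublocale B: monoid LRB by (rule free_pc_lrb_monoid)

text \<open>Write \<open>e\<close> for \<open>base\<close>. Then \<open>ideal\<close> is the right ideal \<open>e B\<close>, the set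
  \<open>tops x\<close> consists of the letters \<open>v\<close> outside \<open>W\<close> with \<open>x \<in> e v B\<close>, and \<open>clique_elt S\<close>
  generates the intersection of the ideals \<open>e v B\<close> with \<open>v \<in> S\<close> if \<open>S\<close> is a clique.\<close>

definition word_of :: "'v set \<Rightarrow> 'v list" where "word_of S = (SOME w. set w = S)"

definition base :: "'v list set" where "base = cls (word_of W)"

definition ideal :: "'v list set set" where "ideal = {x \<in> carrier LRB. base \<cdot> x = x}"

definition tops :: "'v list set \<Rightarrow> 'v set" where
  "tops x = {v \<in> V - W. base \<cdot> (cls [v] \<cdot> x) = x}"

definition clique_elt :: "'v set \<Rightarrow> 'v list set" where
  "clique_elt S = base \<cdot> cls (word_of S)"

lemma set_word_of: "S \<subseteq> V \<Longrightarrow> set (word_of S) = S"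
  unfolding word_of_def using graph finite_subset[of S V] 
  by (intro someI_ex[of "\<lambda>w. set w = S"] finite_list) (auto simp: simple_graph_def)

lemma word_of_lists: "S \<subseteq> V \<Longrightarrow> word_of S \<in> lists V"
  using set_word_of by (auto simp: lists_eq_set)

lemma letter_closed [simp]: "v \<in> V \<Longrightarrow> cls [v] \<in> carrier LRB" by (simp add: word_class_closed)
lemma base_closed [simp]: "base \<in> carrier LRB"
  unfolding base_def by (intro word_class_closed word_of_lists WV)
lemma content_base [simp]: "content base = W"
  by (simp add: base_def content_word_class word_of_lists set_word_of WV)
lemma content_letter: "v \<in> V \<Longrightarrow> content (cls [v]) = {v}" by (simp add: content_word_class)

lemma clique_elt_closed [simp]: "S \<subseteq> V \<Longrightarrow> clique_elt S \<in> carrier LRB"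
  by (simp add: clique_elt_def word_class_closed word_of_lists)

lemma content_clique_elt: "S \<subseteq> V \<Longrightarrow> content (clique_elt S) = W \<union> S"
  by (simp add: clique_elt_def content_mult word_class_closed word_of_lists content_word_class set_word_of)

lemma base_idem: "base \<cdot> base = base" by (rule lrb_absorb) simp_all

lemma clique_elt_ideal: "S \<subseteq> V \<Longrightarrow> clique_elt S \<in> ideal"
  by (simp add: ideal_def) (simp add: clique_elt_def B.m_assoc[symmetric] word_class_closed word_of_lists base_idem)

lemma base_ideal: "base \<in> ideal" by (simp add: ideal_def base_idem)

lemma ideal_closed: "x \<in> ideal \<Longrightarrow> x \<in> carrier LRB" by (simp add: ideal_def)

lemma ideal_mult: "x \<in> ideal \<Longrightarrow> y \<in> carrier LRB \<Longrightarrow> x \<cdot> y \<in> ideal"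
  by (simp add: ideal_def B.m_assoc[symmetric])

text \<open>Each \<open>e v B\<close> is a right ideal; this lets right translation act on functions
  on these ideals.\<close>

lemma tops_mult: "x \<in> carrier LRB \<Longrightarrow> y \<in> carrier LRB \<Longrightarrow> tops x \<subseteq> tops (x \<cdot> y)"
  by (auto simp: tops_def B.m_assoc[symmetric])

lemma tops_subset: "tops x \<subseteq> V - W" by (auto simp: tops_def)

lemma tops_content:
  assumes "x \<in> carrier LRB"
  shows "tops x \<subseteq> content x"
proof
  fix v assume v: "v \<in> tops x"
  then have vV: "v \<in> V" and eq: "base \<cdot> (cls [v] \<cdot> x) = x" by (simp_all add: tops_def)
  have "v \<in> content (base \<cdot> (cls [v] \<cdot> x))" using vV assms by (simp add: content_mult content_letter)
  then show "v \<in> content x" unfolding eq .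
qed

text \<open>For \<open>v\<close> equal to \<open>a\<close> or \<open>b\<close>, the word
  \<open>e v w\<close> has \<open>v\<close> as its first letter from \<open>{a, b}\<close>, since
  the letters of \<open>e\<close> lie in \<open>W\<close>. Were \<open>a\<close> and
  \<open>b\<close> not adjacent, \<open>first_letter_invariant\<close> would carry this over to
  \<open>w\<close> for both of them.\<close>

lemma tops_clique:
  assumes x: "x \<in> carrier LRB" and a: "a \<in> tops x" and b: "b \<in> tops x" and ab: "a \<noteq> b"
  shows "{a, b} \<in> E"
proof (rule ccontr)
  assume nE: "{a, b} \<notin> E"
  obtain w where w: "w \<in> lists V" "x = cls w" using word_class_cases[OF x] .
  have card: "\<And>e. e \<in> E \<Longrightarrow> card e = 2" using graph by (simp add: simple_graph_def)
  have first: "List.find (\<lambda>x. x \<in> {a, b}) w = Some v" if v: "v \<in> {a, b}" for v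
  proof -
    have vT: "v \<in> tops x" using v a b by auto
    then have vV: "v \<in> V" by (simp add: tops_def)
    have "cls (word_of W @ [v] @ w) = cls w"
      using vT w vV by (simp add: tops_def base_def word_class_mult word_of_lists WV)
    then have "(word_of W @ [v] @ w, w) \<in> monoid_congruence V (lrb_relations V E)"
      unfolding word_class_def
      by (rule eq_equiv_class[OF _ equiv_monoid_congruence]) (rule w(1))
    from first_letter_invariant[OF this nE card]
    have "List.find (\<lambda>x. x \<in> {a, b}) w = List.find (\<lambda>x. x \<in> {a, b}) (word_of W @ [v] @ w)" by simp
    also have "\<dots> = Some v"
    proof -
      have "c \<notin> {a, b}" if "c \<in> set (word_of W)" for c
        using that a b set_word_of[OF WV] by (auto simp: tops_def)
      then have "List.find (\<lambda>x. x \<in> {a, b}) (us @ [v] @ w) = Some v" if "set us \<subseteq> set (word_of W)" for us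
        using that v by (induction us) auto
      then show ?thesis by blast
    qed
    finally show ?thesis .
  qed
  show False using first[of a] first[of b] ab by simp
qed

lemma base_word_absorb:
  assumes "set w \<subseteq> W"
  shows "base \<cdot> cls w = base"
proof (rule lrb_absorb)
  have "w \<in> lists V" using assms WV by auto
  then show "cls w \<in> carrier LRB" "content (cls w) \<subseteq> content base"
    using assms by (simp_all add: word_class_closed content_word_class)
qed simp

text \<open>This is \<open>e v e = e v\<close>, by absorption: the content of \<open>e\<close>
  already occurs in \<open>e v\<close>.\<close>

lemma letter_word_base:
  assumes v: "v \<in> V" and x: "x \<in> carrier LRB"
  shows "base \<cdot> (cls [v] \<cdot> (base \<cdot> x)) = base \<cdot> (cls [v] \<cdot> x)"
proof -
  have "(base \<cdot> cls [v]) \<cdot> base = base \<cdot> cls [v]"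
    using v by (intro lrb_absorb) (auto simp: content_mult)
  then show ?thesis using v x B.m_assoc by (metis B.m_closed base_closed letter_closed)
qed

text \<open>In a word for \<open>x\<close>, the letters before the first one outside
  \<open>W\<close> are absorbed by \<open>e\<close>, so \<open>x\<close> lies in
  \<open>e v B\<close> for that letter \<open>v\<close>. If there is no such letter, the whole word
  is absorbed.\<close>

lemma tops_empty_iff:
  assumes x: "x \<in> ideal"
  shows "tops x = {} \<longleftrightarrow> x = base"
proof
  assume "x = base"
  then show "tops x = {}" using tops_content[OF base_closed] tops_subset by fastforce
next
  assume T: "tops x = {}"
  obtain w where w: "w \<in> lists V" "x = cls w" using word_class_cases[OF ideal_closed[OF x]] .
  have bx: "base \<cdot> cls w = x" using x w by (simp add: ideal_def)
  show "x = base"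
  proof (cases "set w \<subseteq> W")
    case True
    then show ?thesis using base_word_absorb bx by simp
  next
    case False
    then obtain v where "v \<in> set w" "v \<notin> W" by blast
    from split_list_first_prop[of w "\<lambda>v. v \<notin> W"] this
    obtain p v r where pvr: "w = p @ v # r" "v \<notin> W" "\<forall>y\<in>set p. y \<in> W" by blast
    have V: "p \<in> lists V" "v \<in> V" "r \<in> lists V" using w pvr(1) by auto
    have cl: "cls p \<in> carrier LRB" "cls r \<in> carrier LRB" using V by (simp_all add: word_class_closed)
    have "base \<cdot> cls p = base" using pvr(3) by (intro base_word_absorb) auto
    moreover have "cls w = cls p \<cdot> (cls [v] \<cdot> cls r)"
      using V by (simp add: word_class_mult pvr(1))
    ultimately have xr: "x = base \<cdot> (cls [v] \<cdot> cls r)"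
      using bx V cl by (simp add: B.m_assoc[symmetric])
    have vr: "cls [v] \<cdot> (cls [v] \<cdot> cls r) = cls [v] \<cdot> cls r"
      using V cl lrb_absorb[of "cls [v]" V E "cls [v]"] by (simp add: B.m_assoc[symmetric])
    have "base \<cdot> (cls [v] \<cdot> x) = x"
      unfolding xr using V cl by (simp add: letter_word_base[OF V(2)] vr)
    then have "v \<in> tops x" using V pvr by (simp add: tops_def)
    then show ?thesis using T by simp
  qed
qed

text \<open>The intersection of the ideals \<open>e v B\<close> with \<open>v\<close> in
  \<open>S\<close> lies in \<open>e e_S B\<close>: the letters of \<open>S\<close> are put in front
  of \<open>x\<close> one at a time, each step using \<open>x = e v x\<close> and
  \<open>e v e = e v\<close>.\<close>

lemma clique_elt_absorb:
  assumes x: "x \<in> ideal" and S: "S \<subseteq> tops x"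
  shows "clique_elt S \<cdot> x = x"
proof -
  have xB: "x \<in> carrier LRB" by (rule ideal_closed[OF x])
  have "base \<cdot> (cls w \<cdot> x) = x" if "set w \<subseteq> tops x" for w
    using that
  proof (induction w)
    case Nil
    then show ?case using x xB by (simp add: word_class_Nil ideal_def)
  next
    case (Cons v w)
    have v: "v \<in> V" and w: "w \<in> lists V" using Cons.prems tops_subset[of x] by auto
    then have wc: "cls w \<in> carrier LRB" by (simp add: word_class_closed)
    have "cls (v # w) = cls [v] \<cdot> cls w" using v w by (simp add: word_class_mult)
    then have "base \<cdot> (cls (v # w) \<cdot> x) =
        base \<cdot> (cls [v] \<cdot> (base \<cdot> (cls w \<cdot> x)))"
      using letter_word_base[OF v, of "cls w \<cdot> x"] v wc xB by (simp add: B.m_assoc)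
    also have "\<dots> = base \<cdot> (cls [v] \<cdot> x)" using Cons by simp
    also have "\<dots> = x" using Cons.prems by (simp add: tops_def)
    finally show ?case .
  qed
  then have "base \<cdot> (cls (word_of S) \<cdot> x) = x"
    using S set_word_of[of S] tops_subset[of x] by (metis Diff_subset order_trans)
  moreover have "S \<subseteq> V" using S tops_subset[of x] by blast
  ultimately show ?thesis
    using xB by (simp add: clique_elt_def B.m_assoc word_class_closed word_of_lists)
qed

text \<open>The letters of a clique commute, so \<open>v\<close> moves past the word of
  \<open>S\<close> to its end and is absorbed there; hence the clique element lies in every
  \<open>e v B\<close>.\<close>

lemma clique_subset_tops:
  assumes S: "S \<subseteq> V - W" and E: "\<And>a b. a \<in> S \<Longrightarrow> b \<in> S \<Longrightarrow> a \<noteq> b \<Longrightarrow> {a, b} \<in> E"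
  shows "S \<subseteq> tops (clique_elt S)"
proof
  fix v assume vS: "v \<in> S"
  have v: "v \<in> V" "v \<notin> W" using vS S by auto
  have SV: "S \<subseteq> V" using S by blast
  note wS = word_of_lists[OF SV] set_word_of[OF SV]
  have comm: "cls [v] \<cdot> cls w = cls w \<cdot> cls [v]" if "set w \<subseteq> S" for w
    using that
  proof (induction w)
    case Nil
    then show ?case using v by (simp add: word_class_Nil)
  next
    case (Cons a w)
    have a: "a \<in> V" and w: "w \<in> lists V" using Cons.prems SV by auto
    then have wc: "cls w \<in> carrier LRB" by (simp add: word_class_closed)
    have av: "cls [v] \<cdot> cls [a] = cls [a] \<cdot> cls [v]"
      using lrb_commute[OF E[of v a] v(1) a] vS Cons.prems by (cases "a = v") auto
    have aw: "cls (a # w) = cls [a] \<cdot> cls w" using a w by (simp add: word_class_mult)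
    have "cls [v] \<cdot> cls (a # w) = cls [a] \<cdot> (cls [v] \<cdot> cls w)"
      unfolding aw using a v wc av by (metis B.m_assoc letter_closed)
    also have "\<dots> = cls (a # w) \<cdot> cls [v]"
      unfolding aw using Cons a v wc by (simp add: B.m_assoc)
    finally show ?case .
  qed
  have cS: "cls (word_of S) \<in> carrier LRB" by (rule word_class_closed[OF wS(1)])
  have "cls (word_of S) \<cdot> cls [v] = cls (word_of S)"
    by (rule lrb_absorb[OF cS]) (use v vS wS in \<open>simp_all add: content_word_class\<close>)
  then have vw: "cls [v] \<cdot> cls (word_of S) = cls (word_of S)" using comm[of "word_of S"] wS by simp
  have "base \<cdot> (cls [v] \<cdot> clique_elt S) = clique_elt S"
    unfolding clique_elt_def letter_word_base[OF v(1) cS] vw ..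
  then show "v \<in> tops (clique_elt S)" using v by (simp add: tops_def)
qed

end

section \<open>Alternating cochains\<close>

text \<open>The alternating sum, written through its cone identity. In this form the identity
  \<open>D (D f) = 0\<close> and the preservation of alternation hold for all lists, degenerate ones
  included, by induction on the list.\<close>

fun cobd :: "('k, 'z) ring_scheme \<Rightarrow> ('v list \<Rightarrow> 'k) \<Rightarrow> 'v list \<Rightarrow> 'k" where
  "cobd K f [] = \<zero>\<^bsub>K\<^esub>"
| "cobd K f (v # vs) = f vs \<ominus>\<^bsub>K\<^esub> cobd K (\<lambda>u. f (v # u)) vs"

definition alternating :: "('k, 'z) ring_scheme \<Rightarrow> ('v list \<Rightarrow> 'k) \<Rightarrow> bool" where
  "alternating K f \<longleftrightarrow> (\<forall>vs. f vs \<in> carrier K) \<and>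
     (\<forall>xs a b ys. f (xs @ a # b # ys) = \<ominus>\<^bsub>K\<^esub> f (xs @ b # a # ys))"

text \<open>Values off the simplices are zero rather than \<open>undefined\<close>, so that
  \<open>cobd\<close> applies to all lists. Vanishing on lists with repetitions comes from the
  support condition; the sign rule alone would not give it when 2 is a zero divisor.\<close>

definition alt_cochains :: "('k, 'z) ring_scheme \<Rightarrow> 'v set set \<Rightarrow> nat \<Rightarrow> ('v list \<Rightarrow> 'k) set" where
  "alt_cochains K X n = {f. alternating K f \<and> (\<forall>vs. vs \<notin> ordered_simplices X n \<longrightarrow> f vs = \<zero>\<^bsub>K\<^esub>)}"

text \<open>The cutoff restores the support condition: a list that is no simplex can have faces that
  are simplices, and \<open>cobd\<close> may be nonzero there.\<close>

definition cobd_on :: "('k, 'z) ring_scheme \<Rightarrow> 'v set set \<Rightarrow> nat \<Rightarrow> ('v list \<Rightarrow> 'k) \<Rightarrow> 'v list \<Rightarrow> 'k" where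
  "cobd_on K X n f vs = (if vs \<in> ordered_simplices X (Suc n) then cobd K f vs else \<zero>\<^bsub>K\<^esub>)"

lemma ordered_simplices_face:
  assumes "\<forall>S\<in>X. Pow S \<subseteq> X" "ys @ y # zs \<in> ordered_simplices X (Suc n)"
  shows "ys @ zs \<in> ordered_simplices X n"
proof -
  have "set (ys @ zs) \<subseteq> set (ys @ y # zs)" by auto
  then have "set (ys @ zs) \<in> X" using assms by (auto simp: ordered_simplices_def)
  then show ?thesis using assms(2) by (auto simp: ordered_simplices_def)
qed

lemma ordered_simplices_swap:
  "xs @ a # b # ys \<in> ordered_simplices X n \<longleftrightarrow> xs @ b # a # ys \<in> ordered_simplices X n"
  by (auto simp: ordered_simplices_def insert_commute)

lemma cobd_cong:
  assumes "\<And>ys y zs. vs = ys @ y # zs \<Longrightarrow> f (ys @ zs) = g (ys @ zs)"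
  shows "cobd K f vs = cobd K g vs"
  using assms
proof (induction vs arbitrary: f g)
  case (Cons v vs)
  have "f vs = g vs" using Cons.prems[of "[]" v vs] by simp
  moreover have "cobd K (\<lambda>u. f (v # u)) vs = cobd K (\<lambda>u. g (v # u)) vs"
  proof (rule Cons.IH)
    show "f (v # ys @ zs) = g (v # ys @ zs)" if "vs = ys @ y # zs" for ys y zs
      using Cons.prems[of "v # ys" y zs] that by simp
  qed
  ultimately show ?case by simp
qed simp

lemma alternatingD:
  assumes "alternating K f"
  shows "f vs \<in> carrier K" "f (xs @ a # b # ys) = \<ominus>\<^bsub>K\<^esub> f (xs @ b # a # ys)"
    "f (a # b # ys) = \<ominus>\<^bsub>K\<^esub> f (b # a # ys)"
proof -
  show "f vs \<in> carrier K" using assms unfolding alternating_def by blast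
  have *: "\<forall>xs a b ys. f (xs @ a # b # ys) = \<ominus>\<^bsub>K\<^esub> f (xs @ b # a # ys)" using assms unfolding alternating_def by blast
  show "f (xs @ a # b # ys) = \<ominus>\<^bsub>K\<^esub> f (xs @ b # a # ys)" using *[rule_format, of xs a b ys] .
  show "f (a # b # ys) = \<ominus>\<^bsub>K\<^esub> f (b # a # ys)" using *[rule_format, of "[]" a b ys] unfolding append_Nil .
qed

lemma alternating_Cons:
  assumes "alternating K f"
  shows "alternating K (\<lambda>u. f (v # u))"
  unfolding alternating_def
proof (intro conjI allI)
  show "f (v # xs @ a # b # ys) = \<ominus>\<^bsub>K\<^esub> f (v # xs @ b # a # ys)" for xs a b ys
    using alternatingD(2)[OF assms, of "v # xs" a b ys] unfolding append_Cons .
qed (rule alternatingD(1)[OF assms])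

lemma alt_cochainsD:
  assumes "f \<in> alt_cochains K X n"
  shows "alternating K f" "vs \<notin> ordered_simplices X n \<Longrightarrow> f vs = \<zero>\<^bsub>K\<^esub>"
  using assms by (simp_all add: alt_cochains_def)

context
  fixes K :: "('k, 'z) ring_scheme" (structure)
  assumes K: "cring K"
begin

interpretation K: cring K by (rule K)

lemma cobd_closed: "(\<And>u. f u \<in> carrier K) \<Longrightarrow> cobd K f vs \<in> carrier K"
  by (induction vs arbitrary: f) simp_all

lemma cobd_zero: "(\<And>u. f u = \<zero>) \<Longrightarrow> cobd K f vs = \<zero>"
  by (induction vs arbitrary: f) (simp_all add: a_minus_def)

lemma cobd_add:
  assumes "\<And>u. f u \<in> carrier K" "\<And>u. g u \<in> carrier K"
  shows "cobd K (\<lambda>u. f u \<oplus> g u) vs = cobd K f vs \<oplus> cobd K g vs"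
  using assms
  by (induction vs arbitrary: f g) (simp_all add: a_minus_def K.minus_add K.a_ac cobd_closed)

lemma cobd_smult:
  assumes "\<And>u. f u \<in> carrier K" "r \<in> carrier K"
  shows "cobd K (\<lambda>u. r \<otimes> f u) vs = r \<otimes> cobd K f vs"
  using assms
  by (induction vs arbitrary: f) (simp_all add: a_minus_def K.r_distr K.r_minus cobd_closed)

lemma cobd_uminus:
  assumes "\<And>u. f u \<in> carrier K"
  shows "cobd K (\<lambda>u. \<ominus> f u) vs = \<ominus> cobd K f vs"
  using assms
  by (induction vs arbitrary: f) (simp_all add: a_minus_def K.minus_add cobd_closed)

lemma cobd_minus:
  assumes "\<And>u. f u \<in> carrier K" "\<And>u. g u \<in> carrier K"
  shows "cobd K (\<lambda>u. f u \<ominus> g u) vs = cobd K f vs \<ominus> cobd K g vs"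
  using assms cobd_add[of f "\<lambda>u. \<ominus> g u"] cobd_uminus[of g] by (simp add: a_minus_def)

text \<open>Write \<open>D\<close> for \<open>cobd\<close>. Expanding the head gives
  \<open>D f vs\<close> minus \<open>D\<close> of \<open>D f (v # _)\<close>; expanding inside, the
  latter is again \<open>D f vs\<close> minus a term that vanishes by induction.\<close>

lemma cobd_cobd:
  assumes "\<And>u. f u \<in> carrier K"
  shows "cobd K (cobd K f) vs = \<zero>"
  using assms
proof (induction vs arbitrary: f)
  case (Cons v vs)
  have c: "cobd K (\<lambda>u. f (v # u)) u \<in> carrier K" "cobd K f u \<in> carrier K" for u
    using Cons.prems by (simp_all add: cobd_closed)
  have "cobd K (\<lambda>u. cobd K f (v # u)) vs = cobd K f vs \<ominus> cobd K (cobd K (\<lambda>u. f (v # u))) vs"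
    using Cons.prems c by (simp add: cobd_minus)
  also have "\<dots> = cobd K f vs" using c Cons by (simp add: a_minus_def)
  finally show ?case using c by (simp add: a_minus_def K.r_neg)
qed simp

lemma cobd_alternating:
  assumes "alternating K f"
  shows "alternating K (cobd K f)"
  unfolding alternating_def
proof (intro conjI allI)
  show "cobd K f vs \<in> carrier K" for vs using alternatingD(1)[OF assms] by (rule cobd_closed)
  fix xs a b ys
  show "cobd K f (xs @ a # b # ys) = \<ominus> cobd K f (xs @ b # a # ys)"
    using assms
  proof (induction xs arbitrary: f)
    case Nil
    note c = alternatingD(1)[OF Nil]
    have "cobd K (\<lambda>u. f (a # b # u)) ys = \<ominus> cobd K (\<lambda>u. f (b # a # u)) ys"
      unfolding alternatingD(3)[OF Nil, of a b] by (rule cobd_uminus) (rule c)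
    then show ?case using c cobd_closed[of "\<lambda>u. f (b # a # u)" ys]
      by (simp add: a_minus_def K.minus_add cobd_closed K.a_ac)
  next
    case (Cons x xs)
    note c = alternatingD(1)[OF Cons.prems]
    show ?case
      unfolding append_Cons cobd.simps alternatingD(2)[OF Cons.prems, of xs a b ys]
        Cons.IH[OF alternating_Cons[OF Cons.prems, of x]]
      using c by (simp add: a_minus_def K.minus_add cobd_closed)
  qed
qed

text \<open>Deleting the head is the term of index 0. The terms of index \<open>Suc i\<close> are
  those of the tail, with \<open>v\<close> kept in front and the opposite sign; this is the
  recursion of \<open>cobd\<close>.\<close>

lemma cobd_eq_finsum:
  assumes "\<And>u. f u \<in> carrier K" "length vs = Suc n"
  shows "cobd K f vs = (\<Oplus>i\<in>{..n}. let u = take i vs @ drop (Suc i) vs in if even i then f u else \<ominus> f u)"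
  using assms
proof (induction n arbitrary: f vs)
  case 0
  then obtain v where "vs = [v]" by (metis length_Suc_conv length_0_conv)
  then show ?case using 0 by (simp add: a_minus_def Let_def)
next
  case (Suc n)
  obtain v ws where v: "vs = v # ws" "length ws = Suc n" using Suc.prems(2) by (metis length_Suc_conv)
  let ?t = "\<lambda>g ws i. let u = take i ws @ drop (Suc i) ws in if even i then g u else \<ominus> g u"
  have "(\<Oplus>i\<in>{..Suc n}. ?t f vs i) = (\<Oplus>i\<in>{..n}. ?t f vs (Suc i)) \<oplus> ?t f vs 0"
    using Suc.prems(1) by (intro K.finsum_Suc2) (auto simp: Let_def)
  also have "(\<Oplus>i\<in>{..n}. ?t f vs (Suc i)) = (\<Oplus>i\<in>{..n}. \<ominus> ?t (\<lambda>u. f (v # u)) ws i)"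
    using Suc.prems(1) by (intro K.finsum_cong') (auto simp: Let_def v)
  also have "\<dots> = \<ominus> (\<Oplus>i\<in>{..n}. ?t (\<lambda>u. f (v # u)) ws i)"
  proof -
    have "(\<Oplus>i\<in>A. \<ominus> t i) = \<ominus> (\<Oplus>i\<in>A. t i)"
      if "finite A" "\<And>i. t i \<in> carrier K" for A and t :: "nat \<Rightarrow> 'k"
      using that by (induction A rule: finite_induct) (simp_all add: K.minus_add)
    then show ?thesis using Suc.prems(1) by (simp add: Let_def)
  qed
  also have "(\<Oplus>i\<in>{..n}. ?t (\<lambda>u. f (v # u)) ws i) = cobd K (\<lambda>u. f (v # u)) ws"
    by (rule Suc.IH[symmetric]) (use Suc.prems v in auto)
  also have "\<ominus> cobd K (\<lambda>u. f (v # u)) ws \<oplus> ?t f vs 0 = cobd K f vs"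
    using Suc.prems(1) by (simp add: v a_minus_def K.a_ac cobd_closed)
  finally show ?case ..
qed

lemma alternating_minus:
  "alternating K f \<Longrightarrow> alternating K g \<Longrightarrow> alternating K (\<lambda>u. f u \<ominus> g u)"
  unfolding alternating_def[of K "\<lambda>u. f u \<ominus> g u"]
proof (intro conjI allI)
  assume f: "alternating K f" and g: "alternating K g"
  note c = alternatingD(1)[OF f] alternatingD(1)[OF g]
  show "f vs \<ominus> g vs \<in> carrier K" for vs using c by simp
  show "f (xs @ a # b # ys) \<ominus> g (xs @ a # b # ys) =
      \<ominus> (f (xs @ b # a # ys) \<ominus> g (xs @ b # a # ys))" for xs a b ys
    unfolding alternatingD(2)[OF f, of xs a b] alternatingD(2)[OF g, of xs a b]
    using c by (simp add: a_minus_def K.minus_add)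
qed

text \<open>An entry moves to the right at the cost of a sign per step, and signs do not affect
  vanishing.\<close>

lemma alternating_move:
  assumes "alternating K f" "f (v # xs @ ys) = \<zero>"
  shows "f (xs @ v # ys) = \<zero>"
  using assms(2)
proof (induction xs arbitrary: ys rule: rev_induct)
  case (snoc a xs)
  have "f (xs @ v # a # ys) = \<zero>" using snoc by simp
  then have "f (xs @ a # v # ys) = \<zero>" unfolding alternatingD(2)[OF assms(1), of xs a v ys] by simp
  then show ?case by simp
qed simp

lemma alternating_swap:
  assumes "alternating K f"
  shows "f (xs @ a # ys @ b # zs) = \<ominus> f (xs @ b # ys @ a # zs)"
proof (induction ys arbitrary: xs)
  case Nil
  show ?case unfolding append_Nil by (rule alternatingD(2)[OF assms])
next
  case (Cons c ys)
  \<comment> \<open>Three sign changes: \<open>a\<close> passes \<open>c\<close>, then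
    \<open>a\<close> and \<open>b\<close> are exchanged across the shorter list \<open>ys\<close>,
    then \<open>b\<close> passes \<open>c\<close>.\<close>
  have "f (xs @ a # c # ys @ b # zs) = \<ominus> f ((xs @ [c]) @ a # ys @ b # zs)"
    unfolding append_assoc append_Cons append_Nil by (rule alternatingD(2)[OF assms])
  also have "\<dots> = f (xs @ c # b # ys @ a # zs)"
    unfolding Cons.IH using alternatingD(1)[OF assms] by simp
  also have "\<dots> = \<ominus> f (xs @ b # c # ys @ a # zs)" by (rule alternatingD(2)[OF assms])
  finally show ?case by simp
qed

section \<open>From adjacent swaps to all permutations; comparison with the simplicial
  cochains\<close>

lemma permute_list_transpose:
  assumes "i < j" "j < length vs"
  obtains xs a ys b zs where "vs = xs @ a # ys @ b # zs"
    "permute_list (transpose i j) vs = xs @ b # ys @ a # zs"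
proof -
  define xs where "xs = take i vs"
  define ys where "ys = take (j - Suc i) (drop (Suc i) vs)"
  define zs where "zs = drop (Suc j) vs"
  have vs: "vs = xs @ vs ! i # ys @ vs ! j # zs"
  proof -
    have "vs = xs @ vs ! i # drop (Suc i) vs" using assms by (simp add: xs_def id_take_nth_drop)
    also have "drop (Suc i) vs = ys @ drop j vs"
      using assms append_take_drop_id[of "j - Suc i" "drop (Suc i) vs"] by (simp add: ys_def)
    also have "drop j vs = vs ! j # zs" using assms by (simp add: zs_def Cons_nth_drop_Suc)
    finally show ?thesis .
  qed
  have len: "length xs = i" "length ys = j - Suc i" using assms by (auto simp: xs_def ys_def)
  have "permute_list (transpose i j) vs = xs @ vs ! j # ys @ vs ! i # zs"
  proof (rule nth_equalityI)
    have l: "length vs = length xs + Suc (length ys + Suc (length zs))" by (subst vs) simp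
    then show "length (permute_list (transpose i j) vs) = length (xs @ vs ! j # ys @ vs ! i # zs)" by simp
    fix k assume "k < length (permute_list (transpose i j) vs)"
    then have k: "k < length vs" by simp
    have p: "transpose i j permutes {..<length vs}" using assms by (intro permutes_swap_id) auto
    have n: "permute_list (transpose i j) vs ! k = vs ! transpose i j k"
      by (rule permute_list_nth[OF p k])
    have vk: "vs ! k = (xs @ vs ! i # ys @ vs ! j # zs) ! k" using vs by metis
    show "permute_list (transpose i j) vs ! k = (xs @ vs ! j # ys @ vs ! i # zs) ! k"
    proof (cases "k = i \<or> k = j")
      case True
      then show ?thesis using n len assms
        by (auto simp: nth_append nth_Cons')
    next
      case False
      then have "transpose i j k = k" by (simp add: transpose_def)
      then show ?thesis using n vk len assms False
        by (auto simp: nth_append nth_Cons')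
    qed
  qed
  with vs that show ?thesis by blast
qed

text \<open>\<open>cochain_module\<close> demands the sign rule for all permutations,
  \<open>alternating\<close> only for adjacent swaps. Transpositions generate the permutations, and
  each of them exchanges two entries at the cost of one sign.\<close>

lemma alternating_permute:
  assumes f: "alternating K f" and \<sigma>: "\<sigma> permutes {..<n}" and vs: "length vs = n"
  shows "f (permute_list \<sigma> vs) = (if evenperm \<sigma> then f vs else \<ominus> f vs)"
  using \<sigma> vs
proof (induction \<sigma> arbitrary: vs rule: permutes_induct[of _ "{..<n}", consumes 1, case_names fin id swap])
  case id
  then show ?case by simp
next
  case (swap i j p)
  have tr: "transpose i j permutes {..<length vs}" using swap by (intro permutes_swap_id) auto
  have "f (permute_list (transpose i j \<circ> p) vs) = f (permute_list p (permute_list (transpose i j) vs))"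
    using swap by (subst permute_list_compose) auto
  also have "\<dots> = (if evenperm p then f (permute_list (transpose i j) vs) else \<ominus> f (permute_list (transpose i j) vs))"
    using swap by simp
  also have "f (permute_list (transpose i j) vs) = \<ominus> f vs"
  proof -
    have *: "f (permute_list (transpose i j) vs) = \<ominus> f vs" if ij: "i < j" "j < length vs" for i j
    proof -
      obtain xs a ys b zs where *: "vs = xs @ a # ys @ b # zs"
        "permute_list (transpose i j) vs = xs @ b # ys @ a # zs"
        using permute_list_transpose[OF ij] .
      show ?thesis unfolding *(2) unfolding *(1) by (rule alternating_swap[OF f])
    qed
    show ?thesis
    proof (cases "i < j")
      case True
      then show ?thesis using * swap by simp
    next
      case False
      then have "j < i" using swap by simp
      then show ?thesis using *[of j i] swap by (simp add: transpose_commute)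
    qed
  qed
  also have "(if evenperm p then \<ominus> f vs else \<ominus> (\<ominus> f vs)) =
      (if evenperm (transpose i j \<circ> p) then f vs else \<ominus> f vs)"
  proof -
    have "permutation p" using swap by (auto simp: permutation_permutes)
    then have "evenperm (transpose i j \<circ> p) = (\<not> evenperm p)"
      using swap by (simp add: evenperm_comp permutation_swap_id evenperm_swap)
    then show ?thesis using alternatingD(1)[OF f] by simp
  qed
  finally show ?case .
qed simp

text \<open>The converse of \<open>cochain_restrict\<close>: the sign rule comes from the odd
  permutations that exchange two neighbours.\<close>

lemma cochain_extend:
  assumes f: "f \<in> carrier (cochain_module K X n)"
  shows "(\<lambda>vs. if vs \<in> ordered_simplices X n then f vs else \<zero>) \<in> alt_cochains K X n"
proof -
  have fK: "\<And>vs. vs \<in> ordered_simplices X n \<Longrightarrow> f vs \<in> carrier K"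
    and fp: "\<And>vs \<sigma>. vs \<in> ordered_simplices X n \<Longrightarrow> \<sigma> permutes {..<n} \<Longrightarrow>
      f (permute_list \<sigma> vs) = (if evenperm \<sigma> then f vs else \<ominus> f vs)"
    using f by (auto simp: cochain_module_def)
  have "f (xs @ a # b # ys) = \<ominus> f (xs @ b # a # ys)" if m: "xs @ b # a # ys \<in> ordered_simplices X n" for xs a b ys
  proof -
    let ?\<sigma> = "transpose (length xs) (Suc (length xs))" and ?vs = "xs @ b # a # ys"
    have n: "length ?vs = n" using m by (simp add: ordered_simplices_def)
    have p: "?\<sigma> permutes {..<length ?vs}" by (rule permutes_swap_id) auto
    have "permute_list ?\<sigma> ?vs = xs @ a # b # ys"
    proof (rule nth_equalityI)
      fix k assume "k < length (permute_list ?\<sigma> ?vs)"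
      then show "permute_list ?\<sigma> ?vs ! k = (xs @ a # b # ys) ! k"
        using permute_list_nth[OF p, of k]
        by (auto simp: nth_append transpose_def nth_Cons' split: if_splits)
    qed simp
    moreover have "\<not> evenperm ?\<sigma>" by (simp add: evenperm_swap)
    ultimately show ?thesis using fp[OF m] p n by metis
  qed
  note sw = this
  show ?thesis unfolding alt_cochains_def alternating_def
  proof (intro CollectI conjI allI impI)
    fix xs a b ys
    show "(if xs @ a # b # ys \<in> ordered_simplices X n then f (xs @ a # b # ys) else \<zero>) =
        \<ominus> (if xs @ b # a # ys \<in> ordered_simplices X n then f (xs @ b # a # ys) else \<zero>)"
    proof (cases "xs @ b # a # ys \<in> ordered_simplices X n")
      case True
      then have True': "xs @ a # b # ys \<in> ordered_simplices X n" by (simp add: ordered_simplices_swap)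
      show ?thesis unfolding if_P[OF True] if_P[OF True'] by (rule sw[OF True])
    next
      case False
      then show ?thesis using ordered_simplices_swap[of xs a b ys X n] by simp
    qed
  qed (simp_all add: fK)
qed

lemma cochain_restrict:
  assumes f: "f \<in> alt_cochains K X n"
  shows "restrict f (ordered_simplices X n) \<in> carrier (cochain_module K X n)"
proof -
  note a = alt_cochainsD(1)[OF f]
  have "permute_list \<sigma> vs \<in> ordered_simplices X n" if "vs \<in> ordered_simplices X n" "\<sigma> permutes {..<n}" for vs \<sigma>
    using that by (auto simp: ordered_simplices_def)
  then show ?thesis
    using alternating_permute[OF a] alternatingD(1)[OF a]
    by (auto simp: cochain_module_def ordered_simplices_def)
qed

lemma simplicial_coboundary_eq:
  assumes down: "\<forall>S\<in>X. Pow S \<subseteq> X" and g: "\<And>vs. g vs \<in> carrier K"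
    and eq: "\<And>vs. vs \<in> ordered_simplices X n \<Longrightarrow> f vs = g vs"
  shows "simplicial_coboundary K X n f = restrict (cobd K g) (ordered_simplices X (Suc n))"
proof -
  have "(\<Oplus>i\<in>{..n}. let u = take i vs @ drop (Suc i) vs in if even i then f u else \<ominus> f u) = cobd K g vs"
    if vs: "vs \<in> ordered_simplices X (Suc n)" for vs
  proof -
    have len: "length vs = Suc n" using vs by (simp add: ordered_simplices_def)
    show ?thesis unfolding cobd_eq_finsum[OF g len]
    proof (rule K.finsum_cong')
      fix i assume "i \<in> {..n}"
      then have "vs = take i vs @ vs ! i # drop (Suc i) vs" using len by (simp add: id_take_nth_drop)
      then have "take i vs @ drop (Suc i) vs \<in> ordered_simplices X n"
        using ordered_simplices_face[OF down] vs by metis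
      then show "(let u = take i vs @ drop (Suc i) vs in if even i then f u else \<ominus> f u) =
         (let u = take i vs @ drop (Suc i) vs in if even i then g u else \<ominus> g u)"
        by (simp add: eq Let_def)
    qed (simp_all add: Let_def g)
  qed
  then show ?thesis by (auto simp: simplicial_coboundary_def restrict_def fun_eq_iff)
qed

lemma cobd_on_closed:
  assumes "f \<in> alt_cochains K X n"
  shows "cobd_on K X n f \<in> alt_cochains K X (Suc n)"
  unfolding alt_cochains_def alternating_def
proof (intro CollectI conjI allI impI)
  note a = cobd_alternating[OF alt_cochainsD(1)[OF assms]]
  show "cobd_on K X n f vs \<in> carrier K" for vs using alternatingD(1)[OF a] by (simp add: cobd_on_def)
  show "cobd_on K X n f (xs @ x # y # ys) = \<ominus> cobd_on K X n f (xs @ y # x # ys)" for xs x y ys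
    unfolding cobd_on_def ordered_simplices_swap[of xs x y]
    using alternatingD(2)[OF a, of xs x y ys] by simp
qed (simp add: cobd_on_def)

text \<open>The cutoff in \<open>cobd_on\<close> is invisible here, since all faces of a simplex are
  simplices.\<close>

lemma cobd_cobd_on:
  assumes down: "\<forall>S\<in>X. Pow S \<subseteq> X" and "f \<in> alt_cochains K X n"
    and vs: "vs \<in> ordered_simplices X (Suc (Suc n))"
  shows "cobd K (cobd_on K X n f) vs = \<zero>"
proof -
  have "cobd K (cobd_on K X n f) vs = cobd K (cobd K f) vs"
    by (rule cobd_cong) (use vs ordered_simplices_face[OF down] in \<open>auto simp: cobd_on_def\<close>)
  then show ?thesis using cobd_cobd[OF alternatingD(1)[OF alt_cochainsD(1)[OF assms(2)]]] by simp
qed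

text \<open>Inserting the vertex \<open>v\<close> in front is a contracting homotopy.\<close>

lemma simplex_acyclic:
  assumes f: "f \<in> alt_cochains K (Pow T) (Suc n)" and v: "v \<in> T"
    and cocycle: "\<And>vs. vs \<in> ordered_simplices (Pow T) (Suc (Suc n)) \<Longrightarrow> cobd K f vs = \<zero>"
  shows "(\<lambda>u. f (v # u)) \<in> alt_cochains K (Pow T) n" "cobd_on K (Pow T) n (\<lambda>u. f (v # u)) = f"
proof -
  let ?g = "\<lambda>u. f (v # u)"
  note a = alt_cochainsD(1)[OF f] and fz = alt_cochainsD(2)[OF f]
  note fK = alternatingD(1)[OF a]
  have gz: "?g u = \<zero>" if "u \<notin> ordered_simplices (Pow T) n" for u
    using that by (intro fz) (auto simp: ordered_simplices_def)
  then show g: "?g \<in> alt_cochains K (Pow T) n"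
    using alternating_Cons[OF a] by (simp add: alt_cochains_def)
  note ag = alt_cochainsD(1)[OF g]
  have gK: "cobd K ?g vs \<in> carrier K" for vs by (rule cobd_closed) (rule fK)
  have eq: "f vs \<ominus> cobd K ?g vs = \<zero>" if vs: "vs \<in> ordered_simplices (Pow T) (Suc n)" for vs
  proof (cases "v \<in> set vs")
    case False
    then have "v # vs \<in> ordered_simplices (Pow T) (Suc (Suc n))" using vs v by (auto simp: ordered_simplices_def)
    from cocycle[OF this] show ?thesis by simp
  next
    case True
    \<comment> \<open>The function \<open>f\<close> minus \<open>cobd\<close> of \<open>?g\<close>
      is alternating, so \<open>v\<close> may be moved to the front. There \<open>cobd\<close> of
      \<open>?g\<close> begins with \<open>f (v # xs @ ys)\<close>, and its other terms contain
      \<open>v\<close> twice and vanish.\<close>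
    then obtain xs ys where vs': "vs = xs @ v # ys" by (meson split_list)
    have z: "f (v # v # u) = \<zero>" for u by (rule fz) (simp add: ordered_simplices_def)
    have "alternating K (\<lambda>u. f u \<ominus> cobd K ?g u)"
      by (rule alternating_minus[OF a cobd_alternating[OF ag]])
    moreover have "f (v # xs @ ys) \<ominus> cobd K ?g (v # xs @ ys) = \<zero>"
      using fK by (simp add: cobd_zero[of "\<lambda>u. f (v # v # u)", OF z] a_minus_def K.r_neg)
    ultimately show ?thesis unfolding vs' by (rule alternating_move)
  qed
  show "cobd_on K (Pow T) n ?g = f"
  proof
    show "cobd_on K (Pow T) n ?g vs = f vs" for vs
    proof (cases "vs \<in> ordered_simplices (Pow T) (Suc n)")
      case True
      have "f vs = (f vs \<ominus> cobd K ?g vs) \<oplus> cobd K ?g vs"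
        using fK gK by (simp add: a_minus_def K.a_assoc K.l_neg)
      then show ?thesis using eq[OF True] gK True by (simp add: cobd_on_def)
    qed (simp add: cobd_on_def fz)
  qed
qed

lemma cochain_module_left_module: "left_module K (cochain_module K X n)"
proof -
  have m: "\<And>f vs. f \<in> carrier (cochain_module K X n) \<Longrightarrow> vs \<in> ordered_simplices X n \<Longrightarrow> f vs \<in> carrier K"
    by (auto simp: cochain_module_def)
  have ext: "f vs = undefined" if "f \<in> carrier (cochain_module K X n)" "vs \<notin> ordered_simplices X n" for f vs
    using that by (auto simp: cochain_module_def PiE_def extensional_def)
  have perm: "permute_list \<sigma> vs \<in> ordered_simplices X n" if "vs \<in> ordered_simplices X n" "\<sigma> permutes {..<n}" for vs \<sigma>
    using that by (auto simp: ordered_simplices_def)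
  show ?thesis
  proof (rule left_moduleI[OF K.ring_axioms])
    show "\<zero>\<^bsub>cochain_module K X n\<^esub> \<in> carrier (cochain_module K X n)" using perm by (simp add: cochain_module_def)
    fix f g assume f: "f \<in> carrier (cochain_module K X n)" and g: "g \<in> carrier (cochain_module K X n)"
    show "f \<oplus>\<^bsub>cochain_module K X n\<^esub> g \<in> carrier (cochain_module K X n)"
      using f g perm m[OF f] m[OF g] by (auto simp: cochain_module_def K.minus_add)
    show "f \<oplus>\<^bsub>cochain_module K X n\<^esub> g = g \<oplus>\<^bsub>cochain_module K X n\<^esub> f"
      using m[OF f] m[OF g] by (auto simp: cochain_module_def fun_eq_iff K.a_comm)
    show "r \<odot>\<^bsub>cochain_module K X n\<^esub> (f \<oplus>\<^bsub>cochain_module K X n\<^esub> g) =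
      r \<odot>\<^bsub>cochain_module K X n\<^esub> f \<oplus>\<^bsub>cochain_module K X n\<^esub> r \<odot>\<^bsub>cochain_module K X n\<^esub> g" if "r \<in> carrier K" for r
      using m[OF f] m[OF g] that by (auto simp: cochain_module_def fun_eq_iff K.r_distr)
    fix h assume h: "h \<in> carrier (cochain_module K X n)"
    show "(f \<oplus>\<^bsub>cochain_module K X n\<^esub> g) \<oplus>\<^bsub>cochain_module K X n\<^esub> h =
      f \<oplus>\<^bsub>cochain_module K X n\<^esub> (g \<oplus>\<^bsub>cochain_module K X n\<^esub> h)"
      using m[OF f] m[OF g] m[OF h] by (auto simp: cochain_module_def fun_eq_iff K.a_assoc)
  next
    fix f assume f: "f \<in> carrier (cochain_module K X n)"
    show "\<zero>\<^bsub>cochain_module K X n\<^esub> \<oplus>\<^bsub>cochain_module K X n\<^esub> f = f"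
      using m[OF f] ext[OF f] by (auto simp: cochain_module_def fun_eq_iff restrict_def)
    show "\<one> \<odot>\<^bsub>cochain_module K X n\<^esub> f = f"
      using m[OF f] ext[OF f] by (auto simp: cochain_module_def fun_eq_iff restrict_def)
    show "\<zero> \<odot>\<^bsub>cochain_module K X n\<^esub> f = \<zero>\<^bsub>cochain_module K X n\<^esub>"
      using m[OF f] by (auto simp: cochain_module_def fun_eq_iff restrict_def)
    fix r assume r: "r \<in> carrier K"
    show "r \<odot>\<^bsub>cochain_module K X n\<^esub> f \<in> carrier (cochain_module K X n)"
      using f r perm m[OF f] by (auto simp: cochain_module_def K.r_minus)
    fix s assume s: "s \<in> carrier K"
    show "(r \<oplus> s) \<odot>\<^bsub>cochain_module K X n\<^esub> f =
        r \<odot>\<^bsub>cochain_module K X n\<^esub> f \<oplus>\<^bsub>cochain_module K X n\<^esub> s \<odot>\<^bsub>cochain_module K X n\<^esub> f"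
      using m[OF f] r s by (auto simp: cochain_module_def fun_eq_iff K.l_distr)
    show "(r \<otimes> s) \<odot>\<^bsub>cochain_module K X n\<^esub> f = r \<odot>\<^bsub>cochain_module K X n\<^esub> (s \<odot>\<^bsub>cochain_module K X n\<^esub> f)"
      using m[OF f] r s by (auto simp: cochain_module_def fun_eq_iff K.m_assoc)
  qed
qed

end

section \<open>A coresolution of the content module\<close>

locale lrb_coefficients = lrb_pair V E W + K: cring K
  for V :: "'v set" and E :: "'v set set" and W :: "'v set" and K :: "('k, 'z) ring_scheme" (structure)
begin

abbreviation "AA \<equiv> lrb_algebra K V E"

abbreviation "simplices x n \<equiv> ordered_simplices (Pow (tops x)) n"

text \<open>The module \<open>cores n\<close> stands for the alternating part of the product, over ordered
  cliques \<open>vs\<close> of size \<open>n\<close> in \<open>V - W\<close>, of the duals of the right modules spanned by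
  \<open>clique_elt (set vs) B\<close>. Functions are total with value zero outside this domain.\<close>

definition cores_set :: "nat \<Rightarrow> ('v list set \<times> 'v list \<Rightarrow> 'k) set" where
  "cores_set n = {\<phi>. (\<forall>x\<in>ideal. (\<lambda>vs. \<phi> (x, vs)) \<in> alt_cochains K (Pow (tops x)) n) \<and>
     (\<forall>x vs. x \<notin> ideal \<longrightarrow> \<phi> (x, vs) = \<zero>)}"

definition cores :: "nat \<Rightarrow> ('v list set \<Rightarrow> 'k, 'v list set \<times> 'v list \<Rightarrow> 'k) module" where
  "cores n = mk_module (cores_set n) (\<lambda>_. \<zero>) (\<lambda>\<phi> \<psi> y. \<phi> y \<oplus> \<psi> y)
     (\<lambda>f \<phi> (x, vs). if x \<in> ideal \<and> vs \<in> simplices x n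
        then pairing K f (\<lambda>b. \<phi> (x \<cdot> b, vs)) else \<zero>)"

definition cores_d :: "nat \<Rightarrow> ('v list set \<times> 'v list \<Rightarrow> 'k) \<Rightarrow> 'v list set \<times> 'v list \<Rightarrow> 'k" where
  "cores_d n = (\<lambda>\<phi>\<in>cores_set n. \<lambda>(x, vs). if x \<in> ideal
     then cobd_on K (Pow (tops x)) n (\<lambda>u. \<phi> (x, u)) vs else \<zero>)"

definition cores_aug :: "'k \<Rightarrow> 'v list set \<times> 'v list \<Rightarrow> 'k" where
  "cores_aug = (\<lambda>t\<in>carrier K. \<lambda>(x, vs). if x = base \<and> vs = [] then t else \<zero>)"

lemmas Kc = K.is_cring
lemmas Bm = free_pc_lrb_monoid[of V E]

sublocale A: central_algebra K AA by (rule monoid_algebra_central[OF Kc Bm])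

text \<open>Right translation can only enlarge \<open>tops\<close>, so a list admissible at
  \<open>x\<close> stays admissible at \<open>x \<cdot> b\<close>. New lists may become admissible
  at \<open>x \<cdot> b\<close>, whence the cutoff in the action of \<open>cores\<close>.\<close>

lemma simplices_mult:
  assumes "x \<in> ideal" "b \<in> carrier LRB" "vs \<in> simplices x n"
  shows "vs \<in> simplices (x \<cdot> b) n"
  using tops_mult[OF ideal_closed[OF assms(1)] assms(2)] assms(3) by (auto simp: ordered_simplices_def)

lemma cores_setD:
  assumes "\<phi> \<in> cores_set n"
  shows "\<phi> y \<in> carrier K" "x \<in> ideal \<Longrightarrow> (\<lambda>vs. \<phi> (x, vs)) \<in> alt_cochains K (Pow (tops x)) n"
    "x \<notin> ideal \<Longrightarrow> \<phi> (x, vs) = \<zero>" "vs \<notin> simplices x n \<Longrightarrow> \<phi> (x, vs) = \<zero>"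
proof -
  show 1: "x \<in> ideal \<Longrightarrow> (\<lambda>vs. \<phi> (x, vs)) \<in> alt_cochains K (Pow (tops x)) n"
    and 2: "x \<notin> ideal \<Longrightarrow> \<phi> (x, vs) = \<zero>" for x vs
    using assms by (simp_all add: cores_set_def)
  show "vs \<notin> simplices x n \<Longrightarrow> \<phi> (x, vs) = \<zero>"
    using alt_cochainsD(2)[OF 1] 2 by (cases "x \<in> ideal") auto
  show "\<phi> y \<in> carrier K"
  proof (cases y)
    case (Pair x vs)
    then show ?thesis using alternatingD(1)[OF alt_cochainsD(1)[OF 1]] 2 by (cases "x \<in> ideal") auto
  qed
qed

lemma cores_set_swap:
  assumes "\<phi> \<in> cores_set n" "x \<in> ideal"
  shows "\<phi> (x, xs @ a # b # ys) = \<ominus> \<phi> (x, xs @ b # a # ys)"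
  using alternatingD(2)[OF alt_cochainsD(1)[OF cores_setD(2)[OF assms]]] .

lemma cores_setI:
  assumes "\<And>x vs. \<phi> (x, vs) \<in> carrier K"
    "\<And>x vs. \<not> (x \<in> ideal \<and> vs \<in> simplices x n) \<Longrightarrow> \<phi> (x, vs) = \<zero>"
    "\<And>x xs a b ys. x \<in> ideal \<Longrightarrow> xs @ a # b # ys \<in> simplices x n \<Longrightarrow> xs @ b # a # ys \<in> simplices x n \<Longrightarrow>
      \<phi> (x, xs @ a # b # ys) = \<ominus> \<phi> (x, xs @ b # a # ys)"
  shows "\<phi> \<in> cores_set n"
proof -
  have "(\<lambda>vs. \<phi> (x, vs)) \<in> alt_cochains K (Pow (tops x)) n" if x: "x \<in> ideal" for x
    unfolding alt_cochains_def alternating_def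
  proof (intro CollectI conjI allI impI)
    fix xs a b ys
    show "\<phi> (x, xs @ a # b # ys) = \<ominus> \<phi> (x, xs @ b # a # ys)"
    proof (cases "xs @ a # b # ys \<in> simplices x n")
      case True
      then show ?thesis using ordered_simplices_swap[of xs a b ys] by (intro assms(3)[OF x]) blast+
    next
      case False
      then have "xs @ b # a # ys \<notin> simplices x n" using ordered_simplices_swap[of xs a b ys] by blast
      then show ?thesis using False assms(2)[of x] by simp
    qed
  qed (use x assms(1,2) in auto)
  then show ?thesis using assms(2) by (simp add: cores_set_def)
qed

lemma cores_simps:
  "carrier (cores n) = cores_set n" "\<zero>\<^bsub>cores n\<^esub> = (\<lambda>_. \<zero>)"
  "\<phi> \<oplus>\<^bsub>cores n\<^esub> \<psi> = (\<lambda>y. \<phi> y \<oplus> \<psi> y)"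
  by (simp_all add: cores_def)

lemma cores_smult:
  "(f \<odot>\<^bsub>cores n\<^esub> \<phi>) (x, vs) = (if x \<in> ideal \<and> vs \<in> simplices x n
     then pairing K f (\<lambda>b. \<phi> (x \<cdot> b, vs)) else \<zero>)"
  by (simp add: cores_def)

text \<open>Right translation of points is a left action on functions. In the associativity law the
  cutoff at the translated point is met by \<open>simplices_mult\<close>.\<close>

lemma cores_left_module: "left_module AA (cores n)"
proof (rule left_moduleI[OF A.A.ring_axioms]; (unfold cores_simps)?)
  note P = Kc Bm
  show "(\<lambda>_. \<zero>) \<in> cores_set n" by (rule cores_setI) simp_all
  fix \<phi> assume \<phi>: "\<phi> \<in> cores_set n"
  note \<phi>K = cores_setD(1)[OF \<phi>]
  show "(\<lambda>y. \<zero> \<oplus> \<phi> y) = \<phi>" using \<phi>K by simp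
  show "\<one>\<^bsub>AA\<^esub> \<odot>\<^bsub>cores n\<^esub> \<phi> = \<phi>"
  proof
    show "(\<one>\<^bsub>AA\<^esub> \<odot>\<^bsub>cores n\<^esub> \<phi>) y = \<phi> y" for y
      using cores_setD(3,4)[OF \<phi>] pairing_one[OF P, of "\<lambda>b. \<phi> (fst y \<cdot> b, snd y)", OF \<phi>K]
      by (cases y) (auto simp: cores_smult ideal_closed)
  qed
  show "\<zero>\<^bsub>AA\<^esub> \<odot>\<^bsub>cores n\<^esub> \<phi> = (\<lambda>_. \<zero>)"
  proof -
    have "{b. \<zero>\<^bsub>AA\<^esub> b \<noteq> \<zero>} = {}" by (simp add: monoid_algebra_def)
    then have "pairing K \<zero>\<^bsub>AA\<^esub> c = \<zero>" for c unfolding pairing_def[OF P] by simp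
    then show ?thesis by (simp add: fun_eq_iff cores_smult)
  qed
  fix f assume f: "f \<in> carrier AA"
  show fc: "f \<odot>\<^bsub>cores n\<^esub> \<phi> \<in> cores_set n"
  proof (rule cores_setI)
    fix x xs a b ys assume x: "x \<in> ideal" and S: "xs @ a # b # ys \<in> simplices x n" "xs @ b # a # ys \<in> simplices x n"
    \<comment> \<open>The sign is written as the right factor \<open>\<ominus> \<one>\<close>, so
      that it can be pulled out of the pairing.\<close>
    have "pairing K f (\<lambda>c. \<phi> (x \<cdot> c, xs @ a # b # ys))
        = pairing K f (\<lambda>c. \<phi> (x \<cdot> c, xs @ b # a # ys) \<otimes> (\<ominus> \<one>))"
    proof (rule pairing_cong[OF P f])
      fix c assume c: "c \<in> carrier LRB"
      show "\<phi> (x \<cdot> c, xs @ a # b # ys) = \<phi> (x \<cdot> c, xs @ b # a # ys) \<otimes> (\<ominus> \<one>)"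
        unfolding cores_set_swap[OF \<phi> ideal_mult[OF x c], of xs a b ys]
          using \<phi>K[of "(x \<cdot> c, xs @ b # a # ys)"] by (simp add: K.r_minus)
    qed (use \<phi>K in simp)
    also have "\<dots> = pairing K f (\<lambda>c. \<phi> (x \<cdot> c, xs @ b # a # ys)) \<otimes> (\<ominus> \<one>)"
      by (rule pairing_smult_right[OF P f]) (simp_all add: \<phi>K)
    also have "\<dots> = \<ominus> pairing K f (\<lambda>c. \<phi> (x \<cdot> c, xs @ b # a # ys))"
      using pairing_closed[OF P f, of "\<lambda>c. \<phi> (x \<cdot> c, xs @ b # a # ys)", OF \<phi>K] by (simp add: K.r_minus)
    finally show "(f \<odot>\<^bsub>cores n\<^esub> \<phi>) (x, xs @ a # b # ys) = \<ominus> (f \<odot>\<^bsub>cores n\<^esub> \<phi>) (x, xs @ b # a # ys)"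
      using x S by (simp add: cores_smult)
  next
    show "(f \<odot>\<^bsub>cores n\<^esub> \<phi>) (x, vs) \<in> carrier K" for x vs
      unfolding cores_smult using pairing_closed[OF P f, of "\<lambda>b. \<phi> (x \<cdot> b, vs)", OF \<phi>K] by simp
  qed (auto simp: cores_smult)
  fix g assume g: "g \<in> carrier AA"
  show "(f \<oplus>\<^bsub>AA\<^esub> g) \<odot>\<^bsub>cores n\<^esub> \<phi> = (\<lambda>y. (f \<odot>\<^bsub>cores n\<^esub> \<phi>) y \<oplus> (g \<odot>\<^bsub>cores n\<^esub> \<phi>) y)"
  proof
    show "((f \<oplus>\<^bsub>AA\<^esub> g) \<odot>\<^bsub>cores n\<^esub> \<phi>) y = (f \<odot>\<^bsub>cores n\<^esub> \<phi>) y \<oplus> (g \<odot>\<^bsub>cores n\<^esub> \<phi>) y" for y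
      using pairing_add[OF P f g, of "\<lambda>b. \<phi> (fst y \<cdot> b, snd y)", OF \<phi>K]
      by (cases y) (simp add: cores_smult)
  qed
  show "(f \<otimes>\<^bsub>AA\<^esub> g) \<odot>\<^bsub>cores n\<^esub> \<phi> = f \<odot>\<^bsub>cores n\<^esub> (g \<odot>\<^bsub>cores n\<^esub> \<phi>)"
  proof
    fix y :: "'v list set \<times> 'v list"
    obtain x vs where y: "y = (x, vs)" by (cases y)
    have "pairing K (f \<otimes>\<^bsub>AA\<^esub> g) (\<lambda>b. \<phi> (x \<cdot> b, vs))
        = pairing K f (\<lambda>b. (g \<odot>\<^bsub>cores n\<^esub> \<phi>) (x \<cdot> b, vs))" if x: "x \<in> ideal" and vs: "vs \<in> simplices x n"
    proof -
      have "pairing K (f \<otimes>\<^bsub>AA\<^esub> g) (\<lambda>b. \<phi> (x \<cdot> b, vs))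
        = pairing K f (\<lambda>b. pairing K g (\<lambda>c. \<phi> (x \<cdot> (b \<cdot> c), vs)))"
        by (rule pairing_mult[OF P f g \<phi>K])
      also have "\<dots> = pairing K f (\<lambda>b. (g \<odot>\<^bsub>cores n\<^esub> \<phi>) (x \<cdot> b, vs))"
      proof (rule pairing_cong[OF P f])
        fix b assume b: "b \<in> carrier LRB"
        have "pairing K g (\<lambda>c. \<phi> (x \<cdot> (b \<cdot> c), vs)) =
          pairing K g (\<lambda>c. \<phi> ((x \<cdot> b) \<cdot> c, vs))"
          by (rule pairing_cong[OF P g]) (simp_all add: B.m_assoc ideal_closed[OF x] b \<phi>K)
        then show "pairing K g (\<lambda>c. \<phi> (x \<cdot> (b \<cdot> c), vs)) = (g \<odot>\<^bsub>cores n\<^esub> \<phi>) (x \<cdot> b, vs)"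
          using ideal_mult[OF x b] simplices_mult[OF x b vs] by (simp add: cores_smult)
      next
        show "(g \<odot>\<^bsub>cores n\<^esub> \<phi>) (x \<cdot> b, vs) \<in> carrier K" for b
          unfolding cores_smult
          using pairing_closed[OF P g, of "\<lambda>c. \<phi> ((x \<cdot> b) \<cdot> c, vs)", OF \<phi>K] by simp
      qed
      finally show ?thesis .
    qed
    then show "((f \<otimes>\<^bsub>AA\<^esub> g) \<odot>\<^bsub>cores n\<^esub> \<phi>) y = (f \<odot>\<^bsub>cores n\<^esub> (g \<odot>\<^bsub>cores n\<^esub> \<phi>)) y"
      unfolding y cores_smult[of _ _ _ x vs] by simp
  qed
next
  note P = Kc Bm
  fix \<phi> \<psi> assume \<phi>: "\<phi> \<in> cores_set n" and \<psi>: "\<psi> \<in> cores_set n"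
  note \<phi>K = cores_setD(1)[OF \<phi>] and \<psi>K = cores_setD(1)[OF \<psi>]
  show "(\<lambda>y. \<phi> y \<oplus> \<psi> y) \<in> cores_set n"
  proof (rule cores_setI)
    fix x xs a b ys assume x: "x \<in> ideal"
    show "\<phi> (x, xs @ a # b # ys) \<oplus> \<psi> (x, xs @ a # b # ys) =
      \<ominus> (\<phi> (x, xs @ b # a # ys) \<oplus> \<psi> (x, xs @ b # a # ys))"
      unfolding cores_set_swap[OF \<phi> x, of xs a b ys] cores_set_swap[OF \<psi> x, of xs a b ys]
      using \<phi>K \<psi>K by (simp add: K.minus_add)
  qed (use \<phi>K \<psi>K cores_setD(3,4)[OF \<phi>] cores_setD(3,4)[OF \<psi>] in auto)
  show "(\<lambda>y. \<phi> y \<oplus> \<psi> y) = (\<lambda>y. \<psi> y \<oplus> \<phi> y)" using \<phi>K \<psi>K by (simp add: K.a_comm)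
  show "f \<odot>\<^bsub>cores n\<^esub> (\<lambda>y. \<phi> y \<oplus> \<psi> y) = (\<lambda>y. (f \<odot>\<^bsub>cores n\<^esub> \<phi>) y \<oplus> (f \<odot>\<^bsub>cores n\<^esub> \<psi>) y)"
    if f: "f \<in> carrier AA" for f
  proof
    show "(f \<odot>\<^bsub>cores n\<^esub> (\<lambda>y. \<phi> y \<oplus> \<psi> y)) y = (f \<odot>\<^bsub>cores n\<^esub> \<phi>) y \<oplus> (f \<odot>\<^bsub>cores n\<^esub> \<psi>) y" for y
      using pairing_add_right[OF P f, of "\<lambda>b. \<phi> (fst y \<cdot> b, snd y)" "\<lambda>b. \<psi> (fst y \<cdot> b, snd y)",
          OF \<phi>K \<psi>K]
      by (cases y) (simp add: cores_smult)
  qed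
  fix \<theta> assume \<theta>: "\<theta> \<in> cores_set n"
  note \<theta>K = cores_setD(1)[OF \<theta>]
  show "(\<lambda>y. \<phi> y \<oplus> \<psi> y \<oplus> \<theta> y) = (\<lambda>y. \<phi> y \<oplus> (\<psi> y \<oplus> \<theta> y))"
    using \<phi>K \<psi>K \<theta>K by (simp add: K.a_assoc)
qed

lemma cores_closed:
  assumes "\<phi> \<in> cores_set n"
  shows "\<psi> \<in> cores_set n \<Longrightarrow> (\<lambda>y. \<phi> y \<oplus> \<psi> y) \<in> cores_set n"
    and "f \<in> carrier AA \<Longrightarrow> f \<odot>\<^bsub>cores n\<^esub> \<phi> \<in> cores_set n"
proof -
  interpret C: left_module AA "cores n" by (rule cores_left_module)
  show "\<psi> \<in> cores_set n \<Longrightarrow> (\<lambda>y. \<phi> y \<oplus> \<psi> y) \<in> cores_set n"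
    using C.M.a_closed[of \<phi> \<psi>] assms by (simp add: cores_simps)
  show "f \<in> carrier AA \<Longrightarrow> f \<odot>\<^bsub>cores n\<^esub> \<phi> \<in> cores_set n"
    using C.smult_closed[of f \<phi>] assms by (simp add: cores_simps)
qed

lemma cores_eqI:
  assumes "\<phi> \<in> cores_set n" "\<psi> \<in> cores_set n"
    "\<And>x vs. x \<in> ideal \<Longrightarrow> vs \<in> simplices x n \<Longrightarrow> \<phi> (x, vs) = \<psi> (x, vs)"
  shows "\<phi> = \<psi>"
proof
  show "\<phi> y = \<psi> y" for y
    using assms(3) cores_setD(3,4)[OF assms(1)] cores_setD(3,4)[OF assms(2)] by (metis surj_pair)
qed

lemma cores_gen:
  assumes "\<phi> \<in> cores_set n" "b \<in> carrier LRB" "x \<in> ideal" "vs \<in> simplices x n"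
  shows "(free_gen K b \<odot>\<^bsub>cores n\<^esub> \<phi>) (x, vs) = \<phi> (x \<cdot> b, vs)"
  using assms pairing_free_gen[OF Kc Bm assms(2) cores_setD(1)[OF assms(1)]] by (simp add: cores_smult)

lemma cores_scalar:
  assumes \<phi>: "\<phi> \<in> cores_set n" and r: "r \<in> carrier K"
  shows "A.scal r \<odot>\<^bsub>cores n\<^esub> \<phi> = (\<lambda>y. r \<otimes> \<phi> y)"
proof
  fix y :: "'v list set \<times> 'v list"
  obtain x vs where y: "y = (x, vs)" by (cases y)
  note \<phi>K = cores_setD(1)[OF \<phi>]
  show "(A.scal r \<odot>\<^bsub>cores n\<^esub> \<phi>) y = r \<otimes> \<phi> y"
    unfolding y cores_smult pairing_monoid_algebra_smult[OF Kc Bm r alg_one_closed[OF Kc Bm] \<phi>K]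
      pairing_one[OF Kc Bm \<phi>K]
    using r cores_setD(3,4)[OF \<phi>] by (auto simp: ideal_closed)
qed

section \<open>Action on the content modules\<close>

lemma content_module_smult:
  fixes f :: "'v list set \<Rightarrow> 'k"
  shows "f \<odot>\<^bsub>content_module K U\<^esub> t = pairing K f (\<lambda>b. if content b \<subseteq> U then t else \<zero>)"
  unfolding content_module_def mk_module_simps pairing_def[OF Kc Bm] ..

lemma content_module_simps:
  "carrier (content_module K U) = carrier K" "\<zero>\<^bsub>content_module K U\<^esub> = \<zero>"
  "s \<oplus>\<^bsub>content_module K U\<^esub> t = s \<oplus> t"
  by (simp_all add: content_module_def)

lemma content_module_gen:
  assumes "b \<in> carrier LRB" "t \<in> carrier K"
  shows "free_gen K b \<odot>\<^bsub>content_module K U\<^esub> t = (if content b \<subseteq> U then t else \<zero>)"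
  unfolding content_module_smult using assms by (subst pairing_free_gen[OF Kc Bm]) auto

lemma content_module_scalar:
  assumes "r \<in> carrier K" "t \<in> carrier K"
  shows "A.scal r \<odot>\<^bsub>content_module K U\<^esub> t = r \<otimes> t"
proof -
  have "content \<one>\<^bsub>LRB\<^esub> = {}" by (simp add: word_class_Nil[symmetric] content_word_class)
  then show ?thesis
    unfolding content_module_smult using assms alg_one_closed[OF Kc Bm]
    by (subst pairing_monoid_algebra_smult[OF Kc Bm]) (auto simp: pairing_one[OF Kc Bm])
qed

lemma content_module_left: "left_module AA (content_module K U)"
  by (rule content_module_left_module[OF Kc])

section \<open>Differential, augmentation and exactness\<close>

lemma cores_d_apply:
  assumes "\<phi> \<in> cores_set n" "x \<in> ideal" "vs \<in> simplices x (Suc n)"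
  shows "cores_d n \<phi> (x, vs) = cobd K (\<lambda>u. \<phi> (x, u)) vs"
  using assms by (simp add: cores_d_def cobd_on_def)

lemma cores_d_outside:
  assumes "\<phi> \<in> cores_set n" "\<not> (x \<in> ideal \<and> vs \<in> simplices x (Suc n))"
  shows "cores_d n \<phi> (x, vs) = \<zero>"
  using assms by (auto simp: cores_d_def cobd_on_def)

lemma cores_d_closed:
  assumes \<phi>: "\<phi> \<in> cores_set n"
  shows "cores_d n \<phi> \<in> cores_set (Suc n)"
proof -
  have "(\<lambda>vs. cores_d n \<phi> (x, vs)) \<in> alt_cochains K (Pow (tops x)) (Suc n)" if x: "x \<in> ideal" for x
  proof -
    have "(\<lambda>vs. cores_d n \<phi> (x, vs)) = cobd_on K (Pow (tops x)) n (\<lambda>u. \<phi> (x, u))"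
      using x \<phi> by (simp add: cores_d_def)
    then show ?thesis using cobd_on_closed[OF Kc cores_setD(2)[OF \<phi> x]] by simp
  qed
  then show ?thesis using \<phi> by (simp add: cores_set_def[of "Suc n"] cores_d_outside)
qed

text \<open>Translation acts on the point and \<open>cobd\<close> on the list, so they commute;
  every face of \<open>vs\<close> is admissible at \<open>x\<close> too, which keeps the cutoff in
  the action out of the way.\<close>

lemma cores_d_hom: "cores_d n \<in> mod_hom AA (cores n) (cores (Suc n))"
proof (rule monoid_algebra_homI[OF Kc Bm cores_left_module cores_left_module])
  note dc = cores_d_closed
  show "cores_d n \<in> mod_hom K (restrict_scalars AA (cores n)) (restrict_scalars AA (cores (Suc n)))"
  proof (rule mod_homI; (unfold restrict_scalars_simps cores_simps)?)
    fix \<phi> assume \<phi>: "\<phi> \<in> cores_set n"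
    show "cores_d n \<phi> \<in> cores_set (Suc n)" by (rule dc[OF \<phi>])
    fix r assume r: "r \<in> carrier K"
    note c = cores_closed(2)[OF \<phi> A.scalar_closed[OF r]]
    show "cores_d n (A.scal r \<odot>\<^bsub>cores n\<^esub> \<phi>) = A.scal r \<odot>\<^bsub>cores (Suc n)\<^esub> cores_d n \<phi>"
      by (rule cores_eqI[OF dc[OF c] cores_closed(2)[OF dc[OF \<phi>] A.scalar_closed[OF r]]])
         (simp add: cores_d_apply c \<phi> cores_scalar[OF \<phi> r] cores_scalar[OF dc[OF \<phi>] r]
            cobd_smult[OF Kc cores_setD(1)[OF \<phi>] r] cores_d_apply[OF c[unfolded cores_scalar[OF \<phi> r]]])
  next
    fix \<phi> \<psi> assume \<phi>: "\<phi> \<in> cores_set n" and \<psi>: "\<psi> \<in> cores_set n"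
    show "cores_d n (\<lambda>y. \<phi> y \<oplus> \<psi> y) = (\<lambda>y. cores_d n \<phi> y \<oplus> cores_d n \<psi> y)"
      by (rule cores_eqI[OF dc[OF cores_closed(1)[OF \<phi> \<psi>]] cores_closed(1)[OF dc[OF \<phi>] dc[OF \<psi>]]])
         (simp add: cores_d_apply[OF cores_closed(1)[OF \<phi> \<psi>]] cores_d_apply[OF \<phi>] cores_d_apply[OF \<psi>]
            cobd_add[OF Kc cores_setD(1)[OF \<phi>] cores_setD(1)[OF \<psi>]])
  qed (simp add: cores_d_def)
  fix b \<phi> assume b: "b \<in> carrier LRB" and "\<phi> \<in> carrier (cores n)"
  then have \<phi>: "\<phi> \<in> cores_set n" by (simp add: cores_simps)
  note g = free_gen_monoid_algebra[OF Kc Bm b]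
  show "cores_d n (free_gen K b \<odot>\<^bsub>cores n\<^esub> \<phi>) = free_gen K b \<odot>\<^bsub>cores (Suc n)\<^esub> cores_d n \<phi>"
  proof (rule cores_eqI[OF dc[OF cores_closed(2)[OF \<phi> g]] cores_closed(2)[OF dc[OF \<phi>] g]])
    fix x vs assume x: "x \<in> ideal" and vs: "vs \<in> simplices x (Suc n)"
    have "cores_d n (free_gen K b \<odot>\<^bsub>cores n\<^esub> \<phi>) (x, vs) = cobd K (\<lambda>u. \<phi> (x \<cdot> b, u)) vs"
      unfolding cores_d_apply[OF cores_closed(2)[OF \<phi> g] x vs]
    proof (rule cobd_cong)
      fix ys y zs assume "vs = ys @ y # zs"
      then have "ys @ zs \<in> simplices x n" using vs ordered_simplices_face[of "Pow (tops x)" ys y zs n] by auto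
      then show "(free_gen K b \<odot>\<^bsub>cores n\<^esub> \<phi>) (x, ys @ zs) = \<phi> (x \<cdot> b, ys @ zs)"
        by (rule cores_gen[OF \<phi> b x])
    qed
    also have "\<dots> = (free_gen K b \<odot>\<^bsub>cores (Suc n)\<^esub> cores_d n \<phi>) (x, vs)"
      unfolding cores_gen[OF dc[OF \<phi>] b x vs]
      by (rule cores_d_apply[symmetric, OF \<phi> ideal_mult[OF x b] simplices_mult[OF x b vs]])
    finally show "cores_d n (free_gen K b \<odot>\<^bsub>cores n\<^esub> \<phi>) (x, vs) =
      (free_gen K b \<odot>\<^bsub>cores (Suc n)\<^esub> cores_d n \<phi>) (x, vs)" .
  qed
qed

lemma cores_aug_closed:
  assumes "t \<in> carrier K"
  shows "cores_aug t \<in> cores_set 0"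
  by (rule cores_setI)
     (use assms base_ideal in \<open>auto simp: cores_aug_def ordered_simplices_def\<close>)

text \<open>Functions concentrated at \<open>(base, [])\<close> form a copy of \<bbbk>_W:
  translation by \<open>b\<close> reaches \<open>base\<close> only from \<open>base\<close> itself,
  and exactly if the content of \<open>b\<close> lies in \<open>W\<close>.\<close>

lemma cores_aug_hom: "cores_aug \<in> mod_hom AA (content_module K W) (cores 0)"
proof (rule monoid_algebra_homI[OF Kc Bm content_module_left cores_left_module])
  show "cores_aug \<in> mod_hom K (restrict_scalars AA (content_module K W)) (restrict_scalars AA (cores 0))"
  proof (rule mod_homI; (unfold restrict_scalars_simps cores_simps content_module_simps)?)
    show "cores_aug (A.scal r \<odot>\<^bsub>content_module K W\<^esub> t) = A.scal r \<odot>\<^bsub>cores 0\<^esub> cores_aug t"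
      if "r \<in> carrier K" "t \<in> carrier K" for r t
      using that by (auto simp: content_module_scalar cores_scalar cores_aug_closed) (auto simp: cores_aug_def fun_eq_iff)
  qed (auto simp: cores_aug_closed, auto simp: cores_aug_def fun_eq_iff)
  fix b t assume b: "b \<in> carrier LRB" and "t \<in> carrier (content_module K W)"
  then have t: "t \<in> carrier K" by (simp add: content_module_simps)
  have bt: "free_gen K b \<odot>\<^bsub>content_module K W\<^esub> t \<in> carrier K" using t by (simp add: content_module_gen[OF b t])
  show "cores_aug (free_gen K b \<odot>\<^bsub>content_module K W\<^esub> t) = free_gen K b \<odot>\<^bsub>cores 0\<^esub> cores_aug t"
  proof (rule cores_eqI[OF cores_aug_closed[OF bt]
        cores_closed(2)[OF cores_aug_closed[OF t] free_gen_monoid_algebra[OF Kc Bm b]]])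
    fix x vs assume x: "x \<in> ideal" and vs: "vs \<in> simplices x 0"
    have "x \<cdot> b = base \<longleftrightarrow> x = base \<and> content b \<subseteq> W"
    proof
      assume eq: "x \<cdot> b = base"
      then have c: "content x \<union> content b = W" using content_mult[OF ideal_closed[OF x] b] by simp
      then have "tops x = {}" using tops_content[OF ideal_closed[OF x]] tops_subset[of x] by blast
      then show "x = base \<and> content b \<subseteq> W" using tops_empty_iff[OF x] c by blast
    next
      assume "x = base \<and> content b \<subseteq> W"
      then show "x \<cdot> b = base" using lrb_absorb[OF base_closed b] by simp
    qed
    then show "cores_aug (free_gen K b \<odot>\<^bsub>content_module K W\<^esub> t) (x, vs) =
        (free_gen K b \<odot>\<^bsub>cores 0\<^esub> cores_aug t) (x, vs)"
      unfolding cores_gen[OF cores_aug_closed[OF t] b x vs] content_module_gen[OF b t]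
      using t by (auto simp: cores_aug_def)
  qed
qed

lemma cores_aug_inj: "inj_on cores_aug (carrier (content_module K W))"
proof (rule inj_onI)
  fix s t assume st: "s \<in> carrier (content_module K W)" "t \<in> carrier (content_module K W)" and "cores_aug s = cores_aug t"
  then have "cores_aug s (base, []) = cores_aug t (base, [])" by simp
  then show "s = t" using st by (simp add: cores_aug_def content_module_simps)
qed

text \<open>The differential of \<phi> at \<open>(x, [v])\<close> is \<open>\<phi> (x, [])\<close>.
  Since \<open>base\<close> is the only point of the ideal without such a \<open>v\<close>, the
  closed functions are those concentrated at \<open>base\<close>.\<close>

lemma cores_exact_0: "cores_aug ` carrier (content_module K W) = {\<phi> \<in> carrier (cores 0). cores_d 0 \<phi> = \<zero>\<^bsub>cores (Suc 0)\<^esub>}"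
proof (intro equalityI subsetI)
  fix \<phi> assume "\<phi> \<in> cores_aug ` carrier (content_module K W)"
  then obtain t where t: "t \<in> carrier K" "\<phi> = cores_aug t" by (auto simp: content_module_simps)
  have \<phi>: "\<phi> \<in> cores_set 0" using t cores_aug_closed by simp
  have "cores_d 0 \<phi> (x, vs) = \<zero>" for x vs
  proof (cases "x \<in> ideal \<and> vs \<in> simplices x (Suc 0)")
    case True
    then have "tops x \<noteq> {}" by (auto simp: ordered_simplices_def length_Suc_conv)
    then have "x \<noteq> base" using tops_empty_iff[OF base_ideal] by auto
    then have "\<phi> (x, u) = \<zero>" for u using t by (simp add: cores_aug_def)
    then have "cobd K (\<lambda>u. \<phi> (x, u)) vs = \<zero>" by (rule cobd_zero[OF Kc])
    then show ?thesis using True cores_d_apply[OF \<phi>, of x vs] by simp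
  next
    case False
    then show ?thesis by (rule cores_d_outside[OF \<phi>])
  qed
  then show "\<phi> \<in> {\<phi> \<in> carrier (cores 0). cores_d 0 \<phi> = \<zero>\<^bsub>cores (Suc 0)\<^esub>}"
    using \<phi> by (auto simp: cores_simps fun_eq_iff)
next
  fix \<phi> assume "\<phi> \<in> {\<phi> \<in> carrier (cores 0). cores_d 0 \<phi> = \<zero>\<^bsub>cores (Suc 0)\<^esub>}"
  then have \<phi>: "\<phi> \<in> cores_set 0" and z: "\<And>y. cores_d 0 \<phi> y = \<zero>" by (auto simp: cores_simps)
  note \<phi>K = cores_setD(1)[OF \<phi>]
  have "\<phi> (x, []) = \<zero>" if x: "x \<in> ideal" "x \<noteq> base" for x
  proof -
    obtain v where v: "v \<in> tops x" using x tops_empty_iff by blast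
    then have "[v] \<in> simplices x (Suc 0)" by (simp add: ordered_simplices_def)
    from cores_d_apply[OF \<phi> x(1) this] z show ?thesis using \<phi>K by (simp add: a_minus_def)
  qed
  note z0 = this
  have "\<phi> y = cores_aug (\<phi> (base, [])) y" for y
  proof (cases y)
    case (Pair x vs)
    have "\<phi> (x, vs) = \<zero>" if "vs \<noteq> []"
      using that by (intro cores_setD(4)[OF \<phi>]) (simp add: ordered_simplices_def)
    moreover have "\<phi> (x, []) = \<zero>" if "x \<noteq> base"
      using that z0 cores_setD(3)[OF \<phi>] by blast
    ultimately show ?thesis using \<phi>K by (auto simp: Pair cores_aug_def)
  qed
  then have "\<phi> = cores_aug (\<phi> (base, []))" by blast
  then show "\<phi> \<in> cores_aug ` carrier (content_module K W)" using \<phi>K by (simp add: content_module_simps)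
qed

lemma cores_exact: "cores_d n ` carrier (cores n) =
  {\<phi> \<in> carrier (cores (Suc n)). cores_d (Suc n) \<phi> = \<zero>\<^bsub>cores (Suc (Suc n))\<^esub>}"
proof (intro equalityI subsetI)
  fix \<phi> assume "\<phi> \<in> cores_d n ` carrier (cores n)"
  then obtain \<psi> where \<psi>: "\<psi> \<in> cores_set n" "\<phi> = cores_d n \<psi>" by (auto simp: cores_simps)
  have \<phi>: "\<phi> \<in> cores_set (Suc n)" using \<psi> cores_d_closed by simp
  have "cores_d (Suc n) \<phi> (x, vs) = \<zero>" for x vs
  proof (cases "x \<in> ideal \<and> vs \<in> simplices x (Suc (Suc n))")
    case True
    then have "(\<lambda>u. \<phi> (x, u)) = cobd_on K (Pow (tops x)) n (\<lambda>u. \<psi> (x, u))"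
      using \<psi> by (simp add: cores_d_def)
    moreover have "cobd K (cobd_on K (Pow (tops x)) n (\<lambda>u. \<psi> (x, u))) vs = \<zero>"
      by (rule cobd_cobd_on[OF Kc _ cores_setD(2)[OF \<psi>(1)]]) (use True in auto)
    ultimately show ?thesis using True cores_d_apply[OF \<phi>, of x vs] by simp
  next
    case False
    then show ?thesis by (rule cores_d_outside[OF \<phi>])
  qed
  then show "\<phi> \<in> {\<phi> \<in> carrier (cores (Suc n)). cores_d (Suc n) \<phi> = \<zero>\<^bsub>cores (Suc (Suc n))\<^esub>}"
    using \<phi> by (auto simp: cores_simps fun_eq_iff)
next
  fix \<phi> assume "\<phi> \<in> {\<phi> \<in> carrier (cores (Suc n)). cores_d (Suc n) \<phi> = \<zero>\<^bsub>cores (Suc (Suc n))\<^esub>}"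
  then have \<phi>: "\<phi> \<in> cores_set (Suc n)" and z: "\<And>y. cores_d (Suc n) \<phi> y = \<zero>" by (auto simp: cores_simps)
  \<comment> \<open>The cone vertex is chosen for each point separately. Compatibility with
    translation is no issue, because exactness concerns the underlying functions.\<close>
  define v where "v x = (SOME v. v \<in> tops x)" for x
  define \<psi> where "\<psi> = (\<lambda>(x, u). if x \<in> ideal \<and> tops x \<noteq> {} then \<phi> (x, v x # u) else \<zero>)"
  have *: "(\<lambda>u. \<psi> (x, u)) \<in> alt_cochains K (Pow (tops x)) n \<and>
      cobd_on K (Pow (tops x)) n (\<lambda>u. \<psi> (x, u)) = (\<lambda>u. \<phi> (x, u))" if x: "x \<in> ideal" for x
  proof (cases "tops x = {}")
    case True
    \<comment> \<open>Over this point there is no simplex with a vertex, so both sides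
      vanish.\<close>
    then have "vs \<notin> simplices x (Suc n)" for vs by (auto simp: ordered_simplices_def)
    moreover from this have "\<phi> (x, vs) = \<zero>" for vs by (rule cores_setD(4)[OF \<phi>])
    moreover have "(\<lambda>u. \<psi> (x, u)) = (\<lambda>u. \<zero>)" using True by (simp add: \<psi>_def)
    ultimately show ?thesis by (auto simp: alt_cochains_def alternating_def cobd_on_def)
  next
    case False
    then have "\<exists>v. v \<in> tops x" by blast
    then have vx: "v x \<in> tops x" unfolding v_def by (rule someI_ex)
    have "cobd K (\<lambda>u. \<phi> (x, u)) vs = \<zero>" if "vs \<in> simplices x (Suc (Suc n))" for vs
      using z cores_d_apply[OF \<phi> x that] by simp
    note ac = simplex_acyclic[OF Kc cores_setD(2)[OF \<phi> x] vx this]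
    have "(\<lambda>u. \<psi> (x, u)) = (\<lambda>u. \<phi> (x, v x # u))" using x False by (simp add: \<psi>_def)
    then show ?thesis using ac by simp
  qed
  have "\<psi> (x, vs) = \<zero>" if "x \<notin> ideal" for x vs using that by (simp add: \<psi>_def)
  then have \<psi>: "\<psi> \<in> cores_set n" unfolding cores_set_def using * by blast
  have "cores_d n \<psi> = \<phi>"
  proof
    fix y :: "'v list set \<times> 'v list"
    obtain x vs where y: "y = (x, vs)" by (cases y)
    show "cores_d n \<psi> y = \<phi> y"
    proof (cases "x \<in> ideal")
      case True
      then have "cores_d n \<psi> (x, vs) = cobd_on K (Pow (tops x)) n (\<lambda>u. \<psi> (x, u)) vs"
        using \<psi> by (simp add: cores_d_def)
      also have "\<dots> = \<phi> (x, vs)" using conjunct2[OF *[OF True]] by (rule fun_cong)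
      finally show ?thesis unfolding y .
    next
      case False
      then show ?thesis unfolding y using \<psi> cores_setD(3)[OF \<phi> False] by (simp add: cores_d_outside)
    qed
  qed
  then show "\<phi> \<in> cores_d n ` carrier (cores n)" using \<psi> by (auto simp: cores_simps)
qed

end

section \<open>Homomorphisms into the coresolution\<close>

lemma mod_hom_factor:
  assumes P: "left_module R P" and M: "left_module R M" and N: "left_module R N"
    and e: "e \<in> mod_hom R P M" "e ` carrier P = carrier M"
    and g: "g \<in> mod_hom R P N" "\<And>x. x \<in> carrier P \<Longrightarrow> e x = \<zero>\<^bsub>M\<^esub> \<Longrightarrow> g x = \<zero>\<^bsub>N\<^esub>"
  obtains g' where "g' \<in> mod_hom R M N" "\<And>x. x \<in> carrier P \<Longrightarrow> g' (e x) = g x"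
proof -
  interpret P: left_module R P by fact
  interpret M: left_module R M by fact
  interpret N: left_module R N by fact
  note eD = mod_homD(1-3)[OF e(1)] and gD = mod_homD(1-3)[OF g(1)]
  define g' where "g' = (\<lambda>t\<in>carrier M. g (inv_into (carrier P) e t))"
  have eq: "g x = g y" if x: "x \<in> carrier P" and y: "y \<in> carrier P" and xy: "e x = e y" for x y
  proof -
    let ?m = "(\<ominus>\<^bsub>R\<^esub> \<one>\<^bsub>R\<^esub>) \<odot>\<^bsub>P\<^esub> y"
    have m: "?m \<in> carrier P" using y by (simp add: P.smult_closed)
    have em: "e ?m = \<ominus>\<^bsub>M\<^esub> e y" "g ?m = \<ominus>\<^bsub>N\<^esub> g y"
      using y by (simp_all add: eD gD M.smult_minus_one N.smult_minus_one)
    have "e (x \<oplus>\<^bsub>P\<^esub> ?m) = \<zero>\<^bsub>M\<^esub>" using x y m em xy by (simp add: eD M.r_neg)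
    then have "g (x \<oplus>\<^bsub>P\<^esub> ?m) = \<zero>\<^bsub>N\<^esub>" using g(2) x m by simp
    then have "g x \<oplus>\<^bsub>N\<^esub> \<ominus>\<^bsub>N\<^esub> g y = \<zero>\<^bsub>N\<^esub>" using x m em by (simp add: gD)
    then have "\<ominus>\<^bsub>N\<^esub> (\<ominus>\<^bsub>N\<^esub> g y) = g x" using gD(1)[OF x] gD(1)[OF y] by (intro N.minus_equality) auto
    then show ?thesis using gD(1)[OF y] by simp
  qed
  have g': "g' (e x) = g x" if x: "x \<in> carrier P" for x
  proof -
    have ex: "e x \<in> e ` carrier P" using x by simp
    show ?thesis
      using eq[OF inv_into_into[OF ex] x f_inv_into_f[OF ex]] eD(1)[OF x] by (simp add: g'_def)
  qed
  have rep: "\<exists>x\<in>carrier P. t = e x" if "t \<in> carrier M" for t using that e(2) by blast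
  have "g' \<in> mod_hom R M N"
  proof (rule mod_homI)
    fix s assume "s \<in> carrier M"
    then obtain x where x: "x \<in> carrier P" "s = e x" using rep by blast
    show "g' s \<in> carrier N" using x g' gD(1) by simp
    show "g' (a \<odot>\<^bsub>M\<^esub> s) = a \<odot>\<^bsub>N\<^esub> g' s" if a: "a \<in> carrier R" for a
      using x a g'[of "a \<odot>\<^bsub>P\<^esub> x"] g'[of x] eD(3)[OF a x(1)] gD(3)[OF a x(1)] P.smult_closed[OF a x(1)] by simp
    fix t assume "t \<in> carrier M"
    then obtain y where y: "y \<in> carrier P" "t = e y" using rep by blast
    show "g' (s \<oplus>\<^bsub>M\<^esub> t) = g' s \<oplus>\<^bsub>N\<^esub> g' t"
      using x y g'[of "x \<oplus>\<^bsub>P\<^esub> y"] g'[of x] g'[of y] eD(2)[OF x(1) y(1)] gD(2)[OF x(1) y(1)] by simp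
  qed (simp add: g'_def)
  with g' that show ?thesis by blast
qed

context lrb_coefficients begin

lemma gen_mult:
  assumes "x \<in> carrier LRB" "y \<in> carrier LRB"
  shows "free_gen K x \<otimes>\<^bsub>AA\<^esub> free_gen K y = free_gen K (x \<cdot> y)"
proof (rule alg_eqI[OF Kc Bm])
  note g = free_gen_monoid_algebra[OF Kc Bm]
  show "free_gen K x \<otimes>\<^bsub>AA\<^esub> free_gen K y \<in> carrier AA" by (rule alg_mult(5)[OF Kc Bm g g]) fact+
  show "free_gen K (x \<cdot> y) \<in> carrier AA" using assms by (intro g) simp
  fix c :: "'v list set \<Rightarrow> 'k" assume c: "\<And>b. c b \<in> carrier K"
  have "pairing K (free_gen K x \<otimes>\<^bsub>AA\<^esub> free_gen K y) c =
      pairing K (free_gen K x) (\<lambda>u. pairing K (free_gen K y) (\<lambda>v. c (u \<cdot> v)))"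
    by (rule pairing_mult[OF Kc Bm g g c]) fact+
  also have "\<dots> = c (x \<cdot> y)"
    by (subst (1 2) pairing_free_gen[OF Kc Bm]) (simp_all add: assms c)
  also have "\<dots> = pairing K (free_gen K (x \<cdot> y)) c"
    by (rule pairing_free_gen[OF Kc Bm, symmetric]) (simp_all add: assms c)
  finally show "pairing K (free_gen K x \<otimes>\<^bsub>AA\<^esub> free_gen K y) c = pairing K (free_gen K (x \<cdot> y)) c" .
qed

text \<open>A point \<open>x\<close> over \<open>vs\<close> is the translate by \<open>x\<close> of
  the clique element, which lies over \<open>vs\<close> itself. This is why the functions over
  \<open>vs\<close> form a coinduced module.\<close>

lemma simplices_clique_elt:
  assumes x: "x \<in> ideal" and vs: "vs \<in> simplices x n"
  shows "set vs \<subseteq> V" "clique_elt (set vs) \<in> ideal" "vs \<in> simplices (clique_elt (set vs)) n"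
    "clique_elt (set vs) \<cdot> x = x"
proof -
  have S: "set vs \<subseteq> tops x" using vs by (auto simp: ordered_simplices_def)
  then show V: "set vs \<subseteq> V" using tops_subset[of x] by blast
  then show "clique_elt (set vs) \<in> ideal" by (rule clique_elt_ideal)
  have "set vs \<subseteq> tops (clique_elt (set vs))"
    by (rule clique_subset_tops) (use S tops_subset[of x] tops_clique[OF ideal_closed[OF x]] in blast)+
  then show "vs \<in> simplices (clique_elt (set vs)) n" using vs by (auto simp: ordered_simplices_def)
  show "clique_elt (set vs) \<cdot> x = x" by (rule clique_elt_absorb[OF x S])
qed

text \<open>Evaluating at \<open>x\<close> amounts to acting by \<open>x\<close> and evaluating at
  the clique element, because \<open>x\<close> is its translate by \<open>x\<close>; and
  \<open>f\<close> commutes with the action.\<close>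

lemma cores_hom_clique_elt:
  assumes M: "left_module AA M" and f: "f \<in> mod_hom AA M (cores n)" and y: "y \<in> carrier M"
    and x: "x \<in> ideal" and vs: "vs \<in> simplices x n"
  shows "f y (x, vs) = f (free_gen K x \<odot>\<^bsub>M\<^esub> y) (clique_elt (set vs), vs)"
proof -
  note c = simplices_clique_elt[OF x vs]
  have "f (free_gen K x \<odot>\<^bsub>M\<^esub> y) = free_gen K x \<odot>\<^bsub>cores n\<^esub> f y"
    by (rule mod_homD(3)[OF f free_gen_monoid_algebra[OF Kc Bm ideal_closed[OF x]] y])
  moreover have "f y \<in> cores_set n" using mod_homD(1)[OF f y] by (simp add: cores_simps)
  ultimately show ?thesis using cores_gen[OF _ ideal_closed[OF x] c(2,3)] c(4) by simp
qed

text \<open>A homomorphism \<open>f\<close> into \<open>cores n\<close> amounts to the functionals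
  \<open>\<lambda>y. f y (clique_elt (set vs), vs)\<close>, linear over the ground ring only, so the splitting of
  the resolution over the ground ring lets \<open>f\<close> be extended along \<open>d i\<close>.\<close>

lemma cores_acyclic:
  fixes P :: "nat \<Rightarrow> ('v list set \<Rightarrow> 'k, 'p) module" and e :: "'p \<Rightarrow> 'k"
  assumes res: "projective_resolution AA P d e (content_module K U)"
    and f: "f \<in> mod_hom AA (P (Suc i)) (cores n)"
    and f0: "\<And>x. x \<in> carrier (P (Suc (Suc i))) \<Longrightarrow> f (d (Suc i) x) = \<zero>\<^bsub>cores n\<^esub>"
  shows "\<exists>h\<in>mod_hom AA (P i) (cores n). \<forall>x\<in>carrier (P (Suc i)). h (d i x) = f x"
proof -
  note r = projective_resolutionD[OF res]
  interpret P: left_module AA "P i" by (rule r(3))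
  interpret Q: left_module AA "P (Suc i)" by (rule r(3))
  interpret P0: left_module AA "P 0" by (rule r(3))
  interpret C: left_module AA "cores n" by (rule cores_left_module)
  have g: "free_gen K x \<in> carrier AA" if "x \<in> carrier LRB" for x by (rule free_gen_monoid_algebra[OF Kc Bm that])
  \<comment> \<open>\<bbbk>_U is free over the ground ring on \<open>\<one>\<close>, so a preimage
    of \<open>\<one>\<close> gives the section that starts the splitting.\<close>
  obtain p0 where p0: "p0 \<in> carrier (P 0)" "e p0 = \<one>"
  proof -
    have "\<one> \<in> e ` carrier (P 0)" unfolding r(6) by (simp add: content_module_simps)
    then show ?thesis using that by auto
  qed
  define \<sigma> where "\<sigma> = (\<lambda>t\<in>carrier K. A.scal t \<odot>\<^bsub>P 0\<^esub> p0)"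
  have \<sigma>: "\<sigma> \<in> mod_hom K (restrict_scalars AA (content_module K U)) (restrict_scalars AA (P 0))"
  proof (rule mod_homI; (unfold restrict_scalars_simps content_module_simps)?)
    fix r t assume "r \<in> carrier K" "t \<in> carrier K"
    then show "\<sigma> (A.scal r \<odot>\<^bsub>content_module K U\<^esub> t) = A.scal r \<odot>\<^bsub>P 0\<^esub> \<sigma> t"
      by (simp add: content_module_scalar \<sigma>_def A.scalar_mult P0.smult_assoc A.scalar_closed p0)
  qed (simp_all add: \<sigma>_def p0 P0.smult_closed A.scalar_closed A.scalar_add P0.smult_l_distr)
  have e\<sigma>: "e (\<sigma> t) = t" if "t \<in> carrier (content_module K U)" for t
    using that mod_homD(3)[OF r(4) A.scalar_closed p0(1), of t]
    by (simp add: \<sigma>_def content_module_simps p0 content_module_scalar)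
  obtain s where s: "s \<in> mod_hom K (restrict_scalars AA (P i)) (restrict_scalars AA (P (Suc i)))"
    and ds: "\<And>y. y \<in> carrier (P (Suc i)) \<Longrightarrow> d i (s (d i y)) = d i y"
    using resolution_scalar_splitting[OF Kc Bm res \<sigma> e\<sigma>] by blast
  note sD = mod_homD(1-3)[OF s, unfolded restrict_scalars_simps]
  note fD = mod_homD(1-3)[OF f, unfolded cores_simps]
  \<comment> \<open>The formula of \<open>cores_hom_clique_elt\<close> dictates this shape, with
    \<open>s\<close> carrying the element up to \<open>P (Suc i)\<close>. Linearity of
    \<open>s\<close> over the ground ring is enough, because \<open>s\<close> is applied after the
    action of \<open>x\<close>.\<close>
  define h where "h = (\<lambda>p\<in>carrier (P i). \<lambda>(x, vs). if x \<in> ideal \<and> vs \<in> simplices x n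
    then f (s (free_gen K x \<odot>\<^bsub>P i\<^esub> p)) (clique_elt (set vs), vs) else \<zero>)"
  have xp: "free_gen K x \<odot>\<^bsub>P i\<^esub> p \<in> carrier (P i)" if "x \<in> ideal" "p \<in> carrier (P i)" for x p
    using that g ideal_closed P.smult_closed by blast
  have fs: "f (s p) \<in> cores_set n" if "p \<in> carrier (P i)" for p using fD(1)[OF sD(1)[OF that]] .
  have hI: "h p (x, vs) = f (s (free_gen K x \<odot>\<^bsub>P i\<^esub> p)) (clique_elt (set vs), vs)"
    if "p \<in> carrier (P i)" "x \<in> ideal" "vs \<in> simplices x n" for p x vs
    using that by (simp add: h_def)
  have hO: "h p (x, vs) = \<zero>" if "p \<in> carrier (P i)" "\<not> (x \<in> ideal \<and> vs \<in> simplices x n)" for p x vs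
    using that by (auto simp: h_def)
  have hc: "h p \<in> cores_set n" if p: "p \<in> carrier (P i)" for p
  proof (rule cores_setI)
    fix x vs
    show "h p (x, vs) \<in> carrier K"
      using hI[OF p, of x vs] hO[OF p, of x vs] cores_setD(1)[OF fs[OF xp[OF _ p]], of x "(clique_elt (set vs), vs)"]
      by (cases "x \<in> ideal \<and> vs \<in> simplices x n") auto
    show "h p (x, vs) = \<zero>" if "\<not> (x \<in> ideal \<and> vs \<in> simplices x n)" by (rule hO[OF p that])
  next
    fix x xs a b ys
    assume x: "x \<in> ideal" and S: "xs @ a # b # ys \<in> simplices x n" "xs @ b # a # ys \<in> simplices x n"
    have eq: "set (xs @ b # a # ys) = set (xs @ a # b # ys)" by auto
    show "h p (x, xs @ a # b # ys) = \<ominus> h p (x, xs @ b # a # ys)"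
      unfolding hI[OF p x S(1)] hI[OF p x S(2)] eq
      by (rule cores_set_swap[OF fs[OF xp[OF x p]] simplices_clique_elt(2)[OF x S(1)]])
  qed
  have hom: "h \<in> mod_hom AA (P i) (cores n)"
  proof (rule monoid_algebra_homI[OF Kc Bm r(3) cores_left_module])
    show "h \<in> mod_hom K (restrict_scalars AA (P i)) (restrict_scalars AA (cores n))"
    proof (rule mod_homI; (unfold restrict_scalars_simps cores_simps)?)
      fix p q assume p: "p \<in> carrier (P i)" and q: "q \<in> carrier (P i)"
      have pq: "p \<oplus>\<^bsub>P i\<^esub> q \<in> carrier (P i)" using p q by simp
      show "h (p \<oplus>\<^bsub>P i\<^esub> q) = (\<lambda>y. h p y \<oplus> h q y)"
      proof (rule cores_eqI[OF hc[OF pq] cores_closed(1)[OF hc[OF p] hc[OF q]]])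
        fix x vs assume x: "x \<in> ideal" and vs: "vs \<in> simplices x n"
        note xx = xp[OF x p] xp[OF x q]
        show "h (p \<oplus>\<^bsub>P i\<^esub> q) (x, vs) = h p (x, vs) \<oplus> h q (x, vs)"
          unfolding hI[OF p x vs] hI[OF q x vs] hI[OF pq x vs]
          P.smult_r_distr[OF g[OF ideal_closed[OF x]] p q] sD(2)[OF xx] fD(2)[OF sD(1)[OF xx(1)] sD(1)[OF xx(2)]] ..
      qed
    next
      fix r p assume rK: "r \<in> carrier K" and p: "p \<in> carrier (P i)"
      have rp: "A.scal r \<odot>\<^bsub>P i\<^esub> p \<in> carrier (P i)" using rK p by (simp add: P.smult_closed A.scalar_closed)
      show "h (A.scal r \<odot>\<^bsub>P i\<^esub> p) = A.scal r \<odot>\<^bsub>cores n\<^esub> h p"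
      proof (rule cores_eqI[OF hc[OF rp] cores_closed(2)[OF hc[OF p] A.scalar_closed[OF rK]]])
        fix x vs assume x: "x \<in> ideal" and vs: "vs \<in> simplices x n"
        note xg = g[OF ideal_closed[OF x]] and xx = xp[OF x p]
        have "free_gen K x \<odot>\<^bsub>P i\<^esub> (A.scal r \<odot>\<^bsub>P i\<^esub> p) = A.scal r \<odot>\<^bsub>P i\<^esub> (free_gen K x \<odot>\<^bsub>P i\<^esub> p)"
          using xg p rK A.scalar_central[OF rK xg] by (simp add: P.smult_assoc[symmetric] A.scalar_closed)
        moreover have "f (A.scal r \<odot>\<^bsub>P (Suc i)\<^esub> s (free_gen K x \<odot>\<^bsub>P i\<^esub> p)) = (\<lambda>y. r \<otimes> f (s (free_gen K x \<odot>\<^bsub>P i\<^esub> p)) y)"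
          using fD(3)[OF A.scalar_closed[OF rK] sD(1)[OF xx]] cores_scalar[OF fs[OF xx] rK] by simp
        ultimately show "h (A.scal r \<odot>\<^bsub>P i\<^esub> p) (x, vs) = (A.scal r \<odot>\<^bsub>cores n\<^esub> h p) (x, vs)"
          unfolding hI[OF rp x vs] cores_scalar[OF hc[OF p] rK] hI[OF p x vs] using sD(3)[OF rK xx] by simp
      qed
    qed (use hc in \<open>simp_all add: h_def\<close>)
    fix b p assume b: "b \<in> carrier LRB" and p: "p \<in> carrier (P i)"
    have bp: "free_gen K b \<odot>\<^bsub>P i\<^esub> p \<in> carrier (P i)" using g[OF b] p by (simp add: P.smult_closed)
    show "h (free_gen K b \<odot>\<^bsub>P i\<^esub> p) = free_gen K b \<odot>\<^bsub>cores n\<^esub> h p"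
    proof (rule cores_eqI[OF hc[OF bp] cores_closed(2)[OF hc[OF p] g[OF b]]])
      fix x vs assume x: "x \<in> ideal" and vs: "vs \<in> simplices x n"
      \<comment> \<open>Acting by \<open>b\<close> turns into translating \<open>x\<close> by
        \<open>b\<close>; the list, and with it the clique element used for evaluation, stays the
        same.\<close>
      have "free_gen K x \<odot>\<^bsub>P i\<^esub> (free_gen K b \<odot>\<^bsub>P i\<^esub> p) = free_gen K (x \<cdot> b) \<odot>\<^bsub>P i\<^esub> p"
        using g[OF ideal_closed[OF x]] g[OF b] p gen_mult[OF ideal_closed[OF x] b] by (simp add: P.smult_assoc[symmetric])
      then show "h (free_gen K b \<odot>\<^bsub>P i\<^esub> p) (x, vs) = (free_gen K b \<odot>\<^bsub>cores n\<^esub> h p) (x, vs)"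
        unfolding hI[OF bp x vs] cores_gen[OF hc[OF p] b x vs] hI[OF p ideal_mult[OF x b] simplices_mult[OF x b vs]]
        by simp
    qed
  qed
  have "h (d i q) = f q" if q: "q \<in> carrier (P (Suc i))" for q
  proof -
    have dq: "d i q \<in> carrier (P i)" by (rule mod_homD(1)[OF r(5) q])
    show ?thesis
    proof (rule cores_eqI[OF hc[OF dq] fD(1)[OF q]])
      fix x vs assume x: "x \<in> ideal" and vs: "vs \<in> simplices x n"
      note xg = g[OF ideal_closed[OF x]]
      let ?u = "free_gen K x \<odot>\<^bsub>P (Suc i)\<^esub> q"
      have u: "?u \<in> carrier (P (Suc i))" using xg q by (simp add: Q.smult_closed)
      have du: "d i ?u = free_gen K x \<odot>\<^bsub>P i\<^esub> d i q" by (rule mod_homD(3)[OF r(5) xg q])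
      let ?z = "s (d i ?u)"
      have z: "?z \<in> carrier (P (Suc i))" by (rule sD(1)[OF mod_homD(1)[OF r(5) u]])
      let ?m = "(\<ominus>\<^bsub>AA\<^esub> \<one>\<^bsub>AA\<^esub>) \<odot>\<^bsub>P (Suc i)\<^esub> ?u"
      have m: "?m \<in> carrier (P (Suc i))" using u by (simp add: Q.smult_closed)
      \<comment> \<open>The splitting moves \<open>?u\<close> only within its coset modulo the
        kernel of \<open>d i\<close>, which is the image of \<open>d (Suc i)\<close>, and
        \<open>f\<close> vanishes there.\<close>
      have "d i (?z \<oplus>\<^bsub>P (Suc i)\<^esub> ?m) = d i ?u \<oplus>\<^bsub>P i\<^esub> (\<ominus>\<^bsub>AA\<^esub> \<one>\<^bsub>AA\<^esub>) \<odot>\<^bsub>P i\<^esub> d i ?u"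
        using mod_homD(2)[OF r(5) z m] ds[OF u] mod_homD(3)[OF r(5) _ u, of "\<ominus>\<^bsub>AA\<^esub> \<one>\<^bsub>AA\<^esub>"] by simp
      also have "\<dots> = \<zero>\<^bsub>P i\<^esub>" using mod_homD(1)[OF r(5) u] by (simp add: P.smult_minus_one P.r_neg)
      finally have "?z \<oplus>\<^bsub>P (Suc i)\<^esub> ?m \<in> d (Suc i) ` carrier (P (Suc (Suc i)))"
        unfolding r(8) using z m by simp
      then have "f (?z \<oplus>\<^bsub>P (Suc i)\<^esub> ?m) = \<zero>\<^bsub>cores n\<^esub>" using f0 by auto
      then have "f ?z \<oplus>\<^bsub>cores n\<^esub> \<ominus>\<^bsub>cores n\<^esub> f ?u = \<zero>\<^bsub>cores n\<^esub>"
        using mod_homD(2)[OF f z m] mod_homD(3)[OF f _ u, of "\<ominus>\<^bsub>AA\<^esub> \<one>\<^bsub>AA\<^esub>"] mod_homD(1)[OF f u]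
        by (simp add: C.smult_minus_one)
      then have "\<ominus>\<^bsub>cores n\<^esub> (\<ominus>\<^bsub>cores n\<^esub> f ?u) = f ?z"
        using mod_homD(1)[OF f u] mod_homD(1)[OF f z] by (intro C.minus_equality) auto
      then have "f ?z = f ?u" using mod_homD(1)[OF f u] by simp
      then show "h (d i q) (x, vs) = f q (x, vs)"
        unfolding hI[OF dq x vs] du[symmetric] cores_hom_clique_elt[OF r(3) f q x vs] by simp
    qed
  qed
  with hom show ?thesis by blast
qed

end

section \<open>The cochain complex of cliques\<close>

context
  fixes K :: "('k, 'z) ring_scheme" (structure) and X :: "'v set set"
  assumes K: "cring K" and down: "\<forall>S\<in>X. Pow S \<subseteq> X"
begin

interpretation K: cring K by (rule K)

lemma cochain_ops:
  "f \<oplus>\<^bsub>cochain_module K X n\<^esub> g = (\<lambda>vs\<in>ordered_simplices X n. f vs \<oplus> g vs)"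
  "r \<odot>\<^bsub>cochain_module K X n\<^esub> f = (\<lambda>vs\<in>ordered_simplices X n. r \<otimes> f vs)"
  by (simp_all add: cochain_module_def)

text \<open>Cochains are \<open>undefined\<close> off the simplices, while the laws of
  \<open>cobd\<close> ask for values in the ring on all lists.\<close>

definition zero_ext :: "nat \<Rightarrow> ('v list \<Rightarrow> 'k) \<Rightarrow> 'v list \<Rightarrow> 'k" where
  "zero_ext n f vs = (if vs \<in> ordered_simplices X n then f vs else \<zero>)"

lemma zero_ext_closed: "f \<in> carrier (cochain_module K X n) \<Longrightarrow> zero_ext n f \<in> alt_cochains K X n"
  using cochain_extend[OF K] by (simp add: zero_ext_def[abs_def])

lemma zero_ext_val: "f \<in> carrier (cochain_module K X n) \<Longrightarrow> zero_ext n f vs \<in> carrier K"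
  using alternatingD(1)[OF alt_cochainsD(1)[OF zero_ext_closed]] .

lemma cochain_val: "f \<in> carrier (cochain_module K X n) \<Longrightarrow> vs \<in> ordered_simplices X n \<Longrightarrow> f vs \<in> carrier K"
  by (auto simp: cochain_module_def)

lemma coboundary_zero_ext:
  assumes "f \<in> carrier (cochain_module K X n)"
  shows "simplicial_coboundary K X n f = restrict (cobd K (zero_ext n f)) (ordered_simplices X (Suc n))"
  by (rule simplicial_coboundary_eq[OF K down]) (simp_all add: zero_ext_val[OF assms], simp add: zero_ext_def)

lemma coboundary_closed:
  assumes f: "f \<in> carrier (cochain_module K X n)"
  shows "simplicial_coboundary K X n f \<in> carrier (cochain_module K X (Suc n))"
proof -
  have "simplicial_coboundary K X n f = restrict (cobd_on K X n (zero_ext n f)) (ordered_simplices X (Suc n))"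
    unfolding coboundary_zero_ext[OF f] by (auto simp: cobd_on_def)
  then show ?thesis using cochain_restrict[OF K cobd_on_closed[OF K zero_ext_closed[OF f]]] by simp
qed

lemma coboundary_coboundary:
  assumes f: "f \<in> carrier (cochain_module K X n)"
  shows "simplicial_coboundary K X (Suc n) (simplicial_coboundary K X n f) = \<zero>\<^bsub>cochain_module K X (Suc (Suc n))\<^esub>"
proof -
  let ?g = "simplicial_coboundary K X n f"
  have "zero_ext (Suc n) ?g = cobd_on K X n (zero_ext n f)"
    unfolding coboundary_zero_ext[OF f] by (auto simp: zero_ext_def cobd_on_def fun_eq_iff)
  then show ?thesis
    unfolding coboundary_zero_ext[OF coboundary_closed[OF f]]
    using cobd_cobd_on[OF K down zero_ext_closed[OF f]] by (auto simp: cochain_module_def restrict_def)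
qed

text \<open>The restriction to the carrier serves \<open>mod_hom\<close>, whose members are
  extensional.\<close>

lemma coboundary_hom:
  "restrict (simplicial_coboundary K X n) (carrier (cochain_module K X n)) \<in>
    mod_hom K (cochain_module K X n) (cochain_module K X (Suc n))"
proof (rule mod_homI)
  interpret C: left_module K "cochain_module K X n" by (rule cochain_module_left_module[OF K])
  fix f assume f: "f \<in> carrier (cochain_module K X n)"
  show "restrict (simplicial_coboundary K X n) (carrier (cochain_module K X n)) f \<in> carrier (cochain_module K X (Suc n))"
    using f coboundary_closed by simp
  show "restrict (simplicial_coboundary K X n) (carrier (cochain_module K X n)) (r \<odot>\<^bsub>cochain_module K X n\<^esub> f) =
      r \<odot>\<^bsub>cochain_module K X (Suc n)\<^esub> restrict (simplicial_coboundary K X n) (carrier (cochain_module K X n)) f"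
    if r: "r \<in> carrier K" for r
  proof -
    have rf: "r \<odot>\<^bsub>cochain_module K X n\<^esub> f \<in> carrier (cochain_module K X n)" using C.smult_closed[OF r f] .
    have eq: "zero_ext n (r \<odot>\<^bsub>cochain_module K X n\<^esub> f) = (\<lambda>u. r \<otimes> zero_ext n f u)"
      using r by (auto simp: zero_ext_def cochain_module_def fun_eq_iff)
    have "simplicial_coboundary K X n (r \<odot>\<^bsub>cochain_module K X n\<^esub> f) =
        r \<odot>\<^bsub>cochain_module K X (Suc n)\<^esub> simplicial_coboundary K X n f"
      unfolding coboundary_zero_ext[OF rf] coboundary_zero_ext[OF f] eq
      by (auto simp: cochain_ops fun_eq_iff restrict_def cobd_smult[OF K zero_ext_val[OF f] r])
    then show ?thesis using f rf by simp
  qed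
  fix g assume g: "g \<in> carrier (cochain_module K X n)"
  have fg: "f \<oplus>\<^bsub>cochain_module K X n\<^esub> g \<in> carrier (cochain_module K X n)" using f g by simp
  have eq: "zero_ext n (f \<oplus>\<^bsub>cochain_module K X n\<^esub> g) = (\<lambda>u. zero_ext n f u \<oplus> zero_ext n g u)"
    by (auto simp: zero_ext_def cochain_module_def fun_eq_iff)
  have "simplicial_coboundary K X n (f \<oplus>\<^bsub>cochain_module K X n\<^esub> g) =
      simplicial_coboundary K X n f \<oplus>\<^bsub>cochain_module K X (Suc n)\<^esub> simplicial_coboundary K X n g"
    unfolding coboundary_zero_ext[OF fg] coboundary_zero_ext[OF f] coboundary_zero_ext[OF g] eq
    by (auto simp: cochain_ops fun_eq_iff restrict_def cobd_add[OF K zero_ext_val[OF f] zero_ext_val[OF g]])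
  then show "restrict (simplicial_coboundary K X n) (carrier (cochain_module K X n)) (f \<oplus>\<^bsub>cochain_module K X n\<^esub> g) =
      restrict (simplicial_coboundary K X n) (carrier (cochain_module K X n)) f \<oplus>\<^bsub>cochain_module K X (Suc n)\<^esub>
      restrict (simplicial_coboundary K X n) (carrier (cochain_module K X n)) g"
    using f g fg by simp
qed simp

lemma cochain_submodules:
  shows "submodule_of K (cochain_module K X n) (cocycles (cochain_module K X) (simplicial_coboundary K X) n)"
    and "submodule_of K ((cochain_module K X (Suc n))\<lparr>carrier := cocycles (cochain_module K X) (simplicial_coboundary K X) (Suc n)\<rparr>)
      (coboundaries (cochain_module K X) (simplicial_coboundary K X) (Suc n))"
proof -
  note C = cochain_module_left_module[OF K, of X]
  have Z: "cocycles (cochain_module K X) (simplicial_coboundary K X) m =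
      a_kernel (cochain_module K X m) (cochain_module K X (Suc m))
       (restrict (simplicial_coboundary K X m) (carrier (cochain_module K X m)))" for m
    by (auto simp: cocycles_def a_kernel_def')
  show "submodule_of K (cochain_module K X n) (cocycles (cochain_module K X) (simplicial_coboundary K X) n)" for n
    unfolding Z by (rule submodule_kernel[OF C C coboundary_hom])
  have B: "coboundaries (cochain_module K X) (simplicial_coboundary K X) (Suc n) =
      restrict (simplicial_coboundary K X n) (carrier (cochain_module K X n)) ` carrier (cochain_module K X n)"
    by (auto simp: coboundaries_def)
  show "submodule_of K ((cochain_module K X (Suc n))\<lparr>carrier := cocycles (cochain_module K X) (simplicial_coboundary K X) (Suc n)\<rparr>)
      (coboundaries (cochain_module K X) (simplicial_coboundary K X) (Suc n))"
  proof (rule submodule_of_restrict)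
    show "submodule_of K (cochain_module K X (Suc n)) (coboundaries (cochain_module K X) (simplicial_coboundary K X) (Suc n))"
      unfolding B by (rule submodule_image[OF C C coboundary_hom])
    show "coboundaries (cochain_module K X) (simplicial_coboundary K X) (Suc n) \<subseteq>
        cocycles (cochain_module K X) (simplicial_coboundary K X) (Suc n)"
      using coboundary_closed coboundary_coboundary by (auto simp: coboundaries_def cocycles_def a_kernel_def')
  qed
qed

end

section \<open>Homomorphisms from the content module of \<open>U\<close> as clique cochains\<close>

locale lrb_ext = lrb_coefficients V E W K
  for V :: "'v set" and E :: "'v set set" and W :: "'v set" and K :: "('k, 'z) ring_scheme" (structure) +
  fixes U :: "'v set"
  assumes WU: "W \<subseteq> U" and UV: "U \<subseteq> V"
begin

abbreviation "X \<equiv> clique_complex (U - W) (induced_edges E (U - W))"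
abbreviation "CC \<equiv> cochain_module K X"
abbreviation "\<delta> \<equiv> simplicial_coboundary K X"

text \<open>The condition on \<open>content x\<close> is forced: by
  \<open>cores_hom_clique_elt\<close> the value at \<open>x\<close> is that of \<open>x\<close>
  acting on \<open>t\<close>, taken at the clique element, and \<open>x\<close> acts on \<bbbk>_U as
  zero unless its content lies in \<open>U\<close>.\<close>

definition cochain_hom :: "nat \<Rightarrow> ('v list \<Rightarrow> 'k) \<Rightarrow> 'k \<Rightarrow> 'v list set \<times> 'v list \<Rightarrow> 'k" where
  "cochain_hom m \<psi> = (\<lambda>t\<in>carrier K. \<lambda>(x, vs).
     if x \<in> ideal \<and> vs \<in> simplices x m \<and> content x \<subseteq> U then t \<otimes> \<psi> vs else \<zero>)"

lemma X_down: "\<forall>S\<in>X. Pow S \<subseteq> X"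
  by (auto simp: clique_complex_def induced_edges_def finite_subset)

lemma X_iff: "S \<in> X \<longleftrightarrow> S \<subseteq> U - W \<and> (\<forall>x\<in>S. \<forall>y\<in>S. x \<noteq> y \<longrightarrow> {x, y} \<in> E)"
proof -
  have "finite (U - W)" using graph UV by (auto simp: simple_graph_def intro: finite_subset)
  then show ?thesis by (auto simp: clique_complex_def induced_edges_def finite_subset)
qed

text \<open>\<open>tops x\<close> is a clique, disjoint from \<open>W\<close> and contained in the
  content of \<open>x\<close>.\<close>

lemma simplices_X:
  assumes x: "x \<in> ideal" and vs: "vs \<in> simplices x m" and "content x \<subseteq> U"
  shows "vs \<in> ordered_simplices X m"
proof -
  have S: "set vs \<subseteq> tops x" using vs by (auto simp: ordered_simplices_def)
  have "set vs \<in> X" unfolding X_iff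
    using S tops_clique[OF ideal_closed[OF x]] tops_content[OF ideal_closed[OF x]] tops_subset[of x] assms(3) by blast
  then show ?thesis using vs by (simp add: ordered_simplices_def)
qed

text \<open>Here \<open>W \<subseteq> U\<close> enters: the clique element has content
  \<open>W\<close> together with the clique.\<close>

lemma X_clique_elt:
  assumes "vs \<in> ordered_simplices X m"
  shows "clique_elt (set vs) \<in> ideal" "vs \<in> simplices (clique_elt (set vs)) m" "content (clique_elt (set vs)) \<subseteq> U"
proof -
  have S: "set vs \<in> X" using assms by (simp add: ordered_simplices_def)
  then have V: "set vs \<subseteq> V" and VW: "set vs \<subseteq> V - W" using UV by (auto simp: X_iff)
  show "clique_elt (set vs) \<in> ideal" by (rule clique_elt_ideal[OF V])
  show "content (clique_elt (set vs)) \<subseteq> U" using S WU by (auto simp: content_clique_elt[OF V] X_iff)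
  have "set vs \<subseteq> tops (clique_elt (set vs))"
    by (rule clique_subset_tops[OF VW]) (use S in \<open>auto simp: X_iff\<close>)
  then show "vs \<in> simplices (clique_elt (set vs)) m" using assms by (simp add: ordered_simplices_def)
qed

lemma cochain_hom_apply:
  assumes "t \<in> carrier K" "x \<in> ideal" "vs \<in> simplices x m"
  shows "cochain_hom m \<psi> t (x, vs) = (if content x \<subseteq> U then t \<otimes> \<psi> vs else \<zero>)"
  using assms by (simp add: cochain_hom_def)

lemma cochain_hom_outside:
  assumes "t \<in> carrier K" "\<not> (x \<in> ideal \<and> vs \<in> simplices x m)"
  shows "cochain_hom m \<psi> t (x, vs) = \<zero>"
  using assms by (auto simp: cochain_hom_def)

lemma cochain_hom_closed:
  assumes \<psi>: "\<psi> \<in> carrier (CC m)" and t: "t \<in> carrier K"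
  shows "cochain_hom m \<psi> t \<in> cores_set m"
proof (rule cores_setI)
  fix x vs
  show "cochain_hom m \<psi> t (x, vs) \<in> carrier K"
    using cochain_val[OF Kc X_down \<psi> simplices_X] t by (auto simp: cochain_hom_def)
  show "cochain_hom m \<psi> t (x, vs) = \<zero>" if "\<not> (x \<in> ideal \<and> vs \<in> simplices x m)"
    by (rule cochain_hom_outside[OF t that])
next
  note a = alt_cochainsD(1)[OF zero_ext_closed[OF Kc X_down \<psi>]]
  fix x xs a b ys
  assume x: "x \<in> ideal" and S: "xs @ a # b # ys \<in> simplices x m" "xs @ b # a # ys \<in> simplices x m"
  show "cochain_hom m \<psi> t (x, xs @ a # b # ys) = \<ominus> cochain_hom m \<psi> t (x, xs @ b # a # ys)"
  proof (cases "content x \<subseteq> U")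
    case True
    note m = simplices_X[OF x S(1) True] simplices_X[OF x S(2) True]
    have "\<psi> (xs @ a # b # ys) = zero_ext K X m \<psi> (xs @ a # b # ys)"
      "\<psi> (xs @ b # a # ys) = zero_ext K X m \<psi> (xs @ b # a # ys)"
      using m by (simp_all add: zero_ext_def[OF Kc X_down])
    then have "\<psi> (xs @ a # b # ys) = \<ominus> \<psi> (xs @ b # a # ys)"
      using alternatingD(2)[OF a, of xs a b ys] by argo
    then show ?thesis
      unfolding cochain_hom_apply[OF t x S(1)] cochain_hom_apply[OF t x S(2)]
      using t cochain_val[OF Kc X_down \<psi> m(2)] True by (simp add: K.r_minus)
  next
    case False
    then show ?thesis unfolding cochain_hom_apply[OF t x S(1)] cochain_hom_apply[OF t x S(2)] by simp
  qed
qed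

text \<open>The content of \<open>x \<cdot> b\<close> lies in \<open>U\<close> iff those of
  \<open>x\<close> and \<open>b\<close> both do; this matches the action of \<open>b\<close> on
  \<bbbk>_U.\<close>

lemma cochain_hom_hom:
  assumes \<psi>: "\<psi> \<in> carrier (CC m)"
  shows "cochain_hom m \<psi> \<in> mod_hom AA (content_module K U) (cores m)"
proof (rule monoid_algebra_homI[OF Kc Bm content_module_left cores_left_module])
  note v = cochain_val[OF Kc X_down \<psi> simplices_X]
  show "cochain_hom m \<psi> \<in> mod_hom K (restrict_scalars AA (content_module K U)) (restrict_scalars AA (cores m))"
  proof (rule mod_homI; (unfold restrict_scalars_simps cores_simps content_module_simps)?)
    fix s t assume s: "s \<in> carrier K" and t: "t \<in> carrier K"
    show "cochain_hom m \<psi> (s \<oplus> t) = (\<lambda>y. cochain_hom m \<psi> s y \<oplus> cochain_hom m \<psi> t y)"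
      using s t v by (auto simp: cochain_hom_def K.l_distr fun_eq_iff)
    show "cochain_hom m \<psi> (A.scal s \<odot>\<^bsub>content_module K U\<^esub> t) = A.scal s \<odot>\<^bsub>cores m\<^esub> cochain_hom m \<psi> t"
      unfolding content_module_scalar[OF s t] cores_scalar[OF cochain_hom_closed[OF \<psi> t] s]
      using s t v by (auto simp: cochain_hom_def K.m_assoc fun_eq_iff)
  qed (use cochain_hom_closed[OF \<psi>] in \<open>simp_all add: cochain_hom_def content_module_simps\<close>)
  fix b t assume b: "b \<in> carrier LRB" and "t \<in> carrier (content_module K U)"
  then have t: "t \<in> carrier K" by (simp add: content_module_simps)
  have bt: "(if content b \<subseteq> U then t else \<zero>) \<in> carrier K" using t by simp
  show "cochain_hom m \<psi> (free_gen K b \<odot>\<^bsub>content_module K U\<^esub> t) = free_gen K b \<odot>\<^bsub>cores m\<^esub> cochain_hom m \<psi> t"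
    unfolding content_module_gen[OF b t]
  proof (rule cores_eqI[OF cochain_hom_closed[OF \<psi> bt]
        cores_closed(2)[OF cochain_hom_closed[OF \<psi> t] free_gen_monoid_algebra[OF Kc Bm b]]])
    fix x vs assume x: "x \<in> ideal" and vs: "vs \<in> simplices x m"
    show "cochain_hom m \<psi> (if content b \<subseteq> U then t else \<zero>) (x, vs) =
        (free_gen K b \<odot>\<^bsub>cores m\<^esub> cochain_hom m \<psi> t) (x, vs)"
      unfolding cores_gen[OF cochain_hom_closed[OF \<psi> t] b x vs] cochain_hom_apply[OF bt x vs]
        cochain_hom_apply[OF t ideal_mult[OF x b] simplices_mult[OF x b vs]] content_mult[OF ideal_closed[OF x] b]
      using v[OF x vs] by auto
  qed
qed

lemma cochain_hom_surj:
  assumes g: "g \<in> mod_hom AA (content_module K U) (cores m)"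
  obtains \<psi> where "\<psi> \<in> carrier (CC m)" "g = cochain_hom m \<psi>"
proof -
  have one: "\<one> \<in> carrier (content_module K U)" by (simp add: content_module_simps)
  have g1: "g \<one> \<in> cores_set m" using mod_homD(1)[OF g one] by (simp add: cores_simps)
  \<comment> \<open>The cochain is read off at the clique elements, where by
    \<open>cores_hom_clique_elt\<close> the whole of \<open>g\<close> is determined.\<close>
  define f where "f vs = (if vs \<in> ordered_simplices X m then g \<one> (clique_elt (set vs), vs) else \<zero>)" for vs
  have "f \<in> alt_cochains K X m" unfolding alt_cochains_def alternating_def
  proof (intro CollectI conjI allI impI)
    show "f vs \<in> carrier K" for vs using cores_setD(1)[OF g1] by (simp add: f_def)
    fix xs a b ys
    show "f (xs @ a # b # ys) = \<ominus> f (xs @ b # a # ys)"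
    proof (cases "xs @ b # a # ys \<in> ordered_simplices X m")
      case True
      then have True': "xs @ a # b # ys \<in> ordered_simplices X m" by (simp add: ordered_simplices_swap)
      have eq: "set (xs @ b # a # ys) = set (xs @ a # b # ys)" by auto
      show ?thesis unfolding f_def if_P[OF True] if_P[OF True'] eq
        by (rule cores_set_swap[OF g1 X_clique_elt(1)[OF True']])
    next
      case False
      then have "xs @ a # b # ys \<notin> ordered_simplices X m" by (simp add: ordered_simplices_swap)
      then show ?thesis using False by (simp add: f_def)
    qed
  qed (simp add: f_def)
  then have \<psi>: "restrict f (ordered_simplices X m) \<in> carrier (CC m)" by (rule cochain_restrict[OF Kc])
  have "g = cochain_hom m (restrict f (ordered_simplices X m))"
  proof (rule mod_hom_eqI[OF g cochain_hom_hom[OF \<psi>]])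
    fix t assume "t \<in> carrier (content_module K U)"
    then have t: "t \<in> carrier K" by (simp add: content_module_simps)
    have gt: "g t = (\<lambda>y. t \<otimes> g \<one> y)"
      using mod_homD(3)[OF g A.scalar_closed[OF t] one] t
      by (simp add: content_module_scalar cores_scalar[OF g1 t])
    have g0: "g \<zero> = (\<lambda>_. \<zero>)"
      using mod_hom_zero[OF content_module_left cores_left_module g] by (simp add: content_module_simps cores_simps)
    have gc: "g t \<in> cores_set m" using mod_homD(1)[OF g] t by (simp add: cores_simps content_module_simps)
    show "g t = cochain_hom m (restrict f (ordered_simplices X m)) t"
    proof (rule cores_eqI[OF gc cochain_hom_closed[OF \<psi> t]])
      fix x vs assume x: "x \<in> ideal" and vs: "vs \<in> simplices x m"
      have "g t (x, vs) = g (if content x \<subseteq> U then t else \<zero>) (clique_elt (set vs), vs)"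
        using cores_hom_clique_elt[OF content_module_left g _ x vs, of t] t
        by (simp add: content_module_simps content_module_gen[OF ideal_closed[OF x] t])
      also have "\<dots> = (if content x \<subseteq> U then t \<otimes> f vs else \<zero>)"
        using simplices_X[OF x vs] gt g0 by (simp add: f_def)
      finally show "g t (x, vs) = cochain_hom m (restrict f (ordered_simplices X m)) t (x, vs)"
        unfolding cochain_hom_apply[OF t x vs] using simplices_X[OF x vs] by simp
    qed
  qed
  with \<psi> that show ?thesis by blast
qed

text \<open>Together with \<open>cochain_hom_surj\<close> and \<open>cochain_hom_inj\<close>, this
  identifies the homomorphisms from \<bbbk>_U into the coresolution with the augmented cochain
  complex of the cliques.\<close>

lemma cochain_hom_coboundary:
  assumes \<psi>: "\<psi> \<in> carrier (CC m)" and t: "t \<in> carrier K"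
  shows "cores_d m (cochain_hom m \<psi> t) = cochain_hom (Suc m) (\<delta> m \<psi>) t"
proof -
  note c = cochain_hom_closed[OF \<psi> t]
  show ?thesis
  proof (rule cores_eqI[OF cores_d_closed[OF c] cochain_hom_closed[OF coboundary_closed[OF Kc X_down \<psi>] t]])
    fix x vs assume x: "x \<in> ideal" and vs: "vs \<in> simplices x (Suc m)"
    show "cores_d m (cochain_hom m \<psi> t) (x, vs) = cochain_hom (Suc m) (\<delta> m \<psi>) t (x, vs)"
      unfolding cores_d_apply[OF c x vs] cochain_hom_apply[OF t x vs]
    proof (cases "content x \<subseteq> U")
      case True
      have "cobd K (\<lambda>u. cochain_hom m \<psi> t (x, u)) vs = cobd K (\<lambda>u. t \<otimes> zero_ext K X m \<psi> u) vs"
      proof (rule cobd_cong)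
        fix ys y zs assume "vs = ys @ y # zs"
        then have f: "ys @ zs \<in> simplices x m"
          using vs ordered_simplices_face[of "Pow (tops x)" ys y zs m] by auto
        show "cochain_hom m \<psi> t (x, ys @ zs) = t \<otimes> zero_ext K X m \<psi> (ys @ zs)"
          unfolding cochain_hom_apply[OF t x f]
          using True simplices_X[OF x f True] by (simp add: zero_ext_def[OF Kc X_down])
      qed
      also have "\<dots> = t \<otimes> cobd K (zero_ext K X m \<psi>) vs"
        by (rule cobd_smult[OF Kc zero_ext_val[OF Kc X_down \<psi>] t])
      finally show "cobd K (\<lambda>u. cochain_hom m \<psi> t (x, u)) vs =
          (if content x \<subseteq> U then t \<otimes> \<delta> m \<psi> vs else \<zero>)"
        unfolding coboundary_zero_ext[OF Kc X_down \<psi>] using True simplices_X[OF x vs True] by simp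
    next
      case False
      have "cochain_hom m \<psi> t (x, u) = \<zero>" for u using t False by (simp add: cochain_hom_def)
      then have "cobd K (\<lambda>u. cochain_hom m \<psi> t (x, u)) vs = \<zero>" by (rule cobd_zero[OF Kc])
      then show "cobd K (\<lambda>u. cochain_hom m \<psi> t (x, u)) vs =
          (if content x \<subseteq> U then t \<otimes> \<delta> m \<psi> vs else \<zero>)" using False by simp
    qed
  qed
qed

lemma cochain_hom_inj:
  assumes "\<psi> \<in> carrier (CC m)" "\<psi>' \<in> carrier (CC m)" "cochain_hom m \<psi> \<one> = cochain_hom m \<psi>' \<one>"
  shows "\<psi> = \<psi>'"
proof
  fix vs
  show "\<psi> vs = \<psi>' vs"
  proof (cases "vs \<in> ordered_simplices X m")
    case True
    note c = X_clique_elt[OF True]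
    have "cochain_hom m \<psi> \<one> (clique_elt (set vs), vs) = cochain_hom m \<psi>' \<one> (clique_elt (set vs), vs)"
      using assms(3) by simp
    then show ?thesis
      using cochain_val[OF Kc X_down assms(1) True] cochain_val[OF Kc X_down assms(2) True] c(3)
      by (simp add: cochain_hom_apply[OF K.one_closed c(1,2)])
  next
    case False
    then show ?thesis using assms(1,2) by (auto simp: cochain_module_def PiE_def extensional_def)
  qed
qed

end

section \<open>The Ext modules\<close>

context lrb_ext begin

text \<open>The cosyzygies: by \<open>cores_exact\<close>, \<open>syzygy (Suc n)\<close> is also the
  image of \<open>cores_d n\<close>, so \<open>cores n\<close> is an extension of
  \<open>syzygy (Suc n)\<close> by \<open>syzygy n\<close>.\<close>

definition syzygy :: "nat \<Rightarrow> ('v list set \<Rightarrow> 'k, 'v list set \<times> 'v list \<Rightarrow> 'k) module" where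
  "syzygy n = (cores n)\<lparr>carrier := {\<phi> \<in> carrier (cores n). cores_d n \<phi> = \<zero>\<^bsub>cores (Suc n)\<^esub>}\<rparr>"

lemma syzygy_left_module: "left_module AA (syzygy n)"
  unfolding syzygy_def
  by (rule submodule_left_module[OF cores_left_module])
     (rule submodule_kernel[OF cores_left_module cores_left_module cores_d_hom, unfolded a_kernel_def'])

lemma syzygy_simps:
  "carrier (syzygy n) = {\<phi> \<in> carrier (cores n). cores_d n \<phi> = \<zero>\<^bsub>cores (Suc n)\<^esub>}"
  "\<zero>\<^bsub>syzygy n\<^esub> = \<zero>\<^bsub>cores n\<^esub>"
  "\<phi> \<oplus>\<^bsub>syzygy n\<^esub> \<psi> = \<phi> \<oplus>\<^bsub>cores n\<^esub> \<psi>"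
  "f \<odot>\<^bsub>syzygy n\<^esub> \<phi> = f \<odot>\<^bsub>cores n\<^esub> \<phi>"
  by (simp_all add: syzygy_def)

lemma syzygy_image: "cores_d n ` carrier (cores n) = carrier (syzygy (Suc n))"
  unfolding cores_exact syzygy_simps ..

lemma mod_hom_syzygy_iff:
  "f \<in> mod_hom AA M (syzygy n) \<longleftrightarrow>
    f \<in> mod_hom AA M (cores n) \<and> (\<forall>x\<in>carrier M. cores_d n (f x) = \<zero>\<^bsub>cores (Suc n)\<^esub>)"
  by (auto simp: mod_hom_def syzygy_simps PiE_iff)

lemma cores_d_hom_syzygy: "cores_d n \<in> mod_hom AA (cores n) (syzygy (Suc n))"
  unfolding mod_hom_syzygy_iff using cores_d_hom cores_exact by blast

lemma syzygy_inclusion: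
  "(\<lambda>\<phi>\<in>carrier (syzygy n). \<phi>) \<in> mod_hom AA (syzygy n) (cores n)"
  using mod_hom_id[OF syzygy_left_module[of n]] by (simp add: mod_hom_syzygy_iff)

section \<open>Dimension shifting along the coresolution for the given resolution\<close>

context
  fixes P :: "nat \<Rightarrow> ('v list set \<Rightarrow> 'k, 'p) module" and d :: "nat \<Rightarrow> 'p \<Rightarrow> 'p" and e :: "'p \<Rightarrow> 'k"
  assumes res: "projective_resolution AA P d e (content_module K U)"
begin

lemmas resolutionD = projective_resolutionD[OF res]

lemma lift_syzygy:
  assumes "g \<in> mod_hom AA (P i) (syzygy (Suc n))"
  shows "\<exists>h\<in>mod_hom AA (P i) (cores n). \<forall>x\<in>carrier (P i). cores_d n (h x) = g x"
proof -
  have "g ` carrier (P i) \<subseteq> cores_d n ` carrier (cores n)"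
    unfolding syzygy_image using mod_homD(1)[OF assms] by blast
  then show ?thesis
  proof (rule projective_lift[OF resolutionD(2) cores_left_module syzygy_left_module cores_d_hom_syzygy assms])
    fix h assume "h \<in> mod_hom AA (P i) (cores n)" "\<And>x. x \<in> carrier (P i) \<Longrightarrow> cores_d n (h x) = g x"
    then show ?thesis by (intro bexI[of _ h] ballI)
  qed
qed

lemma d_d: "x \<in> carrier (P (Suc (Suc i))) \<Longrightarrow> d i (d (Suc i) x) = \<zero>\<^bsub>P i\<^esub>"
  using resolutionD(8)[of i] by blast

text \<open>The outcome of one shift. For positive \<open>i\<close> it is an Ext module of the next
  cosyzygy; for \<open>i = 0\<close> it is the cokernel of the map from Hom(\<bbbk>_U, cores n) to
  Hom(\<bbbk>_U, syzygy (Suc n)), where the cochains appear.\<close>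

abbreviation "shifted i n \<equiv> mod_quotient
  ((hom_module AA (P i) (syzygy (Suc n)))\<lparr>carrier := {g \<in> mod_hom AA (P i) (syzygy (Suc n)).
     \<forall>x\<in>carrier (P (Suc i)). g (d i x) = \<zero>\<^bsub>syzygy (Suc n)\<^esub>}\<rparr>)
  ((\<lambda>h. compose (carrier (P i)) (cores_d n) h) ` {h \<in> mod_hom AA (P i) (cores n).
     \<forall>x\<in>carrier (P (Suc i)). h (d i x) = \<zero>\<^bsub>cores n\<^esub>})"

lemma Ext_shift:
  fixes N :: "('v list set \<Rightarrow> 'k, 'n) module"
  assumes N: "left_module AA N" and \<iota>: "\<iota> \<in> mod_hom AA N (cores n)" "inj_on \<iota> (carrier N)"
    and exact: "\<iota> ` carrier N = {\<phi> \<in> carrier (cores n). cores_d n \<phi> = \<zero>\<^bsub>cores (Suc n)\<^esub>}"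
  shows "mod_isomorphic K (Ext AA P d N (Suc i)) (shifted i n)"
  unfolding A.Ext_Suc
proof (rule A.dimension_shift[OF resolutionD(3) resolutionD(3) resolutionD(3) resolutionD(5) resolutionD(5) d_d N cores_left_module syzygy_left_module \<iota> cores_d_hom_syzygy])
  show "\<iota> ` carrier N = {y \<in> carrier (cores n). cores_d n y = \<zero>\<^bsub>syzygy (Suc n)\<^esub>}"
    unfolding exact syzygy_simps ..
  show "\<exists>h\<in>mod_hom AA (P i) (cores n). \<forall>x\<in>carrier (P i). cores_d n (h x) = g x"
    if "g \<in> mod_hom AA (P i) (syzygy (Suc n))" for g by (rule lift_syzygy[OF that])
  show "\<exists>h\<in>mod_hom AA (P i) (cores n). \<forall>x\<in>carrier (P (Suc i)). h (d i x) = f x"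
    if "f \<in> mod_hom AA (P (Suc i)) (cores n)"
      "\<And>x. x \<in> carrier (P (Suc (Suc i))) \<Longrightarrow> f (d (Suc i) x) = \<zero>\<^bsub>cores n\<^esub>" for f
    by (rule cores_acyclic[OF res that])
qed

text \<open>Only the denominators differ. A cocycle with values in \<open>cores n\<close> is some
  \<open>k\<close> after \<open>d i\<close> by acyclicity, so its image is the coboundary of
  \<open>cores_d n\<close> after \<open>k\<close>. Conversely a map from \<open>P i\<close> into the
  cosyzygy lifts to \<open>cores n\<close> by projectivity, and the lift after \<open>d i\<close> is
  a cocycle.\<close>

lemma shifted_Suc: "shifted (Suc i) n = Ext AA P d (syzygy (Suc n)) (Suc i)"
  unfolding A.Ext_Suc
proof (rule arg_cong2[where f = mod_quotient, OF refl], intro equalityI subsetI)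
  let ?p = "\<lambda>h. compose (carrier (P (Suc i))) (cores_d n) h" and ?q = "\<lambda>f. compose (carrier (P (Suc i))) f (d i)"
  have key: "?p h = ?q (compose (carrier (P i)) (cores_d n) k)"
    if "\<And>x. x \<in> carrier (P (Suc i)) \<Longrightarrow> k (d i x) = h x" for h k
    unfolding compose_def by (rule restrict_ext) (simp add: that mod_homD(1)[OF resolutionD(5)])
  {
    fix g assume "g \<in> ?p ` {h \<in> mod_hom AA (P (Suc i)) (cores n).
      \<forall>x\<in>carrier (P (Suc (Suc i))). h (d (Suc i) x) = \<zero>\<^bsub>cores n\<^esub>}"
    then obtain h where h: "h \<in> mod_hom AA (P (Suc i)) (cores n)" "g = ?p h"
      "\<And>x. x \<in> carrier (P (Suc (Suc i))) \<Longrightarrow> h (d (Suc i) x) = \<zero>\<^bsub>cores n\<^esub>" by blast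
    obtain k where k: "k \<in> mod_hom AA (P i) (cores n)" "\<forall>x\<in>carrier (P (Suc i)). k (d i x) = h x"
      using cores_acyclic[OF res h(1,3)] by blast
    have "g = ?q (compose (carrier (P i)) (cores_d n) k)" unfolding h(2) using k(2) by (intro key) blast
    then show "g \<in> ?q ` mod_hom AA (P i) (syzygy (Suc n))"
      using mod_hom_compose[OF resolutionD(3) k(1) cores_d_hom_syzygy] by blast
  next
    fix g assume "g \<in> ?q ` mod_hom AA (P i) (syzygy (Suc n))"
    then obtain f where f: "f \<in> mod_hom AA (P i) (syzygy (Suc n))" "g = ?q f" by blast
    obtain k where k: "k \<in> mod_hom AA (P i) (cores n)" "\<forall>x\<in>carrier (P i). cores_d n (k x) = f x"
      using lift_syzygy[OF f(1)] by blast
    have "compose (carrier (P i)) (cores_d n) k = f"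
      by (rule mod_hom_eqI[OF mod_hom_compose[OF resolutionD(3) k(1) cores_d_hom_syzygy] f(1)])
         (use k(2) in \<open>simp add: compose_def\<close>)
    moreover have "?p (?q k) = ?q (compose (carrier (P i)) (cores_d n) k)"
      by (rule key) (simp add: compose_def)
    ultimately have "g = ?p (?q k)" using f(2) by simp
    moreover have "?q k \<in> mod_hom AA (P (Suc i)) (cores n)" by (rule mod_hom_compose[OF resolutionD(3) resolutionD(5) k(1)])
    moreover have "?q k (d (Suc i) x) = \<zero>\<^bsub>cores n\<^esub>" if "x \<in> carrier (P (Suc (Suc i)))" for x
      using mod_homD(1)[OF resolutionD(5) that] d_d[OF that] mod_hom_zero[OF resolutionD(3) cores_left_module k(1)]
      by (simp add: compose_def)
    ultimately show "g \<in> ?p ` {h \<in> mod_hom AA (P (Suc i)) (cores n).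
      \<forall>x\<in>carrier (P (Suc (Suc i))). h (d (Suc i) x) = \<zero>\<^bsub>cores n\<^esub>}" by blast
  }
qed

text \<open>Vanishing on the image of \<open>d 0\<close>, the kernel of the augmentation, means
  factoring through \<bbbk>_U, where \<open>cochain_hom_surj\<close> applies.\<close>

lemma hom_factor_cochain:
  assumes h: "h \<in> mod_hom AA (P 0) (cores m)"
    and h0: "\<And>x. x \<in> carrier (P (Suc 0)) \<Longrightarrow> h (d 0 x) = \<zero>\<^bsub>cores m\<^esub>"
  obtains \<psi> where "\<psi> \<in> carrier (CC m)" "\<And>p. p \<in> carrier (P 0) \<Longrightarrow> h p = cochain_hom m \<psi> (e p)"
proof -
  have "h x = \<zero>\<^bsub>cores m\<^esub>" if "x \<in> carrier (P 0)" "e x = \<zero>\<^bsub>content_module K U\<^esub>" for x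
  proof -
    have "x \<in> d 0 ` carrier (P (Suc 0))" unfolding resolutionD(7) using that by simp
    then show ?thesis using h0 by blast
  qed
  then obtain g where g: "g \<in> mod_hom AA (content_module K U) (cores m)" "\<And>x. x \<in> carrier (P 0) \<Longrightarrow> g (e x) = h x"
    using mod_hom_factor[OF resolutionD(3) resolutionD(1) cores_left_module resolutionD(4) resolutionD(6) h] by blast
  obtain \<psi> where "\<psi> \<in> carrier (CC m)" "g = cochain_hom m \<psi>" using cochain_hom_surj[OF g(1)] .
  then show ?thesis using g(2) that by metis
qed

lemma cochain_pullback:
  assumes "\<psi> \<in> carrier (CC m)"
  shows "compose (carrier (P 0)) (cochain_hom m \<psi>) e \<in> mod_hom AA (P 0) (cores m)"
    and "x \<in> carrier (P (Suc 0)) \<Longrightarrow> compose (carrier (P 0)) (cochain_hom m \<psi>) e (d 0 x) = \<zero>\<^bsub>cores m\<^esub>"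
proof -
  show "compose (carrier (P 0)) (cochain_hom m \<psi>) e \<in> mod_hom AA (P 0) (cores m)"
    by (rule mod_hom_compose[OF resolutionD(3) resolutionD(4) cochain_hom_hom[OF assms]])
  assume "x \<in> carrier (P (Suc 0))"
  then have "d 0 x \<in> carrier (P 0) \<and> e (d 0 x) = \<zero>\<^bsub>content_module K U\<^esub>" using resolutionD(7) by blast
  then show "compose (carrier (P 0)) (cochain_hom m \<psi>) e (d 0 x) = \<zero>\<^bsub>cores m\<^esub>"
    using mod_hom_zero[OF resolutionD(1) cores_left_module cochain_hom_hom[OF assms]] by (simp add: compose_def)
qed

text \<open>\<open>CC\<close> is indexed by the number of vertices, so homomorphisms into
  \<open>syzygy (Suc n)\<close> give cocycles in \<open>CC (Suc n)\<close>, that is, in degree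
  \<open>n\<close> of the reduced cohomology.\<close>

lemma shifted_0: "mod_isomorphic K (shifted 0 n) (reduced_cohomology K X n)"
proof -
  let ?H = "hom_module AA (P 0) (syzygy (Suc n))"
  let ?Z = "{g \<in> mod_hom AA (P 0) (syzygy (Suc n)). \<forall>x\<in>carrier (P (Suc 0)). g (d 0 x) = \<zero>\<^bsub>syzygy (Suc n)\<^esub>}"
  let ?B = "(\<lambda>h. compose (carrier (P 0)) (cores_d n) h) ` {h \<in> mod_hom AA (P 0) (cores n).
     \<forall>x\<in>carrier (P (Suc 0)). h (d 0 x) = \<zero>\<^bsub>cores n\<^esub>}"
  let ?Z' = "cocycles CC \<delta> (Suc n)" and ?B' = "coboundaries CC \<delta> (Suc n)"
  have d0: "d 0 ` carrier (P (Suc 0)) \<subseteq> carrier (P 0)" unfolding resolutionD(7) by blast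
  have Z: "submodule_of K ?H ?Z" using A.submodule_hom_vanishing[OF resolutionD(3) syzygy_left_module d0] by simp
  have B: "submodule_of K (?H\<lparr>carrier := ?Z\<rparr>) ?B"
    by (rule A.submodule_shift_boundaries[OF resolutionD(3) d0 cores_left_module syzygy_left_module cores_d_hom_syzygy])
  note Z' = cochain_submodules(1)[OF Kc X_down, of "Suc n"] and B' = cochain_submodules(2)[OF Kc X_down, of n]
  have Z'D: "\<psi> \<in> ?Z' \<longleftrightarrow> \<psi> \<in> carrier (CC (Suc n)) \<and> \<delta> (Suc n) \<psi> = \<zero>\<^bsub>CC (Suc (Suc n))\<^esub>" for \<psi>
    by (auto simp: cocycles_def a_kernel_def')
  have B'D: "?B' = \<delta> n ` carrier (CC n)" by (simp add: coboundaries_def)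
  have eK: "e p \<in> carrier K" if "p \<in> carrier (P 0)" for p
    using mod_homD(1)[OF resolutionD(4) that] by (simp add: content_module_simps)
  have eim: "\<exists>p\<in>carrier (P 0). e p = t" if "t \<in> carrier K" for t
    using resolutionD(6) that unfolding content_module_simps by (metis imageE)
  have inj: "\<psi> = \<psi>'" if "\<psi> \<in> carrier (CC m)" "\<psi>' \<in> carrier (CC m)"
    "\<And>p. p \<in> carrier (P 0) \<Longrightarrow> cochain_hom m \<psi> (e p) = cochain_hom m \<psi>' (e p)" for \<psi> \<psi>' m
  proof -
    obtain p where "p \<in> carrier (P 0)" "e p = \<one>" using eim[of "\<one>"] by auto
    then show ?thesis using cochain_hom_inj[OF that(1,2)] that(3)[of p] by simp
  qed
  have hom0: "cochain_hom m \<zero>\<^bsub>CC m\<^esub> t = \<zero>\<^bsub>cores m\<^esub>" if "t \<in> carrier K" for m t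
  proof
    fix y :: "'v list set \<times> 'v list"
    obtain x vs where y: "y = (x, vs)" by (cases y)
    show "cochain_hom m \<zero>\<^bsub>CC m\<^esub> t y = \<zero>\<^bsub>cores m\<^esub> y"
      using that simplices_X[of x vs m] by (auto simp: y cochain_hom_def cores_simps cochain_module_def)
  qed
  \<comment> \<open>\<rho> pairs a homomorphism on \<open>P 0\<close> with the cochain that
    describes its factor through the augmentation.\<close>
  define \<rho> where "\<rho> g \<psi> \<longleftrightarrow> (\<forall>p\<in>carrier (P 0). g p = cochain_hom (Suc n) \<psi> (e p))" for g \<psi>
  have "mod_isomorphic K (mod_quotient (?H\<lparr>carrier := ?Z\<rparr>) ?B) (mod_quotient ((CC (Suc n))\<lparr>carrier := ?Z'\<rparr>) ?B')"
  proof (rule quotient_isomorphic_relation[OF submodule_left_module[OF A.hom_module_left_module[OF resolutionD(3) syzygy_left_module] Z]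
      submodule_left_module[OF cochain_module_left_module[OF Kc] Z'] B B', of \<rho>])
    fix g h \<psi> \<theta> assume \<rho>: "\<rho> g \<psi>" "\<rho> h \<theta>"
      and "\<psi> \<in> carrier ((CC (Suc n))\<lparr>carrier := ?Z'\<rparr>)" "\<theta> \<in> carrier ((CC (Suc n))\<lparr>carrier := ?Z'\<rparr>)"
    then have c: "\<psi> \<in> carrier (CC (Suc n))" "\<theta> \<in> carrier (CC (Suc n))" by (simp_all add: Z'D)
    have "(\<lambda>y. cochain_hom (Suc n) \<psi> t y \<oplus> cochain_hom (Suc n) \<theta> t y) = cochain_hom (Suc n) (\<psi> \<oplus>\<^bsub>CC (Suc n)\<^esub> \<theta>) t"
      if t: "t \<in> carrier K" for t
    proof
      fix y :: "'v list set \<times> 'v list"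
      obtain x vs where y: "y = (x, vs)" by (cases y)
      show "cochain_hom (Suc n) \<psi> t y \<oplus> cochain_hom (Suc n) \<theta> t y = cochain_hom (Suc n) (\<psi> \<oplus>\<^bsub>CC (Suc n)\<^esub> \<theta>) t y"
        using t simplices_X[of x vs "Suc n"] cochain_val[OF Kc X_down c(1), of vs] cochain_val[OF Kc X_down c(2), of vs]
        by (auto simp: y cochain_hom_def cochain_ops[OF Kc X_down] K.r_distr)
    qed
    then show "\<rho> (g \<oplus>\<^bsub>?H\<lparr>carrier := ?Z\<rparr>\<^esub> h) (\<psi> \<oplus>\<^bsub>(CC (Suc n))\<lparr>carrier := ?Z'\<rparr>\<^esub> \<theta>)"
      using \<rho> eK by (simp add: \<rho>_def hom_module_simps syzygy_simps cores_simps)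
  next
    fix a g \<psi> assume \<rho>: "\<rho> g \<psi>" and a: "a \<in> carrier K" and "\<psi> \<in> carrier ((CC (Suc n))\<lparr>carrier := ?Z'\<rparr>)"
    then have c: "\<psi> \<in> carrier (CC (Suc n))" by (simp add: Z'D)
    have "A.scal a \<odot>\<^bsub>cores (Suc n)\<^esub> cochain_hom (Suc n) \<psi> t = cochain_hom (Suc n) (a \<odot>\<^bsub>CC (Suc n)\<^esub> \<psi>) t"
      if t: "t \<in> carrier K" for t
      unfolding cores_scalar[OF cochain_hom_closed[OF c t] a]
    proof
      fix y :: "'v list set \<times> 'v list"
      obtain x vs where y: "y = (x, vs)" by (cases y)
      show "a \<otimes> cochain_hom (Suc n) \<psi> t y = cochain_hom (Suc n) (a \<odot>\<^bsub>CC (Suc n)\<^esub> \<psi>) t y"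
        using t a simplices_X[of x vs "Suc n"] cochain_val[OF Kc X_down c(1), of vs]
        by (auto simp: y cochain_hom_def cochain_ops[OF Kc X_down] K.m_lcomm)
    qed
    then show "\<rho> (a \<odot>\<^bsub>?H\<lparr>carrier := ?Z\<rparr>\<^esub> g) (a \<odot>\<^bsub>(CC (Suc n))\<lparr>carrier := ?Z'\<rparr>\<^esub> \<psi>)"
      using \<rho> eK by (simp add: \<rho>_def hom_module_simps syzygy_simps)
  next
    fix g assume "g \<in> carrier (?H\<lparr>carrier := ?Z\<rparr>)"
    then have g: "g \<in> mod_hom AA (P 0) (cores (Suc n))"
        "\<And>x. x \<in> carrier (P 0) \<Longrightarrow> cores_d (Suc n) (g x) = \<zero>\<^bsub>cores (Suc (Suc n))\<^esub>"
        "\<And>x. x \<in> carrier (P (Suc 0)) \<Longrightarrow> g (d 0 x) = \<zero>\<^bsub>cores (Suc n)\<^esub>"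
      by (auto simp: mod_hom_syzygy_iff syzygy_simps)
    obtain \<psi> where \<psi>: "\<psi> \<in> carrier (CC (Suc n))" "\<And>p. p \<in> carrier (P 0) \<Longrightarrow> g p = cochain_hom (Suc n) \<psi> (e p)"
      using hom_factor_cochain[OF g(1,3)] by blast
    have zc: "\<zero>\<^bsub>CC (Suc (Suc n))\<^esub> \<in> carrier (CC (Suc (Suc n)))"
      by (rule submodule_ofD(1)[OF cochain_submodules(1)[OF Kc X_down]], rule submodule_ofD(2)[OF cochain_submodules(1)[OF Kc X_down]])
    \<comment> \<open>Closedness of \<open>g\<close> under \<open>cores_d\<close> passes to \<psi>,
      because a cochain is determined by its homomorphism at a preimage of
      \<open>\<one>\<close>.\<close>
    have "\<delta> (Suc n) \<psi> = \<zero>\<^bsub>CC (Suc (Suc n))\<^esub>"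
    proof (rule inj[OF coboundary_closed[OF Kc X_down \<psi>(1)] zc])
      fix p assume p: "p \<in> carrier (P 0)"
      show "cochain_hom (Suc (Suc n)) (\<delta> (Suc n) \<psi>) (e p) = cochain_hom (Suc (Suc n)) \<zero>\<^bsub>CC (Suc (Suc n))\<^esub> (e p)"
        using g(2)[OF p] unfolding \<psi>(2)[OF p] cochain_hom_coboundary[OF \<psi>(1) eK[OF p]] hom0[OF eK[OF p]] .
    qed
    then show "\<exists>\<psi>\<in>carrier ((CC (Suc n))\<lparr>carrier := ?Z'\<rparr>). \<rho> g \<psi>"
      using \<psi> by (auto simp: \<rho>_def Z'D)
  next
    fix \<psi> assume "\<psi> \<in> carrier ((CC (Suc n))\<lparr>carrier := ?Z'\<rparr>)"
    then have \<psi>: "\<psi> \<in> carrier (CC (Suc n))" "\<delta> (Suc n) \<psi> = \<zero>\<^bsub>CC (Suc (Suc n))\<^esub>" by (simp_all add: Z'D)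
    let ?g = "compose (carrier (P 0)) (cochain_hom (Suc n) \<psi>) e"
    have "cores_d (Suc n) (?g p) = \<zero>\<^bsub>cores (Suc (Suc n))\<^esub>" if p: "p \<in> carrier (P 0)" for p
      using cochain_hom_coboundary[OF \<psi>(1) eK[OF p]] hom0[OF eK[OF p]] p by (simp add: compose_def \<psi>(2))
    then have "?g \<in> ?Z" using cochain_pullback[OF \<psi>(1)] by (simp add: mod_hom_syzygy_iff syzygy_simps)
    moreover have "\<rho> ?g \<psi>" by (simp add: \<rho>_def compose_def)
    ultimately show "\<exists>g\<in>carrier (?H\<lparr>carrier := ?Z\<rparr>). \<rho> g \<psi>" by auto
  next
    fix g \<psi> assume \<rho>: "\<rho> g \<psi>" and "g \<in> carrier (?H\<lparr>carrier := ?Z\<rparr>)" "\<psi> \<in> carrier ((CC (Suc n))\<lparr>carrier := ?Z'\<rparr>)"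
    then have g: "g \<in> mod_hom AA (P 0) (cores (Suc n))" and \<psi>: "\<psi> \<in> carrier (CC (Suc n))"
      by (simp_all add: mod_hom_syzygy_iff Z'D)
    show "g \<in> ?B \<longleftrightarrow> \<psi> \<in> ?B'"
    proof
      assume "g \<in> ?B"
      then obtain h where h: "h \<in> mod_hom AA (P 0) (cores n)" "g = compose (carrier (P 0)) (cores_d n) h"
        "\<And>x. x \<in> carrier (P (Suc 0)) \<Longrightarrow> h (d 0 x) = \<zero>\<^bsub>cores n\<^esub>" by blast
      obtain \<theta> where \<theta>: "\<theta> \<in> carrier (CC n)" "\<And>p. p \<in> carrier (P 0) \<Longrightarrow> h p = cochain_hom n \<theta> (e p)"
        using hom_factor_cochain[OF h(1,3)] by blast
      have "\<psi> = \<delta> n \<theta>"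
      proof (rule inj[OF \<psi> coboundary_closed[OF Kc X_down \<theta>(1)]])
        fix p assume p: "p \<in> carrier (P 0)"
        have "cochain_hom (Suc n) \<psi> (e p) = g p" using \<rho> p by (simp add: \<rho>_def)
        also have "\<dots> = cores_d n (cochain_hom n \<theta> (e p))" using p by (simp add: h(2) compose_def \<theta>(2))
        also have "\<dots> = cochain_hom (Suc n) (\<delta> n \<theta>) (e p)" by (rule cochain_hom_coboundary[OF \<theta>(1) eK[OF p]])
        finally show "cochain_hom (Suc n) \<psi> (e p) = cochain_hom (Suc n) (\<delta> n \<theta>) (e p)" .
      qed
      then show "\<psi> \<in> ?B'" unfolding B'D using \<theta>(1) by blast
    next
      assume "\<psi> \<in> ?B'"
      then obtain \<theta> where \<theta>: "\<theta> \<in> carrier (CC n)" "\<psi> = \<delta> n \<theta>" unfolding B'D by blast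
      let ?h = "compose (carrier (P 0)) (cochain_hom n \<theta>) e"
      note h = cochain_pullback[OF \<theta>(1)]
      have "g = compose (carrier (P 0)) (cores_d n) ?h"
      proof (rule mod_hom_eqI[OF g mod_hom_compose[OF resolutionD(3) h(1) cores_d_hom]])
        fix p assume p: "p \<in> carrier (P 0)"
        show "g p = compose (carrier (P 0)) (cores_d n) ?h p"
          using \<rho> p cochain_hom_coboundary[OF \<theta>(1) eK[OF p]] by (simp add: \<rho>_def compose_def \<theta>(2))
      qed
      then show "g \<in> ?B" using h by blast
    qed
  qed
  then show ?thesis by (simp add: reduced_cohomology_def cohomology_def)
qed

text \<open>Each shift lowers the Ext degree by one and moves one step along the coresolution, so
  \<open>n + i\<close> is constant in the induction until \<open>shifted_0\<close> ends it.\<close>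

lemma Ext_syzygy: "mod_isomorphic K (Ext AA P d (syzygy n) (Suc i)) (reduced_cohomology K X (n + i))"
proof (induction i arbitrary: n)
  have shift: "mod_isomorphic K (Ext AA P d (syzygy n) (Suc i)) (shifted i n)" for i n
    by (rule Ext_shift[OF syzygy_left_module syzygy_inclusion]) (auto simp: syzygy_simps inj_on_def)
  {
    case 0
    show ?case using mod_isomorphic_trans[OF shift shifted_0 A.Ext_closed[OF res syzygy_left_module]] by simp
  next
    case (Suc i)
    show ?case
      using mod_isomorphic_trans[OF shift[of n "Suc i", unfolded shifted_Suc] Suc.IH[of "Suc n"]
        A.Ext_closed[OF res syzygy_left_module]] by simp
  }
qed

text \<open>\<bbbk>_W is only isomorphic to \<open>syzygy 0\<close>, so the first shift uses
  \<open>cores_aug\<close> in place of an inclusion; the remaining ones are those of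
  \<open>Ext_syzygy\<close>, beginning at \<open>syzygy (Suc 0)\<close>.\<close>

lemma Ext_content_module:
  "mod_isomorphic K (Ext AA P d (content_module K W) (Suc i)) (reduced_cohomology K X i)"
proof -
  note shift = Ext_shift[OF content_module_left cores_aug_hom cores_aug_inj cores_exact_0]
  note trans = mod_isomorphic_trans[OF shift _ A.Ext_closed[OF res content_module_left]]
  show ?thesis
  proof (cases i)
    case 0
    then show ?thesis using trans[OF shifted_0] by simp
  next
    case (Suc j)
    have "mod_isomorphic K (shifted i 0) (reduced_cohomology K X i)"
      unfolding Suc shifted_Suc using Ext_syzygy[of "Suc 0" j] by simp
    then show ?thesis by (rule trans)
  qed
qed

end

end

theorem theorem15:
  fixes K :: "('k, 'z) ring_scheme"
    and V W U :: "'v set" and E :: "'v set set"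
    and P :: "nat \<Rightarrow> ('v list set \<Rightarrow> 'k, 'p) module"
    and d :: "nat \<Rightarrow> 'p \<Rightarrow> 'p" and e :: "'p \<Rightarrow> 'k"
    and n :: nat
  assumes "simple_graph V E"
    and "cring K"
    and "W \<subset> U" and "U \<subseteq> V"
    and "n \<ge> 1"
    and "projective_resolution (lrb_algebra K V E) P d e (content_module K U)"
  shows "mod_isomorphic K
           (Ext (lrb_algebra K V E) P d (content_module K W) n)
           (reduced_cohomology K (clique_complex (U - W) (induced_edges E (U - W))) (n - 1))"
proof -
  interpret lrb_ext V E W K U
    using assms by (auto simp: lrb_ext_def lrb_ext_axioms_def lrb_coefficients_def lrb_pair_def)
  show ?thesis using Ext_content_module[OF assms(6), of "n - 1"] \<open>n \<ge> 1\<close> by simp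
qed

end
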